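(* Let $K$ be a set and let $\mathsf{CW}_K$ be the category whose objects are the syntactic propositions over $K$ and whose morphisms $(X,S)\to(Y,T)$ are the binary relations $R\subseteq X\times Y$ that respect labels and satisfy the resolution condition: for every $t\in T$, $R^{-1}(t)=\{x:\exists y\in t,\ xRy\}\in S$, and for every $\alpha\in S^{\perp}$, $R(\alpha)=\{y:\exists x\in\alpha,\ xRy\}\in T^{\perp}$; composition is relational composition. Then $\mathsf{CW}_K$ is the free category with binary products and binary sums (coproducts) generated by the set $K$, in the standard 2-categorical sense of freeness (with the generator $k\in K$ corresponding to the proposition with a single leaf labelled $k$ and resolution set $\{\{x\}\}$).
   Context: For subsets $s,t$ of a set $X$, $s\perp t$ means $s\cap t$ has exactly one element; for a set $S$ of subsets of $X$, $S^{\perp}=\{t\subseteq X: t\perp s\ \forall s\in S\}$. An abstract proposition with labels in $K$ is a pair $(X,S)$ with $X$ a set of leaves labelled by elements of $K$ and $S$ a set of subsets of $X$ (resolutions) with $S^{\perp\perp}=S$. A syntactic proposition arises from a formula $\phi$ built from elements of $K$ with binary $\wedge,\vee$ (no constants): $X$ is the set of leaf occurrences of $\phi$, and $S$ the set of maximal sets of leaves no two of which meet at a $\wedge$-node of the parse tree. In $\mathsf{CW}_K$, the sum of $(X,S)$ and $(Y,T)$ is $(X+Y,\{s+t: s\in S,t\in T\})$ and the product is $(X+Y, S\cup T)$ (resolutions of either component, viewed in the disjoint union). *)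

theory Defs
  imports Main "HOL-Library.FuncSet"
begin

section \<open>Categories, functors and natural transformations\<close>

record ('o, 'm) cat =
  Obj :: "'o set"
  Arr :: "'m set"
  Dom :: "'m \<Rightarrow> 'o"
  Cod :: "'m \<Rightarrow> 'o"
  Ide :: "'o \<Rightarrow> 'm"
  Cmp :: "'m \<Rightarrow> 'm \<Rightarrow> 'm"  \<comment> \<open>\<open>Cmp C g f\<close> is \<open>g\<close> after \<open>f\<close>\<close>

definition hom :: "('o, 'm) cat \<Rightarrow> 'o \<Rightarrow> 'o \<Rightarrow> 'm set" where
  "hom C a b = {f \<in> Arr C. Dom C f = a \<and> Cod C f = b}"

definition category :: "('o, 'm) cat \<Rightarrow> bool" where
  "category C \<longleftrightarrow>
     (\<forall>f\<in>Arr C. Dom C f \<in> Obj C \<and> Cod C f \<in> Obj C) \<and>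
     (\<forall>a\<in>Obj C. Ide C a \<in> hom C a a) \<and>
     (\<forall>f\<in>Arr C. \<forall>g\<in>Arr C. Cod C f = Dom C g \<longrightarrow>
        Cmp C g f \<in> hom C (Dom C f) (Cod C g)) \<and>
     (\<forall>f\<in>Arr C. Cmp C f (Ide C (Dom C f)) = f \<and> Cmp C (Ide C (Cod C f)) f = f) \<and>
     (\<forall>f\<in>Arr C. \<forall>g\<in>Arr C. \<forall>h\<in>Arr C. Cod C f = Dom C g \<longrightarrow> Cod C g = Dom C h \<longrightarrow>
        Cmp C h (Cmp C g f) = Cmp C (Cmp C h g) f)"

definition is_iso :: "('o, 'm) cat \<Rightarrow> 'm \<Rightarrow> bool" where
  "is_iso C f \<longleftrightarrow> f \<in> Arr C \<and>
     (\<exists>g\<in>hom C (Cod C f) (Dom C f).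
        Cmp C g f = Ide C (Dom C f) \<and> Cmp C f g = Ide C (Cod C f))"

definition discrete :: "'k set \<Rightarrow> ('k, 'k) cat" where
  "discrete K = \<lparr>Obj = K, Arr = K, Dom = (\<lambda>k. k), Cod = (\<lambda>k. k),
     Ide = (\<lambda>k. k), Cmp = (\<lambda>g f. f)\<rparr>"

text \<open>Functors and natural transformations are \<open>extensional\<close> (\<open>undefined\<close> off their
  domain), so that equality in HOL is the mathematical equality.\<close>

record ('o1, 'm1, 'o2, 'm2) func =
  FObj :: "'o1 \<Rightarrow> 'o2"
  FArr :: "'m1 \<Rightarrow> 'm2"

definition is_functor ::
  "('o1, 'm1) cat \<Rightarrow> ('o2, 'm2) cat \<Rightarrow> ('o1, 'm1, 'o2, 'm2) func \<Rightarrow> bool" where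
  "is_functor C D F \<longleftrightarrow> category C \<and> category D \<and>
     FObj F \<in> Obj C \<rightarrow>\<^sub>E Obj D \<and>
     FArr F \<in> Arr C \<rightarrow>\<^sub>E Arr D \<and>
     (\<forall>f\<in>Arr C. FArr F f \<in> hom D (FObj F (Dom C f)) (FObj F (Cod C f))) \<and>
     (\<forall>a\<in>Obj C. FArr F (Ide C a) = Ide D (FObj F a)) \<and>
     (\<forall>f\<in>Arr C. \<forall>g\<in>Arr C. Cod C f = Dom C g \<longrightarrow>
        FArr F (Cmp C g f) = Cmp D (FArr F g) (FArr F f))"

definition id_functor :: "('o, 'm) cat \<Rightarrow> ('o, 'm, 'o, 'm) func" where
  "id_functor C = \<lparr>FObj = (\<lambda>a\<in>Obj C. a), FArr = (\<lambda>f\<in>Arr C. f)\<rparr>"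

definition comp_functor :: "('o1, 'm1) cat \<Rightarrow> ('o2, 'm2, 'o3, 'm3) func \<Rightarrow>
    ('o1, 'm1, 'o2, 'm2) func \<Rightarrow> ('o1, 'm1, 'o3, 'm3) func" where
  "comp_functor C G F =
     \<lparr>FObj = (\<lambda>a\<in>Obj C. FObj G (FObj F a)), FArr = (\<lambda>f\<in>Arr C. FArr G (FArr F f))\<rparr>"

definition nat_trans :: "('o1, 'm1) cat \<Rightarrow> ('o2, 'm2) cat \<Rightarrow> ('o1, 'm1, 'o2, 'm2) func \<Rightarrow>
    ('o1, 'm1, 'o2, 'm2) func \<Rightarrow> ('o1 \<Rightarrow> 'm2) \<Rightarrow> bool" where
  "nat_trans C D F G \<eta> \<longleftrightarrow> is_functor C D F \<and> is_functor C D G \<and>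
     \<eta> \<in> extensional (Obj C) \<and>
     (\<forall>a\<in>Obj C. \<eta> a \<in> hom D (FObj F a) (FObj G a)) \<and>
     (\<forall>f\<in>Arr C. Cmp D (\<eta> (Cod C f)) (FArr F f) = Cmp D (FArr G f) (\<eta> (Dom C f)))"

definition naturally_isomorphic :: "('o1, 'm1) cat \<Rightarrow> ('o2, 'm2) cat \<Rightarrow>
    ('o1, 'm1, 'o2, 'm2) func \<Rightarrow> ('o1, 'm1, 'o2, 'm2) func \<Rightarrow> bool" where
  "naturally_isomorphic C D F G \<longleftrightarrow>
     (\<exists>\<eta>. nat_trans C D F G \<eta> \<and> (\<forall>a\<in>Obj C. is_iso D (\<eta> a)))"

definition is_equivalence ::
  "('o1, 'm1) cat \<Rightarrow> ('o2, 'm2) cat \<Rightarrow> ('o1, 'm1, 'o2, 'm2) func \<Rightarrow> bool" where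
  "is_equivalence C D F \<longleftrightarrow> is_functor C D F \<and>
     (\<exists>G. is_functor D C G \<and>
        naturally_isomorphic C C (comp_functor C G F) (id_functor C) \<and>
        naturally_isomorphic D D (comp_functor D F G) (id_functor D))"

type_synonym ('o1, 'm1, 'o2, 'm2) nat_arrow =
  "('o1, 'm1, 'o2, 'm2) func \<times> ('o1 \<Rightarrow> 'm2) \<times> ('o1, 'm1, 'o2, 'm2) func"

definition functor_category :: "('o1, 'm1) cat \<Rightarrow> ('o2, 'm2) cat \<Rightarrow>
    (('o1, 'm1, 'o2, 'm2) func, ('o1, 'm1, 'o2, 'm2) nat_arrow) cat" where
  "functor_category C D =
     \<lparr>Obj = {F. is_functor C D F},
      Arr = {(F, \<eta>, G). nat_trans C D F G \<eta>},
      Dom = (\<lambda>(F, \<eta>, G). F),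
      Cod = (\<lambda>(F, \<eta>, G). G),
      Ide = (\<lambda>F. (F, \<lambda>a\<in>Obj C. Ide D (FObj F a), F)),
      Cmp = (\<lambda>(G, \<theta>, H) (F, \<eta>, G'). (F, \<lambda>a\<in>Obj C. Cmp D (\<theta> a) (\<eta> a), H))\<rparr>"

definition full_subcategory :: "('o, 'm) cat \<Rightarrow> ('o \<Rightarrow> bool) \<Rightarrow> ('o, 'm) cat" where
  "full_subcategory C P =
     C\<lparr>Obj := {a \<in> Obj C. P a}, Arr := {f \<in> Arr C. P (Dom C f) \<and> P (Cod C f)}\<rparr>"

section \<open>Binary products and sums\<close>

definition is_product :: "('o, 'm) cat \<Rightarrow> 'o \<Rightarrow> 'o \<Rightarrow> 'o \<Rightarrow> 'm \<Rightarrow> 'm \<Rightarrow> bool" where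
  "is_product C a b p \<pi>\<^sub>1 \<pi>\<^sub>2 \<longleftrightarrow>
     p \<in> Obj C \<and> \<pi>\<^sub>1 \<in> hom C p a \<and> \<pi>\<^sub>2 \<in> hom C p b \<and>
     (\<forall>c\<in>Obj C. \<forall>f\<in>hom C c a. \<forall>g\<in>hom C c b.
        \<exists>!h. h \<in> hom C c p \<and> Cmp C \<pi>\<^sub>1 h = f \<and> Cmp C \<pi>\<^sub>2 h = g)"

definition is_sum :: "('o, 'm) cat \<Rightarrow> 'o \<Rightarrow> 'o \<Rightarrow> 'o \<Rightarrow> 'm \<Rightarrow> 'm \<Rightarrow> bool" where
  "is_sum C a b p \<iota>\<^sub>1 \<iota>\<^sub>2 \<longleftrightarrow>
     p \<in> Obj C \<and> \<iota>\<^sub>1 \<in> hom C a p \<and> \<iota>\<^sub>2 \<in> hom C b p \<and>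
     (\<forall>c\<in>Obj C. \<forall>f\<in>hom C a c. \<forall>g\<in>hom C b c.
        \<exists>!h. h \<in> hom C p c \<and> Cmp C h \<iota>\<^sub>1 = f \<and> Cmp C h \<iota>\<^sub>2 = g)"

definition category_with_products_and_sums :: "('o, 'm) cat \<Rightarrow> bool" where
  "category_with_products_and_sums C \<longleftrightarrow> category C \<and>
     (\<forall>a\<in>Obj C. \<forall>b\<in>Obj C. \<exists>p \<pi>\<^sub>1 \<pi>\<^sub>2. is_product C a b p \<pi>\<^sub>1 \<pi>\<^sub>2) \<and>
     (\<forall>a\<in>Obj C. \<forall>b\<in>Obj C. \<exists>p \<iota>\<^sub>1 \<iota>\<^sub>2. is_sum C a b p \<iota>\<^sub>1 \<iota>\<^sub>2)"

definition preserves_products_and_sums ::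
  "('o1, 'm1) cat \<Rightarrow> ('o2, 'm2) cat \<Rightarrow> ('o1, 'm1, 'o2, 'm2) func \<Rightarrow> bool" where
  "preserves_products_and_sums C D F \<longleftrightarrow>
     (\<forall>a\<in>Obj C. \<forall>b\<in>Obj C. \<forall>p \<pi>\<^sub>1 \<pi>\<^sub>2. is_product C a b p \<pi>\<^sub>1 \<pi>\<^sub>2 \<longrightarrow>
        is_product D (FObj F a) (FObj F b) (FObj F p) (FArr F \<pi>\<^sub>1) (FArr F \<pi>\<^sub>2)) \<and>
     (\<forall>a\<in>Obj C. \<forall>b\<in>Obj C. \<forall>p \<iota>\<^sub>1 \<iota>\<^sub>2. is_sum C a b p \<iota>\<^sub>1 \<iota>\<^sub>2 \<longrightarrow>
        is_sum D (FObj F a) (FObj F b) (FObj F p) (FArr F \<iota>\<^sub>1) (FArr F \<iota>\<^sub>2))"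

definition preserving_functor_category :: "('o1, 'm1) cat \<Rightarrow> ('o2, 'm2) cat \<Rightarrow>
    (('o1, 'm1, 'o2, 'm2) func, ('o1, 'm1, 'o2, 'm2) nat_arrow) cat" where
  "preserving_functor_category C D =
     full_subcategory (functor_category C D) (preserves_products_and_sums C D)"

definition restriction_functor :: "('k, 'l) cat \<Rightarrow> ('o1, 'm1) cat \<Rightarrow> ('o2, 'm2) cat \<Rightarrow>
    ('k, 'l, 'o1, 'm1) func \<Rightarrow>
    (('o1, 'm1, 'o2, 'm2) func, ('o1, 'm1, 'o2, 'm2) nat_arrow,
     ('k, 'l, 'o2, 'm2) func, ('k, 'l, 'o2, 'm2) nat_arrow) func" where
  "restriction_functor A C D J =
     \<lparr>FObj = (\<lambda>F\<in>Obj (preserving_functor_category C D). comp_functor A F J),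
      FArr = (\<lambda>(F, \<eta>, G)\<in>Arr (preserving_functor_category C D).
        (comp_functor A F J, \<lambda>a\<in>Obj A. \<eta> (FObj J a), comp_functor A G J))\<rparr>"

text \<open>Freeness in the 2-category of categories with binary products and sums, functors
  preserving them, and natural transformations: restriction along the inclusion \<open>J\<close> of
  the generators is an equivalence of categories. HOL cannot quantify over types in a
  formula, so the types of the objects and arrows of the test categories \<open>D\<close> are
  parameters; a theorem in which they are type variables covers all \<open>D\<close>.\<close>

definition free_category_with_products_and_sums ::
  "'o2 itself \<Rightarrow> 'm2 itself \<Rightarrow> 'k set \<Rightarrow> ('o1, 'm1) cat \<Rightarrow> ('k, 'k, 'o1, 'm1) func \<Rightarrow> bool" where
  "free_category_with_products_and_sums _ _ K C J \<longleftrightarrow>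
     category_with_products_and_sums C \<and>
     is_functor (discrete K) C J \<and>
     (\<forall>D :: ('o2, 'm2) cat. category_with_products_and_sums D \<longrightarrow>
        is_equivalence (preserving_functor_category C D) (functor_category (discrete K) D)
          (restriction_functor (discrete K) C D J))"

section \<open>Propositions\<close>

definition perp :: "'a set \<Rightarrow> 'a set set \<Rightarrow> 'a set set" where
  "perp X S = {t. t \<subseteq> X \<and> (\<forall>s\<in>S. is_singleton (t \<inter> s))}"

record ('a, 'k) propn =
  leaves :: "'a set"
  label :: "'a \<Rightarrow> 'k"
  resolutions :: "'a set set"

definition abstract_proposition :: "'k set \<Rightarrow> ('a, 'k) propn \<Rightarrow> bool" where
  "abstract_proposition K P \<longleftrightarrow>
     label P \<in> leaves P \<rightarrow>\<^sub>E K \<and>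
     resolutions P \<subseteq> Pow (leaves P) \<and>
     perp (leaves P) (perp (leaves P) (resolutions P)) = resolutions P"

datatype (atoms: 'k) form = Atom 'k | And "'k form" "'k form" | Or "'k form" "'k form"

text \<open>A node of the parse tree is the path leading to it from the root:
  \<open>False\<close> for left, \<open>True\<close> for right.\<close>

type_synonym path = "bool list"

fun subform :: "'k form \<Rightarrow> path \<Rightarrow> 'k form option" where
  "subform \<phi> [] = Some \<phi>"
| "subform (Atom k) (d # p) = None"
| "subform (And \<phi> \<psi>) (d # p) = subform (if d then \<psi> else \<phi>) p"
| "subform (Or \<phi> \<psi>) (d # p) = subform (if d then \<psi> else \<phi>) p"

definition leaf_paths :: "'k form \<Rightarrow> path set" where
  "leaf_paths \<phi> = {p. \<exists>k. subform \<phi> p = Some (Atom k)}"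

definition leaf_label :: "'k form \<Rightarrow> path \<Rightarrow> 'k" where
  "leaf_label \<phi> p = (THE k. subform \<phi> p = Some (Atom k))"

definition meet_at_And :: "'k form \<Rightarrow> path \<Rightarrow> path \<Rightarrow> bool" where
  "meet_at_And \<phi> p q \<longleftrightarrow>
     (\<exists>r d p' q' \<psi> \<chi>. p = r @ d # p' \<and> q = r @ (\<not> d) # q' \<and> subform \<phi> r = Some (And \<psi> \<chi>))"

definition And_free :: "'k form \<Rightarrow> path set \<Rightarrow> bool" where
  "And_free \<phi> s \<longleftrightarrow> s \<subseteq> leaf_paths \<phi> \<and> (\<forall>p\<in>s. \<forall>q\<in>s. \<not> meet_at_And \<phi> p q)"

definition maximal_And_free :: "'k form \<Rightarrow> path set \<Rightarrow> bool" where
  "maximal_And_free \<phi> s \<longleftrightarrow> And_free \<phi> s \<and> (\<forall>t. And_free \<phi> t \<longrightarrow> s \<subseteq> t \<longrightarrow> t = s)"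

definition syntactic :: "'k form \<Rightarrow> (path, 'k) propn" where
  "syntactic \<phi> =
     \<lparr>leaves = leaf_paths \<phi>,
      label = (\<lambda>p\<in>leaf_paths \<phi>. leaf_label \<phi> p),
      resolutions = {s. maximal_And_free \<phi> s}\<rparr>"

section \<open>The category of syntactic propositions\<close>

type_synonym 'k cw_arrow =
  "(path, 'k) propn \<times> (path \<times> path) set \<times> (path, 'k) propn"

definition cw_morphism ::
  "('a, 'k) propn \<Rightarrow> ('b, 'k) propn \<Rightarrow> ('a \<times> 'b) set \<Rightarrow> bool" where
  "cw_morphism P Q R \<longleftrightarrow>
     R \<subseteq> leaves P \<times> leaves Q \<and>
     (\<forall>(x, y)\<in>R. label P x = label Q y) \<and>
     (\<forall>t\<in>resolutions Q. R\<inverse> `` t \<in> resolutions P) \<and>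
     (\<forall>\<alpha>\<in>perp (leaves P) (resolutions P). R `` \<alpha> \<in> perp (leaves Q) (resolutions Q))"

definition CW :: "'k set \<Rightarrow> ((path, 'k) propn, 'k cw_arrow) cat" where
  "CW K =
     \<lparr>Obj = syntactic ` {\<phi>. atoms \<phi> \<subseteq> K},
      Arr = {(P, R, Q). P \<in> syntactic ` {\<phi>. atoms \<phi> \<subseteq> K} \<and>
                        Q \<in> syntactic ` {\<phi>. atoms \<phi> \<subseteq> K} \<and> cw_morphism P Q R},
      Dom = (\<lambda>(P, R, Q). P),
      Cod = (\<lambda>(P, R, Q). Q),
      Ide = (\<lambda>P. (P, Id_on (leaves P), P)),
      Cmp = (\<lambda>(Q, R', Q') (P, R, Q''). (P, R O R', Q'))\<rparr>"

definition generator :: "'k \<Rightarrow> (path, 'k) propn" where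
  "generator k = \<lparr>leaves = {[]}, label = (\<lambda>p\<in>{[]}. k), resolutions = {{[]}}\<rparr>"

definition generators :: "'k set \<Rightarrow> ('k, 'k, (path, 'k) propn, 'k cw_arrow) func" where
  "generators K = \<lparr>FObj = (\<lambda>k\<in>K. generator k), FArr = (\<lambda>k\<in>K. Ide (CW K) (generator k))\<rparr>"

text \<open>The disjoint union of two sets of paths, tagging by the first step, so that it takes
  the leaves of two formulas to those of their conjunction and disjunction.\<close>

definition path_plus :: "path set \<Rightarrow> path set \<Rightarrow> path set"  (infixr \<open>\<uplus>\<close> 65) where
  "X \<uplus> Y = Cons False ` X \<union> Cons True ` Y"

definition label_plus :: "(path, 'k) propn \<Rightarrow> (path, 'k) propn \<Rightarrow> path \<Rightarrow> 'k" where
  "label_plus P Q =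
     (\<lambda>p\<in>leaves P \<uplus> leaves Q. if hd p then label Q (tl p) else label P (tl p))"

definition prop_sum ::
  "(path, 'k) propn \<Rightarrow> (path, 'k) propn \<Rightarrow> (path, 'k) propn" where
  "prop_sum P Q =
     \<lparr>leaves = leaves P \<uplus> leaves Q,
      label = label_plus P Q,
      resolutions = {s \<uplus> t |s t. s \<in> resolutions P \<and> t \<in> resolutions Q}\<rparr>"

definition prop_product ::
  "(path, 'k) propn \<Rightarrow> (path, 'k) propn \<Rightarrow> (path, 'k) propn" where
  "prop_product P Q =
     \<lparr>leaves = leaves P \<uplus> leaves Q,
      label = label_plus P Q,
      resolutions = {s \<uplus> {} |s. s \<in> resolutions P} \<union> {{} \<uplus> t |t. t \<in> resolutions Q}\<rparr>"

definition inj1 :: "(path, 'k) propn \<Rightarrow> (path, 'k) propn \<Rightarrow> 'k cw_arrow" where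
  "inj1 P Q = (P, {(x, False # x) |x. x \<in> leaves P}, prop_sum P Q)"

definition inj2 :: "(path, 'k) propn \<Rightarrow> (path, 'k) propn \<Rightarrow> 'k cw_arrow" where
  "inj2 P Q = (Q, {(y, True # y) |y. y \<in> leaves Q}, prop_sum P Q)"

definition proj1 :: "(path, 'k) propn \<Rightarrow> (path, 'k) propn \<Rightarrow> 'k cw_arrow" where
  "proj1 P Q = (prop_product P Q, {(False # x, x) |x. x \<in> leaves P}, P)"

definition proj2 :: "(path, 'k) propn \<Rightarrow> (path, 'k) propn \<Rightarrow> 'k cw_arrow" where
  "proj2 P Q = (prop_product P Q, {(True # y, y) |y. y \<in> leaves Q}, Q)"

section \<open>Syntactic propositions by recursion on the formula\<close>

lemma path_plus_iff [simp]:
  "False # p \<in> X \<uplus> Y \<longleftrightarrow> p \<in> X" "True # p \<in> X \<uplus> Y \<longleftrightarrow> p \<in> Y" "[] \<notin> X \<uplus> Y"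
  by (auto simp: path_plus_def)

lemma path_plus_subset_iff [simp]: "X \<uplus> Y \<subseteq> X' \<uplus> Y' \<longleftrightarrow> X \<subseteq> X' \<and> Y \<subseteq> Y'"
  by (auto simp: path_plus_def)

lemma path_plus_eq_iff [simp]: "X \<uplus> Y = X' \<uplus> Y' \<longleftrightarrow> X = X' \<and> Y = Y'"
  by (metis order_refl path_plus_subset_iff subset_antisym)

lemma path_plus_Int: "(X \<uplus> Y) \<inter> (X' \<uplus> Y') = (X \<inter> X') \<uplus> (Y \<inter> Y')"
  by (auto simp: path_plus_def)

lemma subset_path_plusE:
  assumes "s \<subseteq> X \<uplus> Y"
  obtains s1 s2 where "s = s1 \<uplus> s2" "s1 \<subseteq> X" "s2 \<subseteq> Y"
proof
  show "s = {p. False # p \<in> s} \<uplus> {p. True # p \<in> s}"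
    using assms by (auto simp: path_plus_def)
qed (use assms in \<open>auto simp: path_plus_def\<close>)

lemma is_singleton_path_plus:
  "is_singleton (X \<uplus> Y) \<longleftrightarrow> is_singleton X \<and> Y = {} \<or> X = {} \<and> is_singleton Y"
proof
  assume "is_singleton (X \<uplus> Y)"
  then obtain p where p: "X \<uplus> Y = {p}"
    by (auto simp: is_singleton_def)
  then have "p \<in> X \<uplus> Y"
    by simp
  then consider q where "p = False # q" "q \<in> X" | q where "p = True # q" "q \<in> Y"
    by (auto simp: path_plus_def)
  then show "is_singleton X \<and> Y = {} \<or> X = {} \<and> is_singleton Y"
  proof cases
    case 1
    then have "X \<uplus> Y = {q} \<uplus> {}"
      using p by (auto simp: path_plus_def)
    then show ?thesis
      by simp
  next
    case 2
    then have "X \<uplus> Y = {} \<uplus> {q}"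
      using p by (auto simp: path_plus_def)
    then show ?thesis
      by simp
  qed
qed (auto simp: is_singleton_def path_plus_def)

lemma perp_product:
  "perp (X \<uplus> Y) ({s \<uplus> {} |s. s \<in> S} \<union> {{} \<uplus> t |t. t \<in> T}) =
     {\<alpha> \<uplus> \<beta> |\<alpha> \<beta>. \<alpha> \<in> perp X S \<and> \<beta> \<in> perp Y T}" (is "?L = ?R")
proof
  show "?L \<subseteq> ?R"
  proof
    fix u assume u: "u \<in> ?L"
    then obtain \<alpha> \<beta> where ab: "u = \<alpha> \<uplus> \<beta>" "\<alpha> \<subseteq> X" "\<beta> \<subseteq> Y"
      by (auto simp: perp_def elim: subset_path_plusE)
    have "is_singleton (\<alpha> \<inter> s)" if "s \<in> S" for s
    proof -
      have "is_singleton ((\<alpha> \<uplus> \<beta>) \<inter> (s \<uplus> {}))"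
        using u that unfolding ab perp_def by blast
      then show ?thesis
        by (simp add: path_plus_Int is_singleton_path_plus) (simp add: is_singleton_def)
    qed
    moreover have "is_singleton (\<beta> \<inter> t)" if "t \<in> T" for t
    proof -
      have "is_singleton ((\<alpha> \<uplus> \<beta>) \<inter> ({} \<uplus> t))"
        using u that unfolding ab perp_def by blast
      then show ?thesis
        by (simp add: path_plus_Int is_singleton_path_plus) (simp add: is_singleton_def)
    qed
    ultimately show "u \<in> ?R"
      using ab by (auto simp: perp_def)
  qed
  show "?R \<subseteq> ?L"
    by (auto simp: perp_def path_plus_Int is_singleton_path_plus) (auto simp: path_plus_def)
qed

lemma perp_sum:
  assumes S: "S \<noteq> {}" "\<Union>S = X" and T: "T \<noteq> {}" "\<Union>T = Y"
  shows "perp (X \<uplus> Y) {s \<uplus> t |s t. s \<in> S \<and> t \<in> T} =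
     {\<alpha> \<uplus> {} |\<alpha>. \<alpha> \<in> perp X S} \<union> {{} \<uplus> \<beta> |\<beta>. \<beta> \<in> perp Y T}" (is "?L = ?R")
proof
  show "?L \<subseteq> ?R"
  proof
    fix u assume u: "u \<in> ?L"
    then obtain \<alpha> \<beta> where ab: "u = \<alpha> \<uplus> \<beta>" "\<alpha> \<subseteq> X" "\<beta> \<subseteq> Y"
      by (auto simp: perp_def elim: subset_path_plusE)
    have *: "is_singleton (\<alpha> \<inter> s) \<and> \<beta> \<inter> t = {} \<or> \<alpha> \<inter> s = {} \<and> is_singleton (\<beta> \<inter> t)"
      if "s \<in> S" "t \<in> T" for s t
    proof -
      have "is_singleton ((\<alpha> \<uplus> \<beta>) \<inter> (s \<uplus> t))"
        using u that unfolding ab perp_def by blast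
      then show ?thesis
        by (simp add: path_plus_Int is_singleton_path_plus)
    qed
    have ne: "\<not> is_singleton ({} :: path set)"
      by (simp add: is_singleton_def)
    obtain s0 t0 where st0: "s0 \<in> S" "t0 \<in> T"
      using S T by blast
    show "u \<in> ?R"
    proof (cases "is_singleton (\<alpha> \<inter> s0)")
      case True
      then have b: "\<beta> \<inter> t = {}" if "t \<in> T" for t
        using *[OF st0(1) that] ne by auto
      then have "\<beta> = {}"
        using ab T by blast
      moreover have "is_singleton (\<alpha> \<inter> s)" if "s \<in> S" for s
        using *[OF that st0(2)] b[OF st0(2)] ne by auto
      ultimately show ?thesis
        using ab by (auto simp: perp_def)
    next
      case False
      then have bt: "is_singleton (\<beta> \<inter> t)" if "t \<in> T" for t
        using *[OF st0(1) that] by auto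
      then have "\<alpha> \<inter> s = {}" if "s \<in> S" for s
        using *[OF that st0(2)] bt[OF st0(2)] ne by auto
      then have "\<alpha> = {}"
        using ab S by blast
      then show ?thesis
        using ab bt by (auto simp: perp_def)
    qed
  qed
  show "?R \<subseteq> ?L"
    by (auto simp: perp_def path_plus_Int is_singleton_path_plus) (auto simp: path_plus_def)
qed

lemma leaf_paths_simps [simp]:
  "leaf_paths (Atom k) = {[]}"
  "leaf_paths (And \<phi> \<psi>) = leaf_paths \<phi> \<uplus> leaf_paths \<psi>"
  "leaf_paths (Or \<phi> \<psi>) = leaf_paths \<phi> \<uplus> leaf_paths \<psi>"
proof -
  have "p \<in> leaf_paths (Atom k) \<longleftrightarrow> p \<in> {[]}" for p
    by (cases p) (auto simp: leaf_paths_def)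
  then show "leaf_paths (Atom k) = {[]}"
    by blast
  have "p \<in> leaf_paths (And \<phi> \<psi>) \<longleftrightarrow> p \<in> leaf_paths \<phi> \<uplus> leaf_paths \<psi>" for p
    by (cases p) (auto simp: leaf_paths_def path_plus_def)
  then show "leaf_paths (And \<phi> \<psi>) = leaf_paths \<phi> \<uplus> leaf_paths \<psi>"
    by blast
  have "p \<in> leaf_paths (Or \<phi> \<psi>) \<longleftrightarrow> p \<in> leaf_paths \<phi> \<uplus> leaf_paths \<psi>" for p
    by (cases p) (auto simp: leaf_paths_def path_plus_def)
  then show "leaf_paths (Or \<phi> \<psi>) = leaf_paths \<phi> \<uplus> leaf_paths \<psi>"
    by blast
qed

lemma leaf_paths_nonempty: "leaf_paths \<phi> \<noteq> {}"
  by (induction \<phi>) (auto simp: path_plus_def)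

lemma leaf_label_simps [simp]:
  "leaf_label (Atom k) [] = k"
  "leaf_label (And \<phi> \<psi>) (d # p) = leaf_label (if d then \<psi> else \<phi>) p"
  "leaf_label (Or \<phi> \<psi>) (d # p) = leaf_label (if d then \<psi> else \<phi>) p"
  by (auto simp: leaf_label_def)

lemma meet_at_And_irrefl: "\<not> meet_at_And \<phi> p p"
  by (auto simp: meet_at_And_def)

lemma meet_at_And_Or:
  "meet_at_And (Or \<phi> \<psi>) (d # p) (e # q) \<longleftrightarrow> d = e \<and> meet_at_And (if d then \<psi> else \<phi>) p q"
  (is "?L \<longleftrightarrow> ?R")
proof
  assume ?L
  then obtain r c p' q' \<alpha> \<beta> where
    r: "d # p = r @ c # p'" "e # q = r @ (\<not> c) # q'" "subform (Or \<phi> \<psi>) r = Some (And \<alpha> \<beta>)"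
    by (auto simp: meet_at_And_def)
  then show ?R
    by (cases r) (fastforce simp: meet_at_And_def)+
next
  assume R: ?R
  then obtain r c p' q' \<alpha> \<beta> where
    r: "p = r @ c # p'" "q = r @ (\<not> c) # q'"
      "subform (if d then \<psi> else \<phi>) r = Some (And \<alpha> \<beta>)"
    by (auto simp: meet_at_And_def)
  show ?L
    unfolding meet_at_And_def
    by (rule exI[of _ "d # r"]) (use r R in auto)
qed

lemma meet_at_And_And:
  "meet_at_And (And \<phi> \<psi>) (d # p) (e # q) \<longleftrightarrow> d \<noteq> e \<or> meet_at_And (if d then \<psi> else \<phi>) p q"
  (is "?L \<longleftrightarrow> ?R")
proof
  assume ?L
  then obtain r c p' q' \<alpha> \<beta> where
    r: "d # p = r @ c # p'" "e # q = r @ (\<not> c) # q'" "subform (And \<phi> \<psi>) r = Some (And \<alpha> \<beta>)"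
    by (auto simp: meet_at_And_def)
  then show ?R
    by (cases r) (fastforce simp: meet_at_And_def)+
next
  assume R: ?R
  show ?L
  proof (cases "d = e")
    case False
    then show ?thesis
      unfolding meet_at_And_def by (intro exI[of _ "[]"]) auto
  next
    case True
    then obtain r c p' q' \<alpha> \<beta> where
      r: "p = r @ c # p'" "q = r @ (\<not> c) # q'"
        "subform (if d then \<psi> else \<phi>) r = Some (And \<alpha> \<beta>)"
      using R by (auto simp: meet_at_And_def)
    show ?thesis
      unfolding meet_at_And_def
      by (rule exI[of _ "d # r"]) (use r True in auto)
  qed
qed

lemma And_free_Or: "And_free (Or \<phi> \<psi>) (s \<uplus> t) \<longleftrightarrow> And_free \<phi> s \<and> And_free \<psi> t"
proof -
  have "(\<forall>p\<in>s \<uplus> t. \<forall>q\<in>s \<uplus> t. \<not> meet_at_And (Or \<phi> \<psi>) p q) \<longleftrightarrow>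
      (\<forall>p\<in>s. \<forall>q\<in>s. \<not> meet_at_And \<phi> p q) \<and> (\<forall>p\<in>t. \<forall>q\<in>t. \<not> meet_at_And \<psi> p q)"
    by (simp add: path_plus_def ball_Un meet_at_And_Or)
  then show ?thesis
    by (auto simp: And_free_def)
qed

lemma And_free_And:
  "And_free (And \<phi> \<psi>) (s \<uplus> t) \<longleftrightarrow> And_free \<phi> s \<and> And_free \<psi> t \<and> (s = {} \<or> t = {})"
proof -
  have "(\<forall>p\<in>s \<uplus> t. \<forall>q\<in>s \<uplus> t. \<not> meet_at_And (And \<phi> \<psi>) p q) \<longleftrightarrow>
      (\<forall>p\<in>s. \<forall>q\<in>s. \<not> meet_at_And \<phi> p q) \<and> (\<forall>p\<in>t. \<forall>q\<in>t. \<not> meet_at_And \<psi> p q) \<and>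
      (s = {} \<or> t = {})"
    by (auto simp: path_plus_def ball_Un meet_at_And_And)
  then show ?thesis
    by (auto simp: And_free_def)
qed

lemma And_free_empty [simp]: "And_free \<phi> {}"
  by (simp add: And_free_def)

lemma And_free_singleton: "p \<in> leaf_paths \<phi> \<Longrightarrow> And_free \<phi> {p}"
  by (simp add: And_free_def meet_at_And_irrefl)

lemma maximal_And_free_nonempty: "\<not> maximal_And_free \<phi> {}"
  using leaf_paths_nonempty[of \<phi>] And_free_singleton[of _ \<phi>]
  by (force simp: maximal_And_free_def)

lemma resolutions_syntactic: "resolutions (syntactic \<phi>) = {s. maximal_And_free \<phi> s}"
  by (simp add: syntactic_def)

lemma And_free_plus:
  assumes "And_free (Or \<phi> \<psi>) u \<or> And_free (And \<phi> \<psi>) u"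
  shows "\<exists>s t. u = s \<uplus> t"
proof -
  have "u \<subseteq> leaf_paths \<phi> \<uplus> leaf_paths \<psi>"
    using assms by (auto simp: And_free_def)
  then show ?thesis
    by (blast elim: subset_path_plusE)
qed

lemma maximal_And_free_Or:
  "maximal_And_free (Or \<phi> \<psi>) (s \<uplus> t) \<longleftrightarrow> maximal_And_free \<phi> s \<and> maximal_And_free \<psi> t"
  (is "?L \<longleftrightarrow> ?R")
proof
  assume L: ?L
  then have f: "And_free \<phi> s" "And_free \<psi> t"
    by (auto simp: maximal_And_free_def And_free_Or)
  have m: "s' \<uplus> t' = s \<uplus> t" if "And_free \<phi> s'" "And_free \<psi> t'" "s \<uplus> t \<subseteq> s' \<uplus> t'" for s' t'
    using L that And_free_Or[of \<phi> \<psi> s' t'] unfolding maximal_And_free_def by blast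
  show ?R
    unfolding maximal_And_free_def using f m[of _ t] m[of s] by auto
next
  assume R: ?R
  show ?L
    unfolding maximal_And_free_def
  proof (intro conjI allI impI)
    show "And_free (Or \<phi> \<psi>) (s \<uplus> t)"
      using R by (simp add: maximal_And_free_def And_free_Or)
    fix u assume u: "And_free (Or \<phi> \<psi>) u" "s \<uplus> t \<subseteq> u"
    then obtain s' t' where "u = s' \<uplus> t'"
      using And_free_plus by blast
    then show "u = s \<uplus> t"
      using u R by (auto simp: maximal_And_free_def And_free_Or)
  qed
qed

lemma maximal_And_free_And:
  "maximal_And_free (And \<phi> \<psi>) (s \<uplus> t) \<longleftrightarrow>
     maximal_And_free \<phi> s \<and> t = {} \<or> s = {} \<and> maximal_And_free \<psi> t"
  (is "?L \<longleftrightarrow> ?R")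
proof
  assume L: ?L
  then have f: "And_free \<phi> s" "And_free \<psi> t" "s = {} \<or> t = {}"
    by (auto simp: maximal_And_free_def And_free_And)
  have m: "s' = s \<and> t' = t"
    if "And_free \<phi> s'" "And_free \<psi> t'" "s' = {} \<or> t' = {}" "s \<subseteq> s'" "t \<subseteq> t'" for s' t'
    using L that And_free_And[of \<phi> \<psi> s' t'] unfolding maximal_And_free_def
    by (metis path_plus_eq_iff path_plus_subset_iff)
  show ?R
  proof (cases "t = {}")
    case True
    then show ?thesis
      unfolding maximal_And_free_def using f m[of _ "{}"] by auto
  next
    case False
    then show ?thesis
      unfolding maximal_And_free_def using f m[of "{}"] by auto
  qed
next
  assume R: ?R
  show ?L
    unfolding maximal_And_free_def
  proof (intro conjI allI impI)
    show "And_free (And \<phi> \<psi>) (s \<uplus> t)"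
      using R by (auto simp: maximal_And_free_def And_free_And)
    fix u assume u: "And_free (And \<phi> \<psi>) u" "s \<uplus> t \<subseteq> u"
    then obtain s' t' where st: "u = s' \<uplus> t'"
      using And_free_plus by blast
    have "s \<noteq> {} \<or> t \<noteq> {}"
      using R maximal_And_free_nonempty by blast
    then show "u = s \<uplus> t"
      using u R maximal_And_free_nonempty[of \<phi>] maximal_And_free_nonempty[of \<psi>] unfolding st
      by (auto simp: maximal_And_free_def And_free_And)
  qed
qed

lemma syntactic_Atom: "syntactic (Atom k) = generator k"
proof (rule propn.equality)
  have "And_free (Atom k) s \<longleftrightarrow> s \<subseteq> {[]}" for s
    by (auto simp: And_free_def meet_at_And_def)
  then show "resolutions (syntactic (Atom k)) = resolutions (generator k)"
    by (auto simp: syntactic_def generator_def maximal_And_free_def subset_singleton_iff)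
qed (auto simp: syntactic_def generator_def)

lemma syntactic_And: "syntactic (And \<phi> \<psi>) = prop_product (syntactic \<phi>) (syntactic \<psi>)"
proof -
  have "resolutions (syntactic (And \<phi> \<psi>)) =
      resolutions (prop_product (syntactic \<phi>) (syntactic \<psi>))" (is "?L = ?R")
  proof
    show "?L \<subseteq> ?R"
    proof
      fix u assume "u \<in> ?L"
      then have u: "maximal_And_free (And \<phi> \<psi>) u"
        by (simp add: resolutions_syntactic)
      then obtain s t where "u = s \<uplus> t"
        using And_free_plus[of \<phi> \<psi> u] by (auto simp: maximal_And_free_def)
      then show "u \<in> ?R"
        using u by (auto simp: maximal_And_free_And prop_product_def resolutions_syntactic)
    qed
    show "?R \<subseteq> ?L"
      by (auto simp: maximal_And_free_And prop_product_def resolutions_syntactic)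
  qed
  moreover have "label (syntactic (And \<phi> \<psi>)) p = label_plus (syntactic \<phi>) (syntactic \<psi>) p" for p
    by (cases p) (auto simp: syntactic_def label_plus_def restrict_def)
  moreover have "leaves (syntactic (And \<phi> \<psi>)) = leaves (syntactic \<phi>) \<uplus> leaves (syntactic \<psi>)"
    by (simp add: syntactic_def)
  ultimately show ?thesis
    by (intro propn.equality ext) (simp_all add: prop_product_def)
qed

lemma syntactic_Or: "syntactic (Or \<phi> \<psi>) = prop_sum (syntactic \<phi>) (syntactic \<psi>)"
proof -
  have "resolutions (syntactic (Or \<phi> \<psi>)) =
      resolutions (prop_sum (syntactic \<phi>) (syntactic \<psi>))" (is "?L = ?R")
  proof
    show "?L \<subseteq> ?R"
    proof
      fix u assume "u \<in> ?L"
      then have u: "maximal_And_free (Or \<phi> \<psi>) u"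
        by (simp add: resolutions_syntactic)
      then obtain s t where "u = s \<uplus> t"
        using And_free_plus[of \<phi> \<psi> u] by (auto simp: maximal_And_free_def)
      then show "u \<in> ?R"
        using u by (auto simp: maximal_And_free_Or prop_sum_def resolutions_syntactic)
    qed
    show "?R \<subseteq> ?L"
      by (auto simp: maximal_And_free_Or prop_sum_def resolutions_syntactic)
  qed
  moreover have "label (syntactic (Or \<phi> \<psi>)) p = label_plus (syntactic \<phi>) (syntactic \<psi>) p" for p
    by (cases p) (auto simp: syntactic_def label_plus_def restrict_def)
  moreover have "leaves (syntactic (Or \<phi> \<psi>)) = leaves (syntactic \<phi>) \<uplus> leaves (syntactic \<psi>)"
    by (simp add: syntactic_def)
  ultimately show ?thesis
    by (intro propn.equality ext) (simp_all add: prop_sum_def)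
qed

lemma Union_sum:
  assumes "A \<noteq> {}" "B \<noteq> {}"
  shows "\<Union>{\<alpha> \<uplus> \<beta> |\<alpha> \<beta>. \<alpha> \<in> A \<and> \<beta> \<in> B} = \<Union>A \<uplus> \<Union>B"
proof -
  have "\<Union>{\<alpha> \<uplus> \<beta> |\<alpha> \<beta>. \<alpha> \<in> A \<and> \<beta> \<in> B} = (\<Union>\<alpha>\<in>A. \<Union>\<beta>\<in>B. \<alpha> \<uplus> \<beta>)"
    by blast
  also have "\<dots> = \<Union>A \<uplus> \<Union>B"
    using assms by (simp add: path_plus_def UN_Un_distrib image_Union)
  finally show ?thesis .
qed

lemma Union_product:
  "\<Union>({s \<uplus> {} |s. s \<in> A} \<union> {{} \<uplus> t |t. t \<in> B}) = \<Union>A \<uplus> \<Union>B"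
proof -
  have "\<Union>({s \<uplus> {} |s. s \<in> A} \<union> {{} \<uplus> t |t. t \<in> B}) = (\<Union>s\<in>A. s \<uplus> {}) \<union> (\<Union>t\<in>B. {} \<uplus> t)"
    by blast
  also have "\<dots> = \<Union>A \<uplus> \<Union>B"
    by (simp add: path_plus_def image_Union)
  finally show ?thesis .
qed

lemma syntactic_perp:
  fixes \<phi> :: "'k form"
  defines "X \<equiv> leaves (syntactic \<phi>)" and "S \<equiv> resolutions (syntactic \<phi>)"
  shows "S \<noteq> {} \<and> \<Union>S = X \<and> perp X S \<noteq> {} \<and> \<Union>(perp X S) = X \<and> perp X (perp X S) = S"
  unfolding X_def S_def
proof (induction \<phi>)
  case (Atom k)
  have "perp {[]} {{[]}} = {{[] :: bool list}}"
    by (auto simp: perp_def is_singleton_def subset_singleton_iff)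
  then show ?case
    by (simp add: syntactic_Atom generator_def)
next
  case (And \<phi> \<psi>)
  let ?X = "leaves (syntactic \<phi>)" and ?S = "resolutions (syntactic \<phi>)"
  let ?Y = "leaves (syntactic \<psi>)" and ?T = "resolutions (syntactic \<psi>)"
  let ?U = "{s \<uplus> {} |s. s \<in> ?S} \<union> {{} \<uplus> t |t. t \<in> ?T}"
  let ?V = "{\<alpha> \<uplus> \<beta> |\<alpha> \<beta>. \<alpha> \<in> perp ?X ?S \<and> \<beta> \<in> perp ?Y ?T}"
  have S: "?S \<noteq> {}" "\<Union>?S = ?X" "perp ?X ?S \<noteq> {}" "\<Union>(perp ?X ?S) = ?X"
      "perp ?X (perp ?X ?S) = ?S"
    and T: "?T \<noteq> {}" "\<Union>?T = ?Y" "perp ?Y ?T \<noteq> {}" "\<Union>(perp ?Y ?T) = ?Y"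
      "perp ?Y (perp ?Y ?T) = ?T"
    using And by simp_all
  have "?U \<noteq> {}"
    using S(1) T(1) by blast
  moreover have "?V \<noteq> {}"
    using S(3) T(3) by blast
  moreover have "\<Union>?U = ?X \<uplus> ?Y"
    unfolding Union_product S(2) T(2) ..
  moreover have "\<Union>?V = ?X \<uplus> ?Y"
    unfolding Union_sum[OF S(3) T(3)] S(4) T(4) ..
  moreover have U: "perp (?X \<uplus> ?Y) ?U = ?V"
    by (rule perp_product)
  moreover have V: "perp (?X \<uplus> ?Y) ?V = ?U"
    unfolding perp_sum[OF S(3,4) T(3,4)] S(5) T(5) ..
  ultimately show ?case
    unfolding syntactic_And prop_product_def propn.select_convs U V by (intro conjI refl)
next
  case (Or \<phi> \<psi>)
  let ?X = "leaves (syntactic \<phi>)" and ?S = "resolutions (syntactic \<phi>)"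
  let ?Y = "leaves (syntactic \<psi>)" and ?T = "resolutions (syntactic \<psi>)"
  let ?U = "{s \<uplus> t |s t. s \<in> ?S \<and> t \<in> ?T}"
  let ?V = "{\<alpha> \<uplus> {} |\<alpha>. \<alpha> \<in> perp ?X ?S} \<union> {{} \<uplus> \<beta> |\<beta>. \<beta> \<in> perp ?Y ?T}"
  have S: "?S \<noteq> {}" "\<Union>?S = ?X" "perp ?X ?S \<noteq> {}" "\<Union>(perp ?X ?S) = ?X"
      "perp ?X (perp ?X ?S) = ?S"
    and T: "?T \<noteq> {}" "\<Union>?T = ?Y" "perp ?Y ?T \<noteq> {}" "\<Union>(perp ?Y ?T) = ?Y"
      "perp ?Y (perp ?Y ?T) = ?T"
    using Or by simp_all
  have "?U \<noteq> {}"
    using S(1) T(1) by blast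
  moreover have "?V \<noteq> {}"
    using S(3) T(3) by blast
  moreover have "\<Union>?U = ?X \<uplus> ?Y"
    unfolding Union_sum[OF S(1) T(1)] S(2) T(2) ..
  moreover have "\<Union>?V = ?X \<uplus> ?Y"
    unfolding Union_product S(4) T(4) ..
  moreover have U: "perp (?X \<uplus> ?Y) ?U = ?V"
    by (rule perp_sum[OF S(1,2) T(1,2)])
  moreover have V: "perp (?X \<uplus> ?Y) ?V = ?U"
    unfolding perp_product S(5) T(5) ..
  ultimately show ?case
    unfolding syntactic_Or prop_sum_def propn.select_convs U V by (intro conjI refl)
qed

lemma leaf_label_in_atoms: "p \<in> leaf_paths \<phi> \<Longrightarrow> leaf_label \<phi> p \<in> atoms \<phi>"
  by (induction \<phi> arbitrary: p) (auto simp: path_plus_def)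

lemma abstract_proposition_syntactic:
  "atoms \<phi> \<subseteq> K \<Longrightarrow> abstract_proposition K (syntactic \<phi>)"
  using syntactic_perp[of \<phi>] leaf_label_in_atoms[of _ \<phi>]
  by (auto simp: abstract_proposition_def syntactic_def)

end

theory Submission
  imports Defs
begin

text \<open>
  A morphism of syntactic propositions into a conjunction or out of a disjunction splits into
  two, so the only remaining case is a relation from a conjunction to a disjunction (or to or
  from an atom). Such a relation factors through a projection or an injection: otherwise it
  would contain two pairs joining different conjuncts to different disjuncts, and the preimage
  of a resolution through both would meet both conjuncts. Hence the morphisms are the relations
  of cut-free derivations.

  A derivation is interpreted in any category with products and sums. Interpretations compose
  by cut elimination, and depend on the relation only: two derivations of the same relation
  that end in a projection and in an injection both factor through their common restriction.
  This extends a family of objects indexed by \<open>K\<close> to a preserving functor. Natural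
  transformations extend from the generators by recursion on formulas, and their naturality
  is checked along derivations.
\<close>

section \<open>Categories, functors and equivalences\<close>

text \<open>A target category has products and sums only up to isomorphism, and a functor must
  preserve every cone; so one preserved cone is shown to imply all others, and only the cones of
  \<open>proj_arrow\<close> and \<open>inj_arrow\<close> are ever inspected. Objects of
  \<open>CW K\<close> are propositions, not formulas, so recursion on formulas defines a functor
  only because \<open>syntactic\<close> is injective. The absence of constants enters in one form:
  the resolutions of a syntactic proposition, and likewise their \<open>perp\<close>, form a
  nonempty family of nonempty sets covering the leaves. This makes every morphism a nonempty
  relation, so the side of a projection or injection through which it factors can be read off.
  Interpretation is a predicate and not a function of derivations, because a relation between leaves
  does not determine its derivation. Composition comes before uniqueness: arrows into a conjunction
  are compared through their composites with the projections, and it takes cut elimination to see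
  that these composites are again interpretations, now of smaller sequents.\<close>

lemma hom_iff: "f \<in> hom C a b \<longleftrightarrow> f \<in> Arr C \<and> Dom C f = a \<and> Cod C f = b"
  by (simp add: hom_def)

lemma categoryI:
  assumes "\<And>f. f \<in> Arr C \<Longrightarrow> Dom C f \<in> Obj C \<and> Cod C f \<in> Obj C"
    and "\<And>a. a \<in> Obj C \<Longrightarrow> Ide C a \<in> hom C a a"
    and "\<And>a b c f g. f \<in> hom C a b \<Longrightarrow> g \<in> hom C b c \<Longrightarrow> Cmp C g f \<in> hom C a c"
    and "\<And>a b f. f \<in> hom C a b \<Longrightarrow> Cmp C f (Ide C a) = f"
    and "\<And>a b f. f \<in> hom C a b \<Longrightarrow> Cmp C (Ide C b) f = f"
    and "\<And>a b c d f g h. f \<in> hom C a b \<Longrightarrow> g \<in> hom C b c \<Longrightarrow> h \<in> hom C c d \<Longrightarrow>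
      Cmp C h (Cmp C g f) = Cmp C (Cmp C h g) f"
  shows "category C"
  unfolding category_def using assms by (simp add: hom_iff)

lemma
  assumes "category C"
  shows hom_Obj: "f \<in> hom C a b \<Longrightarrow> a \<in> Obj C \<and> b \<in> Obj C"
    and Ide_hom: "a \<in> Obj C \<Longrightarrow> Ide C a \<in> hom C a a"
    and Cmp_hom: "f \<in> hom C a b \<Longrightarrow> g \<in> hom C b c \<Longrightarrow> Cmp C g f \<in> hom C a c"
    and Cmp_Ide_right: "f \<in> hom C a b \<Longrightarrow> Cmp C f (Ide C a) = f"
    and Cmp_Ide_left: "f \<in> hom C a b \<Longrightarrow> Cmp C (Ide C b) f = f"
    and Cmp_assoc: "f \<in> hom C a b \<Longrightarrow> g \<in> hom C b c \<Longrightarrow> h \<in> hom C c d \<Longrightarrow>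
      Cmp C (Cmp C h g) f = Cmp C h (Cmp C g f)"
  using assms unfolding category_def by (auto simp: hom_iff)

lemma
  assumes "is_functor C D F"
  shows functor_category_dom: "category C"
    and functor_category_cod: "category D"
    and functor_Obj: "a \<in> Obj C \<Longrightarrow> FObj F a \<in> Obj D"
    and functor_hom: "f \<in> hom C a b \<Longrightarrow> FArr F f \<in> hom D (FObj F a) (FObj F b)"
    and functor_Ide: "a \<in> Obj C \<Longrightarrow> FArr F (Ide C a) = Ide D (FObj F a)"
    and functor_Cmp: "f \<in> hom C a b \<Longrightarrow> g \<in> hom C b c \<Longrightarrow>
      FArr F (Cmp C g f) = Cmp D (FArr F g) (FArr F f)"
    and functor_extensional: "FObj F \<in> extensional (Obj C)" "FArr F \<in> extensional (Arr C)"
  using assms unfolding is_functor_def by (auto simp: hom_iff PiE_iff)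

lemma is_functorI:
  assumes "category C" "category D"
    and "\<And>a. a \<in> Obj C \<Longrightarrow> FObj F a \<in> Obj D"
    and "FObj F \<in> extensional (Obj C)" "FArr F \<in> extensional (Arr C)"
    and "\<And>a b f. f \<in> hom C a b \<Longrightarrow> FArr F f \<in> hom D (FObj F a) (FObj F b)"
    and "\<And>a. a \<in> Obj C \<Longrightarrow> FArr F (Ide C a) = Ide D (FObj F a)"
    and "\<And>a b c f g. f \<in> hom C a b \<Longrightarrow> g \<in> hom C b c \<Longrightarrow>
      FArr F (Cmp C g f) = Cmp D (FArr F g) (FArr F f)"
  shows "is_functor C D F"
  unfolding is_functor_def using assms by (simp add: hom_iff PiE_iff)

lemma functor_eqI:
  fixes F G :: "('o1, 'm1, 'o2, 'm2) func"
  assumes "FObj F \<in> extensional (Obj C)" "FObj G \<in> extensional (Obj C)"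
    and "FArr F \<in> extensional (Arr C)" "FArr G \<in> extensional (Arr C)"
    and "\<And>a. a \<in> Obj C \<Longrightarrow> FObj F a = FObj G a" "\<And>f. f \<in> Arr C \<Longrightarrow> FArr F f = FArr G f"
  shows "F = G"
  using assms by (intro func.equality extensionalityI[of _ "Obj C"] extensionalityI[of _ "Arr C"]) auto

lemma is_functor_id: "category C \<Longrightarrow> is_functor C C (id_functor C)"
  by (rule is_functorI) (auto simp: id_functor_def hom_iff category_def)

lemma is_functor_comp:
  assumes F: "is_functor C D F" and G: "is_functor D E G"
  shows "is_functor C E (comp_functor C G F)"
proof (rule is_functorI)
  have C: "category C"
    using F by (rule functor_category_dom)
  show "category C" "category E"
    using C functor_category_cod[OF G] .
  fix a b c f g
  assume f: "f \<in> hom C a b"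
  then show "FArr (comp_functor C G F) f
      \<in> hom E (FObj (comp_functor C G F) a) (FObj (comp_functor C G F) b)"
    using functor_hom[OF G functor_hom[OF F f]] hom_Obj[OF C f]
    by (simp add: comp_functor_def hom_iff)
  assume g: "g \<in> hom C b c"
  then show "FArr (comp_functor C G F) (Cmp C g f)
      = Cmp E (FArr (comp_functor C G F) g) (FArr (comp_functor C G F) f)"
    using functor_Cmp[OF G functor_hom[OF F f] functor_hom[OF F g]] functor_Cmp[OF F f g]
      Cmp_hom[OF C f g] f g
    by (simp add: comp_functor_def hom_iff)
next
  fix a assume a: "a \<in> Obj C"
  show "FObj (comp_functor C G F) a \<in> Obj E"
    using a functor_Obj[OF F] functor_Obj[OF G] by (simp add: comp_functor_def)
  show "FArr (comp_functor C G F) (Ide C a) = Ide E (FObj (comp_functor C G F) a)"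
    using a functor_Obj[OF F] functor_Ide[OF F] functor_Ide[OF G]
      Ide_hom[OF functor_category_dom[OF F] a]
    by (simp add: comp_functor_def hom_iff)
qed (simp_all add: comp_functor_def)

lemma is_isoI:
  assumes "f \<in> hom C a b" "g \<in> hom C b a" "Cmp C g f = Ide C a" "Cmp C f g = Ide C b"
  shows "is_iso C f"
  using assms by (auto simp: is_iso_def hom_iff)

lemma nat_transD:
  assumes "nat_trans C D F G \<eta>"
  shows "is_functor C D F" "is_functor C D G" "\<eta> \<in> extensional (Obj C)"
    and "a \<in> Obj C \<Longrightarrow> \<eta> a \<in> hom D (FObj F a) (FObj G a)"
    and "f \<in> hom C a b \<Longrightarrow> Cmp D (\<eta> b) (FArr F f) = Cmp D (FArr G f) (\<eta> a)"
  using assms by (auto simp: nat_trans_def hom_iff)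

lemma nat_transI:
  assumes "is_functor C D F" "is_functor C D G" "\<eta> \<in> extensional (Obj C)"
    and "\<And>a. a \<in> Obj C \<Longrightarrow> \<eta> a \<in> hom D (FObj F a) (FObj G a)"
    and "\<And>a b f. f \<in> hom C a b \<Longrightarrow> Cmp D (\<eta> b) (FArr F f) = Cmp D (FArr G f) (\<eta> a)"
  shows "nat_trans C D F G \<eta>"
  using assms by (auto simp: nat_trans_def hom_iff)

lemma nat_trans_Ide:
  assumes F: "is_functor C D F"
  shows "nat_trans C D F F (\<lambda>a\<in>Obj C. Ide D (FObj F a))"
proof (rule nat_transI)
  note C = functor_category_dom[OF F] and D = functor_category_cod[OF F]
  show "(\<lambda>a\<in>Obj C. Ide D (FObj F a)) a \<in> hom D (FObj F a) (FObj F a)" if "a \<in> Obj C" for a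
    using that Ide_hom[OF D functor_Obj[OF F that]] by simp
  fix a b f assume f: "f \<in> hom C a b"
  show "Cmp D ((\<lambda>a\<in>Obj C. Ide D (FObj F a)) b) (FArr F f) =
      Cmp D (FArr F f) ((\<lambda>a\<in>Obj C. Ide D (FObj F a)) a)"
    using functor_hom[OF F f] hom_Obj[OF C f]
    by (simp add: Cmp_Ide_left[OF D] Cmp_Ide_right[OF D])
qed (use F in simp_all)

lemma naturally_isomorphic_refl:
  assumes F: "is_functor C D F"
  shows "naturally_isomorphic C D F F"
proof -
  note D = functor_category_cod[OF F]
  have "is_iso D (Ide D (FObj F a))" if a: "a \<in> Obj C" for a
  proof -
    have i: "Ide D (FObj F a) \<in> hom D (FObj F a) (FObj F a)"
      using Ide_hom[OF D functor_Obj[OF F a]] .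
    show ?thesis
      using is_isoI[OF i i] Cmp_Ide_left[OF D i] by simp
  qed
  then show ?thesis
    unfolding naturally_isomorphic_def
    by (intro exI[of _ "\<lambda>a\<in>Obj C. Ide D (FObj F a)"]) (simp add: nat_trans_Ide[OF F])
qed

text \<open>Surjectivity on objects is required on the nose. A section of the object map then makes
  one composite equal to the identity functor, and only the other composite needs a natural
  isomorphism.\<close>

lemma is_equivalenceI:
  assumes F: "is_functor C D F"
    and surj: "\<And>b. b \<in> Obj D \<Longrightarrow> \<exists>a\<in>Obj C. FObj F a = b"
    and ff: "\<And>a a' f. a \<in> Obj C \<Longrightarrow> a' \<in> Obj C \<Longrightarrow> f \<in> hom D (FObj F a) (FObj F a') \<Longrightarrow>
      \<exists>!h. h \<in> hom C a a' \<and> FArr F h = f"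
  shows "is_equivalence C D F"
proof -
  have C: "category C" and D: "category D"
    using functor_category_dom[OF F] functor_category_cod[OF F] .
  obtain g where g: "\<And>b. b \<in> Obj D \<Longrightarrow> g b \<in> Obj C" "\<And>b. b \<in> Obj D \<Longrightarrow> FObj F (g b) = b"
    using bchoice[of "Obj D" "\<lambda>b a. a \<in> Obj C \<and> FObj F a = b"] surj by blast
  define lift where "lift a a' f = (THE h. h \<in> hom C a a' \<and> FArr F h = f)" for a a' f
  have lift: "lift a a' f \<in> hom C a a'" "FArr F (lift a a' f) = f"
    if "a \<in> Obj C" "a' \<in> Obj C" "f \<in> hom D (FObj F a) (FObj F a')" for a a' f
    using theI'[OF ff[OF that]] by (simp_all add: lift_def)
  have faithful: "h = h'"
    if "h \<in> hom C a a'" "h' \<in> hom C a a'" "FArr F h = FArr F h'" for a a' h h'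
    using ff[of a a' "FArr F h'"] that functor_hom[OF F] hom_Obj[OF C that(1)] by blast
  define G where "G = \<lparr>FObj = (\<lambda>b\<in>Obj D. g b),
    FArr = (\<lambda>f\<in>Arr D. lift (g (Dom D f)) (g (Cod D f)) f)\<rparr>"
  have GO: "FObj G b = g b" if "b \<in> Obj D" for b
    using that by (simp add: G_def)
  have GA: "FArr G f \<in> hom C (g b) (g b')" "FArr F (FArr G f) = f" if f: "f \<in> hom D b b'" for b b' f
    using lift[of "g b" "g b'" f] g hom_Obj[OF D f] f by (simp_all add: G_def hom_iff)
  have G: "is_functor D C G"
  proof (rule is_functorI)
    fix a b c f h assume f: "f \<in> hom D a b" and h: "h \<in> hom D b c"
    show "FArr G (Cmp D h f) = Cmp C (FArr G h) (FArr G f)"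
      by (rule faithful[of _ "g a" "g c"])
        (use f h in \<open>simp_all add: GA Cmp_hom[OF D] Cmp_hom[OF C]
          functor_Cmp[OF F GA(1)[OF f] GA(1)[OF h]] GA(2)[OF Cmp_hom[OF D f h]]
          GA(1)[OF Cmp_hom[OF D f h]] Cmp_hom[OF C GA(1)[OF f] GA(1)[OF h]]\<close>)
  next
    fix a assume a: "a \<in> Obj D"
    show "FArr G (Ide D a) = Ide C (FObj G a)"
      by (rule faithful[of _ "g a" "g a"])
        (use a g Ide_hom[OF D a] Ide_hom[OF C] in \<open>simp_all add: GA GO functor_Ide[OF F]\<close>)
  next
    fix a b f assume f: "f \<in> hom D a b"
    show "FArr G f \<in> hom C (FObj G a) (FObj G b)"
      using GA[OF f] hom_Obj[OF D f] by (simp add: GO)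
  qed (use C D g in \<open>simp_all add: G_def\<close>)
  have "comp_functor D F G = id_functor D"
  proof (rule functor_eqI[where C = D])
    fix f assume "f \<in> Arr D"
    then show "FArr (comp_functor D F G) f = FArr (id_functor D) f"
      using GA(2)[of f] by (simp add: comp_functor_def id_functor_def hom_iff)
  qed (auto simp: comp_functor_def id_functor_def GO g)
  then have FG: "naturally_isomorphic D D (comp_functor D F G) (id_functor D)"
    using naturally_isomorphic_refl[OF is_functor_id[OF D]] by simp
  \<comment> \<open>The objects \<open>g (FObj F a)\<close> and \<open>a\<close> have the same
    image, so the identity of that image lifts to an arrow between them; its lift in the other
    direction is the inverse.\<close>
  define \<eta> where "\<eta> = (\<lambda>a\<in>Obj C. lift (g (FObj F a)) a (Ide D (FObj F a)))"
  have \<eta>: "\<eta> a \<in> hom C (g (FObj F a)) a" "FArr F (\<eta> a) = Ide D (FObj F a)"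
    if "a \<in> Obj C" for a
    using lift[of "g (FObj F a)" a "Ide D (FObj F a)"] that g functor_Obj[OF F]
    by (simp_all add: \<eta>_def Ide_hom[OF D])
  have "nat_trans C C (comp_functor C G F) (id_functor C) \<eta>"
    unfolding nat_trans_def
  proof (intro conjI ballI)
    show "is_functor C C (comp_functor C G F)" "is_functor C C (id_functor C)"
      using is_functor_comp[OF F G] is_functor_id[OF C] .
    show "\<eta> \<in> extensional (Obj C)"
      by (simp add: \<eta>_def)
  next
    fix a assume a: "a \<in> Obj C"
    show "\<eta> a \<in> hom C (FObj (comp_functor C G F) a) (FObj (id_functor C) a)"
      using \<eta>[OF a] a functor_Obj[OF F a] by (simp add: comp_functor_def id_functor_def GO)
  next
    fix f assume fA: "f \<in> Arr C"
    let ?a = "Dom C f" and ?b = "Cod C f"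
    have f: "f \<in> hom C ?a ?b"
      using fA by (simp add: hom_iff)
    note ab = conjunct1[OF hom_Obj[OF C f]] conjunct2[OF hom_Obj[OF C f]]
    note Ff = functor_hom[OF F f]
    have "Cmp C (\<eta> ?b) (FArr G (FArr F f)) = Cmp C f (\<eta> ?a)"
    proof (rule faithful)
      show "Cmp C (\<eta> ?b) (FArr G (FArr F f)) \<in> hom C (g (FObj F ?a)) ?b"
        using Cmp_hom[OF C GA(1)[OF Ff] \<eta>(1)[OF ab(2)]] .
      show "Cmp C f (\<eta> ?a) \<in> hom C (g (FObj F ?a)) ?b"
        using Cmp_hom[OF C \<eta>(1)[OF ab(1)] f] .
      show "FArr F (Cmp C (\<eta> ?b) (FArr G (FArr F f))) = FArr F (Cmp C f (\<eta> ?a))"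
        using functor_Cmp[OF F GA(1)[OF Ff] \<eta>(1)[OF ab(2)]] functor_Cmp[OF F \<eta>(1)[OF ab(1)] f]
          \<eta>(2) ab GA(2)[OF Ff] Cmp_Ide_left[OF D Ff] Cmp_Ide_right[OF D Ff]
        by simp
    qed
    then show "Cmp C (\<eta> ?b) (FArr (comp_functor C G F) f)
        = Cmp C (FArr (id_functor C) f) (\<eta> ?a)"
      using fA by (simp add: comp_functor_def id_functor_def)
  qed
  moreover have "is_iso C (\<eta> a)" if a: "a \<in> Obj C" for a
  proof (rule is_isoI)
    let ?e = "Ide D (FObj F a)" and ?a' = "g (FObj F a)"
    let ?\<theta> = "lift a ?a' ?e"
    have a': "?a' \<in> Obj C" "FObj F ?a' = FObj F a"
      using g functor_Obj[OF F a] by simp_all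
    have e: "?e \<in> hom D (FObj F a) (FObj F a)"
      using Ide_hom[OF D functor_Obj[OF F a]] .
    show 1: "\<eta> a \<in> hom C ?a' a" and 2: "?\<theta> \<in> hom C a ?a'"
      using \<eta>[OF a] lift[OF a a'(1)] e a' by simp_all
    have 3: "FArr F ?\<theta> = ?e"
      using lift[OF a a'(1)] e a' by simp
    show "Cmp C ?\<theta> (\<eta> a) = Ide C ?a'"
      by (rule faithful[OF Cmp_hom[OF C 1 2] Ide_hom[OF C a'(1)]])
        (simp add: functor_Cmp[OF F 1 2] 3 \<eta>[OF a] functor_Ide[OF F a'(1)] a' Cmp_Ide_left[OF D e])
    show "Cmp C (\<eta> a) ?\<theta> = Ide C a"
      by (rule faithful[OF Cmp_hom[OF C 2 1] Ide_hom[OF C a]])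
        (simp add: functor_Cmp[OF F 2 1] 3 \<eta>[OF a] functor_Ide[OF F a] Cmp_Ide_left[OF D e])
  qed
  ultimately have "naturally_isomorphic C C (comp_functor C G F) (id_functor C)"
    unfolding naturally_isomorphic_def by blast
  then show ?thesis
    unfolding is_equivalence_def using F G FG by blast
qed

section \<open>Functor categories and full subcategories\<close>

lemma nat_trans_Cmp:
  assumes \<eta>: "nat_trans C D F G \<eta>" and \<theta>: "nat_trans C D G H \<theta>"
  shows "nat_trans C D F H (\<lambda>a\<in>Obj C. Cmp D (\<theta> a) (\<eta> a))"
proof (rule nat_transI)
  note F = nat_transD(1)[OF \<eta>] and G = nat_transD(2)[OF \<eta>] and H = nat_transD(2)[OF \<theta>]
  note C = functor_category_dom[OF F] and D = functor_category_cod[OF F]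
  show "is_functor C D F" "is_functor C D H"
    using F H .
  show "(\<lambda>a\<in>Obj C. Cmp D (\<theta> a) (\<eta> a)) a \<in> hom D (FObj F a) (FObj H a)" if "a \<in> Obj C" for a
    using that Cmp_hom[OF D nat_transD(4)[OF \<eta>] nat_transD(4)[OF \<theta>]] by simp
  fix a b f assume f: "f \<in> hom C a b"
  note ab = conjunct1[OF hom_Obj[OF C f]] conjunct2[OF hom_Obj[OF C f]]
  note h = nat_transD(4)[OF \<eta>] nat_transD(4)[OF \<theta>] functor_hom[OF F f] functor_hom[OF G f]
    functor_hom[OF H f]
  have "Cmp D (Cmp D (\<theta> b) (\<eta> b)) (FArr F f) = Cmp D (\<theta> b) (Cmp D (FArr G f) (\<eta> a))"
    using Cmp_assoc[OF D h(3) h(1)[OF ab(2)] h(2)[OF ab(2)]] nat_transD(5)[OF \<eta> f] by simp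
  also have "\<dots> = Cmp D (Cmp D (FArr H f) (\<theta> a)) (\<eta> a)"
    using Cmp_assoc[OF D h(1)[OF ab(1)] h(4) h(2)[OF ab(2)]] nat_transD(5)[OF \<theta> f] by simp
  also have "\<dots> = Cmp D (FArr H f) (Cmp D (\<theta> a) (\<eta> a))"
    by (rule Cmp_assoc[OF D h(1)[OF ab(1)] h(2)[OF ab(1)] h(5)])
  finally show "Cmp D ((\<lambda>a\<in>Obj C. Cmp D (\<theta> a) (\<eta> a)) b) (FArr F f) =
      Cmp D (FArr H f) ((\<lambda>a\<in>Obj C. Cmp D (\<theta> a) (\<eta> a)) a)"
    using ab by simp
qed simp

lemma hom_functor_category:
  "t \<in> hom (functor_category C D) F G \<longleftrightarrow> (\<exists>\<eta>. t = (F, \<eta>, G) \<and> nat_trans C D F G \<eta>)"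
  by (auto simp: hom_iff functor_category_def)

lemma category_functor_category:
  fixes C :: "('o1, 'm1) cat" and D :: "('o2, 'm2) cat"
  shows "category (functor_category C D)" (is "category ?E")
proof (rule categoryI)
  fix F assume "F \<in> Obj ?E"
  then show "Ide ?E F \<in> hom ?E F F"
    unfolding hom_functor_category using nat_trans_Ide[of C D F]
    by (simp add: functor_category_def)
next
  fix F G s assume "s \<in> hom ?E F G"
  then obtain \<eta> where s: "s = (F, \<eta>, G)" and \<eta>: "nat_trans C D F G \<eta>"
    by (auto simp: hom_functor_category)
  note D = functor_category_cod[OF nat_transD(1)[OF \<eta>]]
  \<comment> \<open>Because \<eta> is \<open>undefined\<close> off \<open>Obj C\<close>, the unit
    laws hold as equalities of functions and not only pointwise on objects.\<close>
  show "Cmp ?E s (Ide ?E F) = s" "Cmp ?E (Ide ?E G) s = s"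
    using nat_transD(3)[OF \<eta>] Cmp_Ide_left[OF D nat_transD(4)[OF \<eta>]]
      Cmp_Ide_right[OF D nat_transD(4)[OF \<eta>]]
    by (auto simp: s functor_category_def extensional_def fun_eq_iff)
  fix H t assume "t \<in> hom ?E G H"
  then obtain \<theta> where t: "t = (G, \<theta>, H)" and \<theta>: "nat_trans C D G H \<theta>"
    by (auto simp: hom_functor_category)
  show "Cmp ?E t s \<in> hom ?E F H"
    unfolding hom_functor_category using nat_trans_Cmp[OF \<eta> \<theta>]
    by (simp add: s t functor_category_def)
  fix H' u assume "u \<in> hom ?E H H'"
  then obtain \<zeta> where u: "u = (H, \<zeta>, H')" and \<zeta>: "nat_trans C D H H' \<zeta>"
    by (auto simp: hom_functor_category)
  show "Cmp ?E u (Cmp ?E t s) = Cmp ?E (Cmp ?E u t) s"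
    using Cmp_assoc[OF D nat_transD(4)[OF \<eta>] nat_transD(4)[OF \<theta>] nat_transD(4)[OF \<zeta>]]
    by (auto simp: s t u functor_category_def fun_eq_iff)
qed (auto simp: functor_category_def dest: nat_transD)

lemma full_subcategory_simps:
  "Obj (full_subcategory C P) = {a \<in> Obj C. P a}"
  "Ide (full_subcategory C P) = Ide C" "Cmp (full_subcategory C P) = Cmp C"
  "f \<in> hom (full_subcategory C P) a b \<longleftrightarrow> f \<in> hom C a b \<and> P a \<and> P b"
  by (auto simp: full_subcategory_def hom_iff)

lemma category_full_subcategory:
  assumes C: "category C"
  shows "category (full_subcategory C P)"
proof (rule categoryI)
  fix f assume "f \<in> Arr (full_subcategory C P)"
  then show "Dom (full_subcategory C P) f \<in> Obj (full_subcategory C P) \<and>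
      Cod (full_subcategory C P) f \<in> Obj (full_subcategory C P)"
    using hom_Obj[OF C, of f] by (auto simp: full_subcategory_def hom_iff)
qed (auto simp: full_subcategory_simps Cmp_Ide_left[OF C] Cmp_Ide_right[OF C] Cmp_assoc[OF C]
    intro: Ide_hom[OF C] Cmp_hom[OF C])

lemma category_discrete: "category (discrete K)"
  by (rule categoryI) (auto simp: discrete_def hom_iff)

section \<open>Cones preserved by functors\<close>

lemma is_productD:
  assumes "is_product C a b p \<pi>\<^sub>1 \<pi>\<^sub>2"
  shows "p \<in> Obj C" "\<pi>\<^sub>1 \<in> hom C p a" "\<pi>\<^sub>2 \<in> hom C p b"
  using assms by (auto simp: is_product_def)

lemma product_pairing:
  assumes "category C" "is_product C a b p \<pi>\<^sub>1 \<pi>\<^sub>2" "f \<in> hom C c a" "g \<in> hom C c b"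
  obtains h where "h \<in> hom C c p" "Cmp C \<pi>\<^sub>1 h = f" "Cmp C \<pi>\<^sub>2 h = g"
  using assms hom_Obj[OF assms(1,3)] unfolding is_product_def by blast

lemma product_ext:
  assumes "category C" "is_product C a b p \<pi>\<^sub>1 \<pi>\<^sub>2" "h \<in> hom C c p" "h' \<in> hom C c p"
    and "Cmp C \<pi>\<^sub>1 h = Cmp C \<pi>\<^sub>1 h'" "Cmp C \<pi>\<^sub>2 h = Cmp C \<pi>\<^sub>2 h'"
  shows "h = h'"
proof -
  have "Cmp C \<pi>\<^sub>1 h' \<in> hom C c a" "Cmp C \<pi>\<^sub>2 h' \<in> hom C c b" "c \<in> Obj C"
    using assms is_productD[OF assms(2)] Cmp_hom[OF assms(1)] hom_Obj[OF assms(1,3)] by blast+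
  then have "\<exists>!k. k \<in> hom C c p \<and> Cmp C \<pi>\<^sub>1 k = Cmp C \<pi>\<^sub>1 h' \<and> Cmp C \<pi>\<^sub>2 k = Cmp C \<pi>\<^sub>2 h'"
    using assms(2) unfolding is_product_def by blast
  then show ?thesis
    using assms(3-6) by blast
qed

lemma is_product_iso:
  assumes C: "category C" and P: "is_product C a b p \<pi>\<^sub>1 \<pi>\<^sub>2"
    and u: "u \<in> hom C q p" and v: "v \<in> hom C p q"
    and vu: "Cmp C v u = Ide C q" and uv: "Cmp C u v = Ide C p"
  shows "is_product C a b q (Cmp C \<pi>\<^sub>1 u) (Cmp C \<pi>\<^sub>2 u)"
  unfolding is_product_def
proof (intro conjI ballI)
  note \<pi> = is_productD[OF P]
  show "q \<in> Obj C" "Cmp C \<pi>\<^sub>1 u \<in> hom C q a" "Cmp C \<pi>\<^sub>2 u \<in> hom C q b"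
    using hom_Obj[OF C u] Cmp_hom[OF C u] \<pi> by auto
  fix c f g assume "c \<in> Obj C" and f: "f \<in> hom C c a" and g: "g \<in> hom C c b"
  obtain h where h: "h \<in> hom C c p" "Cmp C \<pi>\<^sub>1 h = f" "Cmp C \<pi>\<^sub>2 h = g"
    using product_pairing[OF C P f g] .
  have u_eq: "Cmp C u (Cmp C v h) = h"
    using Cmp_assoc[OF C h(1) v u] Cmp_Ide_left[OF C h(1)] uv by simp
  have vh: "Cmp C v h \<in> hom C c q"
    using Cmp_hom[OF C h(1) v] .
  show "\<exists>!h. h \<in> hom C c q \<and> Cmp C (Cmp C \<pi>\<^sub>1 u) h = f \<and> Cmp C (Cmp C \<pi>\<^sub>2 u) h = g"
  proof (intro ex1I conjI)
    show "Cmp C v h \<in> hom C c q"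
      by (rule vh)
    show "Cmp C (Cmp C \<pi>\<^sub>1 u) (Cmp C v h) = f" "Cmp C (Cmp C \<pi>\<^sub>2 u) (Cmp C v h) = g"
      using Cmp_assoc[OF C vh u] \<pi> h u_eq by auto
    fix k assume k: "k \<in> hom C c q \<and> Cmp C (Cmp C \<pi>\<^sub>1 u) k = f \<and> Cmp C (Cmp C \<pi>\<^sub>2 u) k = g"
    then have "Cmp C u k = h"
      using product_ext[OF C P Cmp_hom[OF C _ u] h(1)] Cmp_assoc[OF C _ u \<pi>(2)]
        Cmp_assoc[OF C _ u \<pi>(3)] h by metis
    then show "k = Cmp C v h"
      using k Cmp_assoc[OF C _ u v] Cmp_Ide_left[OF C] vu by metis
  qed
qed

lemma products_iso:
  assumes C: "category C" and P: "is_product C a b p \<pi>\<^sub>1 \<pi>\<^sub>2" and Q: "is_product C a b q \<rho>\<^sub>1 \<rho>\<^sub>2"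
  obtains u v where "u \<in> hom C q p" "v \<in> hom C p q" "Cmp C v u = Ide C q" "Cmp C u v = Ide C p"
    "Cmp C \<pi>\<^sub>1 u = \<rho>\<^sub>1" "Cmp C \<pi>\<^sub>2 u = \<rho>\<^sub>2"
proof -
  note \<pi> = is_productD[OF P] and \<rho> = is_productD[OF Q]
  obtain u where u: "u \<in> hom C q p" "Cmp C \<pi>\<^sub>1 u = \<rho>\<^sub>1" "Cmp C \<pi>\<^sub>2 u = \<rho>\<^sub>2"
    using product_pairing[OF C P \<rho>(2,3)] .
  obtain v where v: "v \<in> hom C p q" "Cmp C \<rho>\<^sub>1 v = \<pi>\<^sub>1" "Cmp C \<rho>\<^sub>2 v = \<pi>\<^sub>2"
    using product_pairing[OF C Q \<pi>(2,3)] .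
  have "Cmp C v u = Ide C q"
    by (rule product_ext[OF C Q Cmp_hom[OF C u(1) v(1)] Ide_hom[OF C \<rho>(1)]])
      (use Cmp_assoc[OF C u(1) v(1)] \<rho> u v Cmp_Ide_right[OF C] in metis)+
  moreover have "Cmp C u v = Ide C p"
    by (rule product_ext[OF C P Cmp_hom[OF C v(1) u(1)] Ide_hom[OF C \<pi>(1)]])
      (use Cmp_assoc[OF C v(1) u(1)] \<pi> u v Cmp_Ide_right[OF C] in metis)+
  ultimately show ?thesis
    using that u v by blast
qed

text \<open>Any two product cones on the same pair differ by an isomorphism of apexes. The functor
  keeps it an isomorphism, and transporting the preserved cone along its image gives the image of
  the other cone.\<close>

lemma functor_preserves_product_cones:
  assumes F: "is_functor C D F" and P: "is_product C a b p \<pi>\<^sub>1 \<pi>\<^sub>2"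
    and FP: "is_product D (FObj F a) (FObj F b) (FObj F p) (FArr F \<pi>\<^sub>1) (FArr F \<pi>\<^sub>2)"
    and Q: "is_product C a b q \<rho>\<^sub>1 \<rho>\<^sub>2"
  shows "is_product D (FObj F a) (FObj F b) (FObj F q) (FArr F \<rho>\<^sub>1) (FArr F \<rho>\<^sub>2)"
proof -
  have C: "category C" and D: "category D"
    using functor_category_dom[OF F] functor_category_cod[OF F] .
  note \<pi> = is_productD[OF P]
  obtain u v where u: "u \<in> hom C q p" and v: "v \<in> hom C p q"
    and vu: "Cmp C v u = Ide C q" and uv: "Cmp C u v = Ide C p"
    and \<rho>: "\<rho>\<^sub>1 = Cmp C \<pi>\<^sub>1 u" "\<rho>\<^sub>2 = Cmp C \<pi>\<^sub>2 u"
    using products_iso[OF C P Q] by metis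
  have "Cmp D (FArr F v) (FArr F u) = Ide D (FObj F q)"
    using functor_Cmp[OF F u v] functor_Ide[OF F] vu hom_Obj[OF C u] by simp
  moreover have "Cmp D (FArr F u) (FArr F v) = Ide D (FObj F p)"
    using functor_Cmp[OF F v u] functor_Ide[OF F] uv hom_Obj[OF C v] by simp
  ultimately show ?thesis
    using is_product_iso[OF D FP functor_hom[OF F u] functor_hom[OF F v]]
      functor_Cmp[OF F u \<pi>(2)] functor_Cmp[OF F u \<pi>(3)] by (simp add: \<rho>)
qed

section \<open>Sums as products in the opposite category\<close>

definition op :: "('o, 'm) cat \<Rightarrow> ('o, 'm) cat" where
  "op C = C\<lparr>Dom := Cod C, Cod := Dom C, Cmp := (\<lambda>g f. Cmp C f g)\<rparr>"

lemma op_simps [simp]: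
  "Obj (op C) = Obj C" "Arr (op C) = Arr C" "Ide (op C) = Ide C" "Cmp (op C) g f = Cmp C f g"
  "hom (op C) a b = hom C b a"
  by (auto simp: op_def hom_def)

lemma category_op:
  assumes C: "category C"
  shows "category (op C)"
proof (rule categoryI)
  fix f assume "f \<in> Arr (op C)"
  then show "Dom (op C) f \<in> Obj (op C) \<and> Cod (op C) f \<in> Obj (op C)"
    using hom_Obj[OF C, of f] by (simp add: op_def hom_iff)
qed (simp_all add: Cmp_hom[OF C] Ide_hom[OF C] Cmp_Ide_left[OF C] Cmp_Ide_right[OF C]
    Cmp_assoc[OF C])

lemma is_functor_op:
  assumes F: "is_functor C D F"
  shows "is_functor (op C) (op D) F"
  by (rule is_functorI)
    (simp_all add: functor_Obj[OF F] functor_hom[OF F] functor_Ide[OF F] functor_Cmp[OF F]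
      functor_extensional[OF F] category_op functor_category_dom[OF F] functor_category_cod[OF F])

lemma is_product_op [simp]: "is_product (op C) a b p \<iota>\<^sub>1 \<iota>\<^sub>2 = is_sum C a b p \<iota>\<^sub>1 \<iota>\<^sub>2"
  by (simp add: is_product_def is_sum_def)

lemma is_sumD:
  assumes "is_sum C a b p \<iota>\<^sub>1 \<iota>\<^sub>2"
  shows "p \<in> Obj C" "\<iota>\<^sub>1 \<in> hom C a p" "\<iota>\<^sub>2 \<in> hom C b p"
  using assms by (auto simp: is_sum_def)

lemma sum_copairing:
  assumes "category C" "is_sum C a b p \<iota>\<^sub>1 \<iota>\<^sub>2" "f \<in> hom C a c" "g \<in> hom C b c"
  obtains h where "h \<in> hom C p c" "Cmp C h \<iota>\<^sub>1 = f" "Cmp C h \<iota>\<^sub>2 = g"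
  using product_pairing[OF category_op[OF assms(1)], of a b p \<iota>\<^sub>1 \<iota>\<^sub>2 f c g] assms(2-) by auto

lemma sum_ext:
  assumes "category C" "is_sum C a b p \<iota>\<^sub>1 \<iota>\<^sub>2" "h \<in> hom C p c" "h' \<in> hom C p c"
    and "Cmp C h \<iota>\<^sub>1 = Cmp C h' \<iota>\<^sub>1" "Cmp C h \<iota>\<^sub>2 = Cmp C h' \<iota>\<^sub>2"
  shows "h = h'"
  using product_ext[OF category_op[OF assms(1)], of a b p \<iota>\<^sub>1 \<iota>\<^sub>2 h c h'] assms(2-) by auto

lemma functor_preserves_sum_cones:
  assumes F: "is_functor C D F" and P: "is_sum C a b p \<iota>\<^sub>1 \<iota>\<^sub>2"
    and FP: "is_sum D (FObj F a) (FObj F b) (FObj F p) (FArr F \<iota>\<^sub>1) (FArr F \<iota>\<^sub>2)"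
    and Q: "is_sum C a b q \<kappa>\<^sub>1 \<kappa>\<^sub>2"
  shows "is_sum D (FObj F a) (FObj F b) (FObj F q) (FArr F \<kappa>\<^sub>1) (FArr F \<kappa>\<^sub>2)"
  using functor_preserves_product_cones[OF is_functor_op[OF F], of a b p \<iota>\<^sub>1 \<iota>\<^sub>2 q \<kappa>\<^sub>1 \<kappa>\<^sub>2]
    P FP Q by simp

section \<open>Morphisms of syntactic propositions\<close>

definition tagL :: "bool \<Rightarrow> (path \<times> 'b) set \<Rightarrow> (path \<times> 'b) set" where
  "tagL d R = {(d # x, y) |x y. (x, y) \<in> R}"

text \<open>\<open>tagL d\<close> is the effect on relations of precomposing with the projection to
  side \<open>d\<close>, and \<open>tagR d\<close> that of postcomposing with the injection of side
  \<open>d\<close>. A pairing is a union of two \<open>tagR\<close>, a copairing a union of two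
  \<open>tagL\<close>.\<close>

definition tagR :: "bool \<Rightarrow> ('a \<times> path) set \<Rightarrow> ('a \<times> path) set" where
  "tagR d R = {(x, d # y) |x y. (x, y) \<in> R}"

lemma tag_iff [simp]:
  "(p, y) \<in> tagL d R \<longleftrightarrow> (\<exists>x. p = d # x \<and> (x, y) \<in> R)"
  "(x', q) \<in> tagR d Q \<longleftrightarrow> (\<exists>y. q = d # y \<and> (x', y) \<in> Q)"
  by (auto simp: tagL_def tagR_def)

lemma tag_eq_iff [simp]: "tagL d R = tagL d R' \<longleftrightarrow> R = R'" "tagR d Q = tagR d Q' \<longleftrightarrow> Q = Q'"
  by (auto simp: set_eq_iff)

text \<open>The empty relation carries no tag, hence the second hypothesis; for morphisms it is
  supplied by \<open>cw_morphism_nonempty\<close>.\<close>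

lemma tagL_eq_tagL:
  assumes "tagL d R = tagL e Q" "tagL d R \<noteq> {}"
  shows "d = e"
proof -
  obtain x y where "(d # x, y) \<in> tagL d R"
    using assms(2) by auto
  then have "(d # x, y) \<in> tagL e Q"
    by (simp only: assms(1))
  then show ?thesis
    by simp
qed

lemma tagR_eq_tagR:
  assumes "tagR d R = tagR e Q" "tagR d R \<noteq> {}"
  shows "d = e"
proof -
  obtain x y where "(x, d # y) \<in> tagR d R"
    using assms(2) by auto
  then have "(x, d # y) \<in> tagR e Q"
    by (simp only: assms(1))
  then show ?thesis
    by simp
qed

lemma tag_commute: "tagL d (tagR e R) = tagR e (tagL d R)"
  by auto

lemma converse_tag: "(tagL d R)\<inverse> = tagR d (R\<inverse>)" "(tagR d Q)\<inverse> = tagL d (Q\<inverse>)"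
  by auto

lemma tag_relcomp: "tagL d R O Q = tagL d (R O Q)" "R' O tagR d Q' = tagR d (R' O Q')"
  by (fastforce simp: relcomp_unfold)+

text \<open>The relational form of a principal cut: matching sides cancel, and different sides have
  no leaf in common.\<close>

lemma tagR_relcomp_tagL: "tagR d R O tagL e Q = (if d = e then R O Q else {})"
  by (auto simp: relcomp_unfold)

lemma Id_on_path_plus:
  "Id_on (X \<uplus> Y) = tagR False (tagL False (Id_on X)) \<union> tagR True (tagL True (Id_on Y))"
  by (auto simp: path_plus_def)

lemma tagR_Image: "(tagR False R \<union> tagR True Q) `` \<alpha> = R `` \<alpha> \<uplus> Q `` \<alpha>"
  by (auto simp: path_plus_def Image_def)

lemma converse_tagR_Image:
  "(tagR False R \<union> tagR True Q)\<inverse> `` (s \<uplus> t) = R\<inverse> `` s \<union> Q\<inverse> `` t"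
  by (auto simp: path_plus_def Image_def)

lemma tagR_subset: "tagR d R \<subseteq> A \<times> (X \<uplus> Y) \<longleftrightarrow> R \<subseteq> A \<times> (if d then Y else X)"
proof
  assume L: "tagR d R \<subseteq> A \<times> (X \<uplus> Y)"
  show "R \<subseteq> A \<times> (if d then Y else X)"
  proof (rule subrelI)
    fix x y assume "(x, y) \<in> R"
    then have "(x, d # y) \<in> A \<times> (X \<uplus> Y)"
      using L by (intro subsetD[OF L]) simp
    then show "(x, y) \<in> A \<times> (if d then Y else X)"
      by (cases d) simp_all
  qed
next
  assume "R \<subseteq> A \<times> (if d then Y else X)"
  then show "tagR d R \<subseteq> A \<times> (X \<uplus> Y)"
    by (cases d) fastforce+
qed

lemma ball_tagR: "(\<forall>(x, y)\<in>tagR d R. f x = g y) \<longleftrightarrow> (\<forall>(x, y)\<in>R. f x = g (d # y))"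
  unfolding tagR_def by blast

lemma tagR_cases:
  assumes "R \<subseteq> A \<times> (X \<uplus> Y)"
  obtains R\<^sub>1 R\<^sub>2 where "R = tagR False R\<^sub>1 \<union> tagR True R\<^sub>2"
proof
  show "R = tagR False {(x, y). (x, False # y) \<in> R} \<union> tagR True {(x, y). (x, True # y) \<in> R}"
    using assms by (auto simp: path_plus_def)
qed

lemma tagL_cases:
  assumes "R \<subseteq> (X \<uplus> Y) \<times> A"
  obtains R\<^sub>1 R\<^sub>2 where "R = tagL False R\<^sub>1 \<union> tagL True R\<^sub>2"
proof
  show "R = tagL False {(x, y). (False # x, y) \<in> R} \<union> tagL True {(x, y). (True # x, y) \<in> R}"
    using assms by (auto simp: path_plus_def)
qed

section \<open>Duality of formulas\<close>

lemmas syntactic_simps = syntactic_And syntactic_Or syntactic_Atom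

text \<open>De Morgan duality with atoms kept, since labels carry no polarity. On propositions it
  exchanges the resolutions with their \<open>perp\<close>, so the converse of a morphism is a
  morphism between duals and statements about disjunctions on the left follow from those about
  conjunctions on the right.\<close>

primrec dual :: "'k form \<Rightarrow> 'k form" where
  "dual (Atom k) = Atom k"
| "dual (And \<phi> \<psi>) = Or (dual \<phi>) (dual \<psi>)"
| "dual (Or \<phi> \<psi>) = And (dual \<phi>) (dual \<psi>)"

lemma perp_prop_product:
  "perp (leaves (prop_product P Q)) (resolutions (prop_product P Q)) =
    {\<alpha> \<uplus> \<beta> |\<alpha> \<beta>. \<alpha> \<in> perp (leaves P) (resolutions P) \<and> \<beta> \<in> perp (leaves Q) (resolutions Q)}"
  unfolding prop_product_def propn.select_convs by (rule perp_product)

lemma perp_syntactic_Or: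
  "perp (leaves (syntactic (Or \<phi> \<psi>))) (resolutions (syntactic (Or \<phi> \<psi>))) =
    {\<alpha> \<uplus> {} |\<alpha>. \<alpha> \<in> perp (leaves (syntactic \<phi>)) (resolutions (syntactic \<phi>))} \<union>
    {{} \<uplus> \<beta> |\<beta>. \<beta> \<in> perp (leaves (syntactic \<psi>)) (resolutions (syntactic \<psi>))}"
  unfolding prop_sum_def propn.select_convs syntactic_Or
  by (rule perp_sum) (simp_all add: syntactic_perp)

lemma syntactic_dual:
  "syntactic (dual \<phi>) = (syntactic \<phi>)
    \<lparr>resolutions := perp (leaves (syntactic \<phi>)) (resolutions (syntactic \<phi>))\<rparr>"
proof (induction \<phi>)
  case (Atom k)
  have "perp {[]} {{[]}} = {{[] :: bool list}}"
    by (auto simp: perp_def is_singleton_def subset_singleton_iff)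
  then show ?case
    by (simp add: syntactic_Atom generator_def)
next
  case (And \<phi> \<psi>)
  have "syntactic (dual (And \<phi> \<psi>)) = prop_sum (syntactic (dual \<phi>)) (syntactic (dual \<psi>))"
    by (simp add: syntactic_Or)
  then show ?case
    unfolding And syntactic_And perp_prop_product
    by (simp add: prop_sum_def prop_product_def label_plus_def cong: if_cong)
next
  case (Or \<phi> \<psi>)
  have "syntactic (dual (Or \<phi> \<psi>)) = prop_product (syntactic (dual \<phi>)) (syntactic (dual \<psi>))"
    by (simp add: syntactic_And)
  then show ?case
    unfolding Or perp_syntactic_Or
    by (simp add: prop_sum_def prop_product_def label_plus_def syntactic_Or cong: if_cong)
qed

text \<open>Passing to the converse swaps the condition on preimages of resolutions with the
  condition on images of elements of \<open>perp\<close>. That the double \<open>perp\<close> gives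
  back the resolutions closes the circle.\<close>

lemma cw_morphism_dual:
  "cw_morphism (syntactic (dual \<psi>)) (syntactic (dual \<phi>)) (R\<inverse>) \<longleftrightarrow>
    cw_morphism (syntactic \<phi>) (syntactic \<psi>) R"
proof -
  have "(\<forall>(x, y)\<in>R\<inverse>. f x = g y) \<longleftrightarrow> (\<forall>(y, x)\<in>R. g y = f x)" for f g :: "path \<Rightarrow> 'a"
    by (auto simp: Ball_def)
  moreover have "R\<inverse> \<subseteq> Y \<times> X \<longleftrightarrow> R \<subseteq> X \<times> Y" for X Y
    by (auto simp: subset_iff)
  moreover have "perp (leaves (syntactic \<chi>)) (perp (leaves (syntactic \<chi>))
      (resolutions (syntactic \<chi>))) = resolutions (syntactic \<chi>)" for \<chi> :: "'a form"
    by (simp add: syntactic_perp)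
  ultimately show ?thesis
    by (auto simp: cw_morphism_def syntactic_dual)
qed

section \<open>Morphisms into and out of compound formulas\<close>

lemma cw_morphism_pair:
  "cw_morphism A (prop_product P Q) (tagR False R\<^sub>1 \<union> tagR True R\<^sub>2) \<longleftrightarrow>
    cw_morphism A P R\<^sub>1 \<and> cw_morphism A Q R\<^sub>2" (is "cw_morphism A ?PQ ?R \<longleftrightarrow> _")
proof -
  \<comment> \<open>Each of the four clauses of \<open>cw_morphism\<close> splits separately. For
    the last two: a resolution of a product lies on one side, so its preimage sees only one
    component, while an element of the \<open>perp\<close> is a pair of such elements, one for each
    side.\<close>
  have 1: "?R \<subseteq> leaves A \<times> leaves ?PQ \<longleftrightarrow>
      R\<^sub>1 \<subseteq> leaves A \<times> leaves P \<and> R\<^sub>2 \<subseteq> leaves A \<times> leaves Q"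
    by (simp add: prop_product_def tagR_subset)
  have 2: "(\<forall>(x, y)\<in>?R. label A x = label ?PQ y) \<longleftrightarrow>
      (\<forall>(x, y)\<in>R\<^sub>1. label A x = label P y) \<and> (\<forall>(x, y)\<in>R\<^sub>2. label A x = label Q y)"
    if "R\<^sub>1 \<subseteq> leaves A \<times> leaves P \<and> R\<^sub>2 \<subseteq> leaves A \<times> leaves Q"
    unfolding ball_Un ball_tagR using that
    by (intro conj_cong ball_cong) (auto simp: prop_product_def label_plus_def)
  have 3: "(\<forall>t\<in>resolutions ?PQ. ?R\<inverse> `` t \<in> resolutions A) \<longleftrightarrow>
      (\<forall>t\<in>resolutions P. R\<^sub>1\<inverse> `` t \<in> resolutions A) \<and>
      (\<forall>t\<in>resolutions Q. R\<^sub>2\<inverse> `` t \<in> resolutions A)"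
  proof -
    have "(\<forall>t\<in>resolutions ?PQ. ?R\<inverse> `` t \<in> resolutions A) \<longleftrightarrow>
      (\<forall>t\<in>resolutions P. ?R\<inverse> `` (t \<uplus> {}) \<in> resolutions A) \<and>
      (\<forall>t\<in>resolutions Q. ?R\<inverse> `` ({} \<uplus> t) \<in> resolutions A)"
      unfolding prop_product_def propn.select_convs by blast
    then show ?thesis
      unfolding converse_tagR_Image by simp
  qed
  have 4: "(\<forall>\<alpha>\<in>perp (leaves A) (resolutions A). ?R `` \<alpha> \<in> perp (leaves ?PQ) (resolutions ?PQ)) \<longleftrightarrow>
      (\<forall>\<alpha>\<in>perp (leaves A) (resolutions A). R\<^sub>1 `` \<alpha> \<in> perp (leaves P) (resolutions P)) \<and>
      (\<forall>\<alpha>\<in>perp (leaves A) (resolutions A). R\<^sub>2 `` \<alpha> \<in> perp (leaves Q) (resolutions Q))"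
    unfolding tagR_Image perp_prop_product by auto
  show ?thesis
    unfolding cw_morphism_def 1 3 4 using 2 by blast
qed

lemma cw_morphism_And:
  "cw_morphism A (syntactic (And \<phi> \<psi>)) (tagR False R\<^sub>1 \<union> tagR True R\<^sub>2) \<longleftrightarrow>
    cw_morphism A (syntactic \<phi>) R\<^sub>1 \<and> cw_morphism A (syntactic \<psi>) R\<^sub>2"
  by (simp add: syntactic_And cw_morphism_pair)

lemma cw_morphism_Or:
  "cw_morphism (syntactic (Or \<phi> \<psi>)) (syntactic \<chi>) (tagL False R\<^sub>1 \<union> tagL True R\<^sub>2) \<longleftrightarrow>
    cw_morphism (syntactic \<phi>) (syntactic \<chi>) R\<^sub>1 \<and> cw_morphism (syntactic \<psi>) (syntactic \<chi>) R\<^sub>2"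
  unfolding cw_morphism_dual[of \<chi>, symmetric]
  by (simp add: converse_tag converse_Un cw_morphism_And)

text \<open>An equivalence and not only closure under injections: the tag can be stripped from a
  morphism. This is what allows derivations to be read back from relations.\<close>

lemma cw_morphism_inj:
  "cw_morphism A (syntactic (Or \<phi> \<psi>)) (tagR d R) \<longleftrightarrow>
    cw_morphism A (syntactic (if d then \<psi> else \<phi>)) R"
proof -
  let ?X = "\<lambda>\<phi>. leaves (syntactic \<phi>)" and ?S = "\<lambda>\<phi>. resolutions (syntactic \<phi>)"
  let ?\<chi> = "if d then \<psi> else \<phi>"
  have 1: "tagR d R \<subseteq> leaves A \<times> ?X (Or \<phi> \<psi>) \<longleftrightarrow> R \<subseteq> leaves A \<times> ?X ?\<chi>"
    by (simp add: syntactic_Or prop_sum_def tagR_subset)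
  have 2: "(\<forall>(x, y)\<in>tagR d R. label A x = label (syntactic (Or \<phi> \<psi>)) y) \<longleftrightarrow>
      (\<forall>(x, y)\<in>R. label A x = label (syntactic ?\<chi>) y)" if "R \<subseteq> leaves A \<times> ?X ?\<chi>"
    unfolding ball_tagR using that
    by (intro ball_cong) (auto simp: syntactic_Or prop_sum_def label_plus_def)
  have 3: "(\<forall>t\<in>?S (Or \<phi> \<psi>). (tagR d R)\<inverse> `` t \<in> resolutions A) \<longleftrightarrow>
      (\<forall>t\<in>?S ?\<chi>. R\<inverse> `` t \<in> resolutions A)"
  proof -
    have "(tagR d R)\<inverse> `` (s \<uplus> t) = R\<inverse> `` (if d then t else s)" for s t
      by (auto simp: path_plus_def Image_def)
    moreover have "(\<forall>u\<in>?S (Or \<phi> \<psi>). f u \<in> resolutions A) \<longleftrightarrow>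
        (\<forall>s\<in>?S \<phi>. \<forall>t\<in>?S \<psi>. f (s \<uplus> t) \<in> resolutions A)" for f
      unfolding syntactic_Or prop_sum_def propn.select_convs by blast
    \<comment> \<open>The preimage of \<open>s \<uplus> t\<close> depends on one of the two
      components only; the other must be filled by some resolution before the condition can be
      used.\<close>
    moreover have "?S \<phi> \<noteq> {}" "?S \<psi> \<noteq> {}"
      by (simp_all add: syntactic_perp)
    ultimately show ?thesis
      by auto
  qed
  have 4: "(\<forall>\<alpha>\<in>B. tagR d R `` \<alpha> \<in> perp (?X (Or \<phi> \<psi>)) (?S (Or \<phi> \<psi>))) \<longleftrightarrow>
      (\<forall>\<alpha>\<in>B. R `` \<alpha> \<in> perp (?X ?\<chi>) (?S ?\<chi>))" for B
  proof -
    have im: "tagR d R `` \<alpha> = (if d then {} \<uplus> R `` \<alpha> else R `` \<alpha> \<uplus> {})" for \<alpha>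
      by (auto simp: path_plus_def Image_def)
    \<comment> \<open>A tagged image is empty on the other side. Were the empty set in the
      \<open>perp\<close> there, the image could count as an element of the wrong summand of
      \<open>perp_syntactic_Or\<close>.\<close>
    have "{} \<notin> perp (?X \<chi>) (?S \<chi>)" for \<chi> :: "'b form"
      using syntactic_perp[of \<chi>] by (auto simp: perp_def is_singleton_def)
    then show ?thesis
      unfolding im perp_syntactic_Or by auto
  qed
  show ?thesis
    unfolding cw_morphism_def 1 3 4 using 2 by blast
qed

lemma cw_morphism_proj:
  "cw_morphism (syntactic (And \<phi> \<psi>)) (syntactic \<chi>) (tagL d R) \<longleftrightarrow>
    cw_morphism (syntactic (if d then \<psi> else \<phi>)) (syntactic \<chi>) R"
proof -
  have "cw_morphism (syntactic (And \<phi> \<psi>)) (syntactic \<chi>) (tagL d R) \<longleftrightarrow>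
      cw_morphism (syntactic (dual \<chi>)) (syntactic (Or (dual \<phi>) (dual \<psi>))) (tagR d (R\<inverse>))"
    unfolding cw_morphism_dual[of \<chi>, symmetric] by (simp add: converse_tag)
  also have "\<dots> \<longleftrightarrow> cw_morphism (syntactic (dual \<chi>)) (syntactic (dual (if d then \<psi> else \<phi>))) (R\<inverse>)"
    by (simp add: cw_morphism_inj)
  finally show ?thesis
    by (simp add: cw_morphism_dual)
qed

text \<open>Some resolution exists in the target, its preimage is a resolution of the source, and
  resolutions are nonempty.\<close>

lemma cw_morphism_nonempty:
  assumes "cw_morphism (syntactic \<phi>) (syntactic \<psi>) R"
  shows "R \<noteq> {}"
proof -
  obtain t where t: "t \<in> resolutions (syntactic \<psi>)"
    using syntactic_perp[of \<psi>] by blast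
  have "R\<inverse> `` t \<in> resolutions (syntactic \<phi>)"
    using assms t by (simp add: cw_morphism_def)
  then show ?thesis
    using maximal_And_free_nonempty[of \<phi>] by (auto simp: resolutions_syntactic)
qed

lemma cw_morphism_subset:
  assumes "cw_morphism P Q R"
  shows "R \<subseteq> leaves P \<times> leaves Q"
  using assms by (simp add: cw_morphism_def)

lemma cw_morphism_atoms:
  "cw_morphism (syntactic (Atom k)) (syntactic (Atom l)) R \<longleftrightarrow> k = l \<and> R = {([], [])}"
proof
  assume R: "cw_morphism (syntactic (Atom k)) (syntactic (Atom l)) R"
  have "R \<subseteq> {([], [])}"
    using cw_morphism_subset[OF R] by (auto simp: syntactic_Atom generator_def)
  then show "k = l \<and> R = {([], [])}"
    using R cw_morphism_nonempty[OF R]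
    by (auto simp: cw_morphism_def syntactic_Atom generator_def subset_singleton_iff)
next
  assume "k = l \<and> R = {([], [])}"
  moreover have "{([], [])} `` \<alpha> = \<alpha>" if "\<alpha> \<subseteq> {[]}" for \<alpha> :: "path set"
    using that by auto
  ultimately show "cw_morphism (syntactic (Atom k)) (syntactic (Atom l)) R"
    by (auto simp: cw_morphism_def syntactic_Atom generator_def perp_def)
qed

lemma cw_morphism_id: "cw_morphism (syntactic \<phi>) (syntactic \<phi>) (Id_on (leaves (syntactic \<phi>)))"
proof -
  have "Id_on X `` \<alpha> = \<alpha>" "(Id_on X)\<inverse> `` \<alpha> = \<alpha>" if "\<alpha> \<subseteq> X" for \<alpha> X :: "path set"
    using that by auto
  moreover have "s \<subseteq> leaves (syntactic \<phi>)" if "s \<in> resolutions (syntactic \<phi>)" for s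
    using that syntactic_perp[of \<phi>] by blast
  ultimately show ?thesis
    by (auto simp: cw_morphism_def perp_def)
qed

lemma cw_morphism_comp:
  assumes "cw_morphism A B R" "cw_morphism B C Q"
  shows "cw_morphism A C (R O Q)"
  unfolding cw_morphism_def
proof (intro conjI ballI)
  show "R O Q \<subseteq> leaves A \<times> leaves C"
    using cw_morphism_subset[OF assms(1)] cw_morphism_subset[OF assms(2)] by blast
  fix p assume "p \<in> R O Q"
  then show "case p of (x, z) \<Rightarrow> label A x = label C z"
    using assms unfolding cw_morphism_def by fastforce
qed (use assms in \<open>simp_all add: cw_morphism_def relcomp_Image converse_relcomp\<close>)

section \<open>Cut-free derivations\<close>

text \<open>Sequents with one formula on each side, carrying the leaf relation that the rules build.
  The axiom is restricted to atoms, so identities of compound formulas arise by expansion, and there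
  is no cut rule.\<close>

inductive deriv :: "'k form \<Rightarrow> 'k form \<Rightarrow> (path \<times> path) set \<Rightarrow> bool" where
  atom: "deriv (Atom k) (Atom k) {([], [])}"
| pair: "deriv \<chi> \<phi> R\<^sub>1 \<Longrightarrow> deriv \<chi> \<psi> R\<^sub>2 \<Longrightarrow> deriv \<chi> (And \<phi> \<psi>) (tagR False R\<^sub>1 \<union> tagR True R\<^sub>2)"
| copair: "deriv \<phi> \<chi> R\<^sub>1 \<Longrightarrow> deriv \<psi> \<chi> R\<^sub>2 \<Longrightarrow> deriv (Or \<phi> \<psi>) \<chi> (tagL False R\<^sub>1 \<union> tagL True R\<^sub>2)"
| proj: "deriv (if d then \<psi> else \<phi>) \<chi> R \<Longrightarrow> deriv (And \<phi> \<psi>) \<chi> (tagL d R)"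
| inj: "deriv \<chi> (if d then \<psi> else \<phi>) R \<Longrightarrow> deriv \<chi> (Or \<phi> \<psi>) (tagR d R)"

section \<open>Softness: factoring through a projection or an injection\<close>

lemma resolution_And_one_side:
  "s \<in> resolutions (syntactic (And \<phi> \<psi>)) \<Longrightarrow> False # x \<in> s \<Longrightarrow> True # y \<in> s \<Longrightarrow> False"
  by (auto simp: syntactic_And prop_product_def)

lemma tagL_intro:
  assumes "R \<subseteq> (X \<uplus> Y) \<times> A" "\<And>x y. ((\<not> d) # x, y) \<notin> R"
  obtains R' where "R = tagL d R'"
proof
  show "R = tagL d {(x, y). (d # x, y) \<in> R}"
  proof (rule subset_antisym; rule subrelI)
    fix p y assume R: "(p, y) \<in> R"
    then have "p \<in> X \<uplus> Y"
      using assms(1) by blast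
    then obtain e x where p: "p = e # x"
      by (auto simp: path_plus_def)
    then have "e = d"
      using assms(2)[of x y] R by (cases e; cases d) auto
    then show "(p, y) \<in> tagL d {(x, y). (d # x, y) \<in> R}"
      using R p by simp
  qed auto
qed

lemma tagR_intro:
  assumes "R \<subseteq> A \<times> (X \<uplus> Y)" "\<And>x y. (x, (\<not> d) # y) \<notin> R"
  obtains R' where "R = tagR d R'"
proof -
  obtain Q where "R\<inverse> = tagL d Q"
    using tagL_intro[of "R\<inverse>" X Y A d] assms by auto
  then have "R = tagR d (Q\<inverse>)"
    by (metis converse_converse converse_tag(1))
  then show ?thesis
    using that by blast
qed

lemma cw_morphism_And_Or_softness:
  assumes R: "cw_morphism (syntactic (And \<phi>\<^sub>1 \<phi>\<^sub>2)) (syntactic (Or \<psi>\<^sub>1 \<psi>\<^sub>2)) R"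
  shows "\<exists>d R'. R = tagL d R' \<or> R = tagR d R'"
proof (rule ccontr)
  assume none: "\<not> ?thesis"
  have sub: "R \<subseteq> (leaves (syntactic \<phi>\<^sub>1) \<uplus> leaves (syntactic \<phi>\<^sub>2)) \<times>
      (leaves (syntactic \<psi>\<^sub>1) \<uplus> leaves (syntactic \<psi>\<^sub>2))"
    using cw_morphism_subset[OF R] by (simp add: syntactic_simps prop_sum_def prop_product_def)
  have no_matching: False
    if e: "(False # x, e # y) \<in> R" "(True # x', (\<not> e) # y') \<in> R" for x x' e y y'
  proof -
    \<comment> \<open>\<open>z\<close> is the endpoint lying in the left disjunct and
      \<open>z'\<close> the one in the right disjunct, whichever of the two pairs it belongs to.
      Resolutions cover the leaves, so a resolution of the disjunction passes through both.\<close>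
    define z z' where "z = (if e then y' else y)" and "z' = (if e then y else y')"
    have "e # y \<in> leaves (syntactic \<psi>\<^sub>1) \<uplus> leaves (syntactic \<psi>\<^sub>2)"
      "(\<not> e) # y' \<in> leaves (syntactic \<psi>\<^sub>1) \<uplus> leaves (syntactic \<psi>\<^sub>2)"
      using sub e by blast+
    then have "z \<in> leaves (syntactic \<psi>\<^sub>1)" "z' \<in> leaves (syntactic \<psi>\<^sub>2)"
      by (cases e; simp add: z_def z'_def)+
    then obtain s t where "s \<in> resolutions (syntactic \<psi>\<^sub>1)" "z \<in> s"
      and "t \<in> resolutions (syntactic \<psi>\<^sub>2)" "z' \<in> t"
      using syntactic_perp[of \<psi>\<^sub>1] syntactic_perp[of \<psi>\<^sub>2] by blast
    then have "s \<uplus> t \<in> resolutions (syntactic (Or \<psi>\<^sub>1 \<psi>\<^sub>2))" "e # y \<in> s \<uplus> t" "(\<not> e) # y' \<in> s \<uplus> t"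
      by (cases e; auto simp: syntactic_Or prop_sum_def z_def z'_def)+
    then obtain u where u: "u \<in> resolutions (syntactic (Or \<psi>\<^sub>1 \<psi>\<^sub>2))" "e # y \<in> u" "(\<not> e) # y' \<in> u"
      by blast
    then have "R\<inverse> `` u \<in> resolutions (syntactic (And \<phi>\<^sub>1 \<phi>\<^sub>2))"
      using R by (simp add: cw_morphism_def)
    moreover have "False # x \<in> R\<inverse> `` u" "True # x' \<in> R\<inverse> `` u"
      using e u by blast+
    ultimately show False
      by (rule resolution_And_one_side)
  qed
  \<comment> \<open>If no pair started on side \<open>d\<close>, the whole relation would start on
    the opposite side and so be a \<open>tagL\<close>, against the assumption. The same holds for
    targets.\<close>
  have L: "\<exists>x y. (d # x, y) \<in> R" for d
    using none tagL_intro[OF sub, of "\<not> d"] by (metis (full_types))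
  have R: "\<exists>x y. (x, d # y) \<in> R" for d
    using none tagR_intro[OF sub, of "\<not> d"] by (metis (full_types))
  obtain x e y where 1: "(False # x, e # y) \<in> R"
    using L[of False] sub by (auto simp: path_plus_def)
  obtain x' e' y' where 2: "(True # x', e' # y') \<in> R"
    using L[of True] sub by (auto simp: path_plus_def)
  \<comment> \<open>One pair leaves each conjunct, and both must end in the same disjunct, since
    otherwise they would form a forbidden matching.\<close>
  have [simp]: "e' = e"
    using no_matching 1 2 by (metis (full_types))
  \<comment> \<open>A third pair ends in the other disjunct. Whichever conjunct \<open>f\<close> it
    starts from, it is in conflict with the pair that leaves the opposite conjunct.\<close>
  obtain f z w where 3: "(f # z, (\<not> e) # w) \<in> R"
    using R[of "\<not> e"] sub by (fastforce simp: path_plus_def)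
  show False
    using no_matching[of x e y z w] no_matching[of z "\<not> e" w x' y'] 1 2 3 by (cases f) auto
qed

text \<open>The single leaf of the atom forms an element of the \<open>perp\<close> of its
  resolutions, and its image must be an element of the \<open>perp\<close> of a disjunction, which
  lies on one side. Here the condition on images does the work, whereas softness rests on the
  condition on preimages.\<close>

lemma cw_morphism_Atom_Or:
  assumes R: "cw_morphism (syntactic (Atom k)) (syntactic (Or \<psi>\<^sub>1 \<psi>\<^sub>2)) R"
  obtains d R' where "R = tagR d R'"
proof -
  have sub: "R \<subseteq> {[]} \<times> (leaves (syntactic \<psi>\<^sub>1) \<uplus> leaves (syntactic \<psi>\<^sub>2))"
    using cw_morphism_subset[OF R]
    by (simp add: syntactic_simps prop_sum_def prop_product_def generator_def)
  have "R `` {[]} \<in> perp (leaves (syntactic (Or \<psi>\<^sub>1 \<psi>\<^sub>2))) (resolutions (syntactic (Or \<psi>\<^sub>1 \<psi>\<^sub>2)))"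
    using R by (auto simp: cw_morphism_def perp_def syntactic_Atom generator_def)
  then obtain \<alpha> where "R `` {[]} = \<alpha> \<uplus> {} \<or> R `` {[]} = {} \<uplus> \<alpha>"
    unfolding perp_syntactic_Or by blast
  then have "True # y \<notin> R `` {[]} \<or> False # y' \<notin> R `` {[]}" for y y'
    by (metis empty_iff path_plus_iff(1,2))
  then obtain d where "\<And>y. ([], (\<not> d) # y) \<notin> R"
    by (metis (full_types) Image_singleton_iff)
  then have d: "\<And>x y. (x, (\<not> d) # y) \<notin> R"
    using sub by fastforce
  show ?thesis
    by (rule tagR_intro[OF sub d]) (rule that)
qed

lemma cw_morphism_And_Atom:
  assumes R: "cw_morphism (syntactic (And \<phi>\<^sub>1 \<phi>\<^sub>2)) (syntactic (Atom k)) R"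
  obtains d R' where "R = tagL d R'"
proof -
  obtain d Q where "R\<inverse> = tagR d Q"
    using cw_morphism_Atom_Or[of k "dual \<phi>\<^sub>1" "dual \<phi>\<^sub>2" "R\<inverse>"] R
      cw_morphism_dual[of "Atom k" "And \<phi>\<^sub>1 \<phi>\<^sub>2" R] by auto
  then have "R = tagL d (Q\<inverse>)"
    by (metis converse_converse converse_tag(2))
  then show ?thesis
    using that by blast
qed

lemma deriv_sound: "deriv \<phi> \<psi> R \<Longrightarrow> cw_morphism (syntactic \<phi>) (syntactic \<psi>) R"
  by (induction rule: deriv.induct)
    (simp_all add: cw_morphism_And cw_morphism_Or cw_morphism_proj cw_morphism_inj cw_morphism_atoms)

text \<open>Every rule is invertible on morphisms once the shape of the relation is known. For a
  conjunction on the right or a disjunction on the left the shape is automatic; in all other cases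
  softness or the inspection of an atom supplies it. Either formula may shrink, hence the induction
  on the sum of the sizes.\<close>

lemma deriv_complete: "cw_morphism (syntactic \<phi>) (syntactic \<psi>) R \<Longrightarrow> deriv \<phi> \<psi> R"
proof (induction "size \<phi> + size \<psi>" arbitrary: \<phi> \<psi> R rule: less_induct)
  case less
  note R = less.prems
  have inj: "deriv \<phi> \<psi> R" if "\<psi> = Or \<psi>\<^sub>1 \<psi>\<^sub>2" "R = tagR d R'" for \<psi>\<^sub>1 \<psi>\<^sub>2 d R'
    using R deriv.inj[of \<phi> d \<psi>\<^sub>2 \<psi>\<^sub>1 R'] less.hyps[of \<phi> "if d then \<psi>\<^sub>2 else \<psi>\<^sub>1" R'] that
    by (simp add: cw_morphism_inj)
  have proj: "deriv \<phi> \<psi> R" if "\<phi> = And \<phi>\<^sub>1 \<phi>\<^sub>2" "R = tagL d R'" for \<phi>\<^sub>1 \<phi>\<^sub>2 d R'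
    using R deriv.proj[of d \<phi>\<^sub>2 \<phi>\<^sub>1 \<psi> R'] less.hyps[of "if d then \<phi>\<^sub>2 else \<phi>\<^sub>1" \<psi> R'] that
    by (simp add: cw_morphism_proj)
  have And: "deriv \<phi> \<psi> R" if \<psi>: "\<psi> = And \<psi>\<^sub>1 \<psi>\<^sub>2" for \<psi>\<^sub>1 \<psi>\<^sub>2
  proof -
    obtain R\<^sub>1 R\<^sub>2 where "R = tagR False R\<^sub>1 \<union> tagR True R\<^sub>2"
      using tagR_cases[of R "leaves (syntactic \<phi>)" "leaves (syntactic \<psi>\<^sub>1)" "leaves (syntactic \<psi>\<^sub>2)"]
        cw_morphism_subset[OF R] by (auto simp: \<psi> syntactic_And prop_product_def)
    then show ?thesis
      using R less.hyps[of \<phi>] by (simp add: \<psi> cw_morphism_And deriv.pair)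
  qed
  have Or: "deriv \<phi> \<psi> R" if \<phi>: "\<phi> = Or \<phi>\<^sub>1 \<phi>\<^sub>2" for \<phi>\<^sub>1 \<phi>\<^sub>2
  proof -
    obtain R\<^sub>1 R\<^sub>2 where "R = tagL False R\<^sub>1 \<union> tagL True R\<^sub>2"
      using tagL_cases[of R "leaves (syntactic \<phi>\<^sub>1)" "leaves (syntactic \<phi>\<^sub>2)" "leaves (syntactic \<psi>)"]
        cw_morphism_subset[OF R] by (auto simp: \<phi> syntactic_Or prop_sum_def)
    then show ?thesis
      using R less.hyps[of _ \<psi>] by (simp add: \<phi> cw_morphism_Or deriv.copair)
  qed
  show ?case
  proof (cases \<phi>)
    case \<phi>: (Atom k)
    show ?thesis
    proof (cases \<psi>)
      case (Atom l)
      then show ?thesis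
        using R \<phi> by (simp add: cw_morphism_atoms deriv.atom)
    next
      case (Or \<psi>\<^sub>1 \<psi>\<^sub>2)
      then show ?thesis
        using R \<phi> inj cw_morphism_Atom_Or by metis
    qed (rule And)
  next
    case \<phi>: (And \<phi>\<^sub>1 \<phi>\<^sub>2)
    show ?thesis
    proof (cases \<psi>)
      case (Atom k)
      then show ?thesis
        using R \<phi> proj cw_morphism_And_Atom by metis
    next
      case (Or \<psi>\<^sub>1 \<psi>\<^sub>2)
      then show ?thesis
        using R \<phi> proj inj cw_morphism_And_Or_softness by metis
    qed (rule And)
  qed (rule Or)
qed

lemma deriv_iff: "deriv \<phi> \<psi> R \<longleftrightarrow> cw_morphism (syntactic \<phi>) (syntactic \<psi>) R"
  using deriv_sound deriv_complete by blast

section \<open>Products and sums of syntactic propositions\<close>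

lemma Obj_CW: "P \<in> Obj (CW K) \<longleftrightarrow> (\<exists>\<phi>. atoms \<phi> \<subseteq> K \<and> P = syntactic \<phi>)"
  by (auto simp: CW_def)

lemma Ide_CW: "Ide (CW K) P = (P, Id_on (leaves P), P)"
  by (simp add: CW_def)

lemma Cmp_CW: "Cmp (CW K) (Q, R', Q') (P, R, Q'') = (P, R O R', Q')"
  by (simp add: CW_def)

lemma hom_CW:
  "f \<in> hom (CW K) P Q \<longleftrightarrow>
    P \<in> Obj (CW K) \<and> Q \<in> Obj (CW K) \<and> (\<exists>R. f = (P, R, Q) \<and> cw_morphism P Q R)"
  by (auto simp: CW_def hom_iff)

lemma relcomp_Id_on:
  "R \<subseteq> X \<times> Y \<Longrightarrow> R O Id_on Y = R" "R \<subseteq> X \<times> Y \<Longrightarrow> Id_on X O R = R"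
  by auto

lemma category_CW: "category (CW K)"
proof (rule categoryI)
  fix f assume "f \<in> Arr (CW K)"
  then show "Dom (CW K) f \<in> Obj (CW K) \<and> Cod (CW K) f \<in> Obj (CW K)"
    by (auto simp: CW_def)
next
  fix P assume "P \<in> Obj (CW K)"
  then show "Ide (CW K) P \<in> hom (CW K) P P"
    by (auto simp: hom_CW Ide_CW Obj_CW intro: cw_morphism_id)
next
  fix P Q f assume "f \<in> hom (CW K) P Q"
  then obtain R where f: "f = (P, R, Q)" and "cw_morphism P Q R"
    by (auto simp: hom_CW)
  then have "R \<subseteq> leaves P \<times> leaves Q"
    by (simp add: cw_morphism_def)
  then show "Cmp (CW K) f (Ide (CW K) P) = f" "Cmp (CW K) (Ide (CW K) Q) f = f"
    by (simp_all add: f Ide_CW Cmp_CW relcomp_Id_on)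
next
  fix P Q Q' f g assume "f \<in> hom (CW K) P Q" "g \<in> hom (CW K) Q Q'"
  then show "Cmp (CW K) g f \<in> hom (CW K) P Q'"
    by (auto simp: hom_CW Cmp_CW intro: cw_morphism_comp)
next
  fix P Q Q' Q'' f g h
  assume "f \<in> hom (CW K) P Q" "g \<in> hom (CW K) Q Q'" "h \<in> hom (CW K) Q' Q''"
  then show "Cmp (CW K) h (Cmp (CW K) g f) = Cmp (CW K) (Cmp (CW K) h g) f"
    by (auto simp: hom_CW Cmp_CW O_assoc)
qed

section \<open>Universal properties of conjunction and disjunction\<close>

definition proj_arrow :: "bool \<Rightarrow> 'k form \<Rightarrow> 'k form \<Rightarrow> 'k cw_arrow" where
  "proj_arrow d \<phi> \<psi> = (syntactic (And \<phi> \<psi>),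
    tagL d (Id_on (leaves (syntactic (if d then \<psi> else \<phi>)))), syntactic (if d then \<psi> else \<phi>))"

text \<open>Both injections, like both projections before, share one constant indexed by the side,
  so that a single statement covers the two; writing them as tagged identities gives access to the
  laws of tags.\<close>

definition inj_arrow :: "bool \<Rightarrow> 'k form \<Rightarrow> 'k form \<Rightarrow> 'k cw_arrow" where
  "inj_arrow d \<phi> \<psi> = (syntactic (if d then \<psi> else \<phi>),
    tagR d (Id_on (leaves (syntactic (if d then \<psi> else \<phi>)))), syntactic (Or \<phi> \<psi>))"

lemma proj_eq_proj_arrow:
  "proj1 (syntactic \<phi>) (syntactic \<psi>) = proj_arrow False \<phi> \<psi>"
  "proj2 (syntactic \<phi>) (syntactic \<psi>) = proj_arrow True \<phi> \<psi>"
  by (auto simp: proj1_def proj2_def proj_arrow_def syntactic_And)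

lemma inj_eq_inj_arrow:
  "inj1 (syntactic \<phi>) (syntactic \<psi>) = inj_arrow False \<phi> \<psi>"
  "inj2 (syntactic \<phi>) (syntactic \<psi>) = inj_arrow True \<phi> \<psi>"
  by (auto simp: inj1_def inj2_def inj_arrow_def syntactic_Or)

lemma hom_CW_syntactic:
  assumes "atoms \<phi> \<subseteq> K" "atoms \<psi> \<subseteq> K"
  shows "f \<in> hom (CW K) (syntactic \<phi>) (syntactic \<psi>) \<longleftrightarrow>
    (\<exists>R. f = (syntactic \<phi>, R, syntactic \<psi>) \<and> cw_morphism (syntactic \<phi>) (syntactic \<psi>) R)"
  using assms by (auto simp: hom_CW Obj_CW)

lemma proj_arrow_hom:
  assumes "atoms \<phi> \<subseteq> K" "atoms \<psi> \<subseteq> K"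
  shows "proj_arrow d \<phi> \<psi> \<in> hom (CW K) (syntactic (And \<phi> \<psi>)) (syntactic (if d then \<psi> else \<phi>))"
proof -
  have at: "atoms (And \<phi> \<psi>) \<subseteq> K" "atoms (if d then \<psi> else \<phi>) \<subseteq> K"
    using assms by simp_all
  show ?thesis
    unfolding hom_CW_syntactic[OF at] proj_arrow_def
    by (intro exI conjI, rule refl) (rule cw_morphism_proj[THEN iffD2, OF cw_morphism_id])
qed

lemma inj_arrow_hom:
  assumes "atoms \<phi> \<subseteq> K" "atoms \<psi> \<subseteq> K"
  shows "inj_arrow d \<phi> \<psi> \<in> hom (CW K) (syntactic (if d then \<psi> else \<phi>)) (syntactic (Or \<phi> \<psi>))"
proof -
  have at: "atoms (if d then \<psi> else \<phi>) \<subseteq> K" "atoms (Or \<phi> \<psi>) \<subseteq> K"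
    using assms by simp_all
  show ?thesis
    unfolding hom_CW_syntactic[OF at] inj_arrow_def
    by (intro exI conjI, rule refl) (rule cw_morphism_inj[THEN iffD2, OF cw_morphism_id])
qed

text \<open>The beta laws of pairing. The bounds on the two relations ensure that composing with
  \<open>Id_on\<close> changes nothing.\<close>

lemma pair_relcomp_proj:
  assumes "R\<^sub>1 \<subseteq> A \<times> X" "R\<^sub>2 \<subseteq> A \<times> Y"
  shows "(tagR False R\<^sub>1 \<union> tagR True R\<^sub>2) O tagL False (Id_on X) = R\<^sub>1"
    and "(tagR False R\<^sub>1 \<union> tagR True R\<^sub>2) O tagL True (Id_on Y) = R\<^sub>2"
  using assms by (simp_all add: relcomp_distrib2 tagR_relcomp_tagL relcomp_Id_on)

lemma inj_relcomp_copair: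
  assumes "R\<^sub>1 \<subseteq> X \<times> A" "R\<^sub>2 \<subseteq> Y \<times> A"
  shows "tagR False (Id_on X) O (tagL False R\<^sub>1 \<union> tagL True R\<^sub>2) = R\<^sub>1"
    and "tagR True (Id_on Y) O (tagL False R\<^sub>1 \<union> tagL True R\<^sub>2) = R\<^sub>2"
  using assms by (simp_all add: relcomp_distrib tagR_relcomp_tagL relcomp_Id_on)

lemma is_product_CW_syntactic:
  assumes "atoms \<phi> \<subseteq> K" "atoms \<psi> \<subseteq> K"
  shows "is_product (CW K) (syntactic \<phi>) (syntactic \<psi>) (syntactic (And \<phi> \<psi>))
    (proj_arrow False \<phi> \<psi>) (proj_arrow True \<phi> \<psi>)"
  unfolding is_product_def
proof (intro conjI ballI)
  show "syntactic (And \<phi> \<psi>) \<in> Obj (CW K)"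
    using assms by (auto simp: Obj_CW intro!: exI[of _ "And \<phi> \<psi>"])
  show "proj_arrow False \<phi> \<psi> \<in> hom (CW K) (syntactic (And \<phi> \<psi>)) (syntactic \<phi>)"
    "proj_arrow True \<phi> \<psi> \<in> hom (CW K) (syntactic (And \<phi> \<psi>)) (syntactic \<psi>)"
    using proj_arrow_hom[OF assms, of False] proj_arrow_hom[OF assms, of True] by simp_all
  fix A f g assume A: "A \<in> Obj (CW K)"
    and "f \<in> hom (CW K) A (syntactic \<phi>)" "g \<in> hom (CW K) A (syntactic \<psi>)"
  then obtain R\<^sub>1 R\<^sub>2 where f: "f = (A, R\<^sub>1, syntactic \<phi>)" and R1: "cw_morphism A (syntactic \<phi>) R\<^sub>1"
    and g: "g = (A, R\<^sub>2, syntactic \<psi>)" and R2: "cw_morphism A (syntactic \<psi>) R\<^sub>2"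
    by (auto simp: hom_CW)
  let ?h = "(A, tagR False R\<^sub>1 \<union> tagR True R\<^sub>2, syntactic (And \<phi> \<psi>))"
  note comp = pair_relcomp_proj[OF cw_morphism_subset cw_morphism_subset]
  show "\<exists>!h. h \<in> hom (CW K) A (syntactic (And \<phi> \<psi>)) \<and>
      Cmp (CW K) (proj_arrow False \<phi> \<psi>) h = f \<and> Cmp (CW K) (proj_arrow True \<phi> \<psi>) h = g"
  proof (intro ex1I conjI)
    show "?h \<in> hom (CW K) A (syntactic (And \<phi> \<psi>))"
      using A \<open>syntactic (And \<phi> \<psi>) \<in> Obj (CW K)\<close> R1 R2 by (simp add: hom_CW cw_morphism_And)
    show "Cmp (CW K) (proj_arrow False \<phi> \<psi>) ?h = f" "Cmp (CW K) (proj_arrow True \<phi> \<psi>) ?h = g"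
      using comp[OF R1 R2] by (simp_all add: proj_arrow_def Cmp_CW f g)
    fix h assume h: "h \<in> hom (CW K) A (syntactic (And \<phi> \<psi>)) \<and>
      Cmp (CW K) (proj_arrow False \<phi> \<psi>) h = f \<and> Cmp (CW K) (proj_arrow True \<phi> \<psi>) h = g"
    then obtain R where hR: "h = (A, R, syntactic (And \<phi> \<psi>))"
      and R: "cw_morphism A (syntactic (And \<phi> \<psi>)) R"
      by (auto simp: hom_CW)
    \<comment> \<open>Any relation into a disjoint union splits by the side of its targets, so a
      mediating arrow is itself a pairing, and composing with the projections recovers its
      components.\<close>
    obtain Q\<^sub>1 Q\<^sub>2 where Q: "R = tagR False Q\<^sub>1 \<union> tagR True Q\<^sub>2"
      using tagR_cases[of R "leaves A" "leaves (syntactic \<phi>)" "leaves (syntactic \<psi>)"]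
        cw_morphism_subset[OF R] by (auto simp: syntactic_And prop_product_def)
    then have "cw_morphism A (syntactic \<phi>) Q\<^sub>1" "cw_morphism A (syntactic \<psi>) Q\<^sub>2"
      using R by (simp_all add: cw_morphism_And)
    from comp[OF this] have "Q\<^sub>1 = R\<^sub>1" "Q\<^sub>2 = R\<^sub>2"
      using h by (simp_all add: hR Q f g proj_arrow_def Cmp_CW)
    then show "h = ?h"
      by (simp add: hR Q)
  qed
qed

lemma is_sum_CW_syntactic:
  assumes "atoms \<phi> \<subseteq> K" "atoms \<psi> \<subseteq> K"
  shows "is_sum (CW K) (syntactic \<phi>) (syntactic \<psi>) (syntactic (Or \<phi> \<psi>))
    (inj_arrow False \<phi> \<psi>) (inj_arrow True \<phi> \<psi>)"
  unfolding is_sum_def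
proof (intro conjI ballI)
  show "syntactic (Or \<phi> \<psi>) \<in> Obj (CW K)"
    using assms by (auto simp: Obj_CW intro!: exI[of _ "Or \<phi> \<psi>"])
  show "inj_arrow False \<phi> \<psi> \<in> hom (CW K) (syntactic \<phi>) (syntactic (Or \<phi> \<psi>))"
    "inj_arrow True \<phi> \<psi> \<in> hom (CW K) (syntactic \<psi>) (syntactic (Or \<phi> \<psi>))"
    using inj_arrow_hom[OF assms, of False] inj_arrow_hom[OF assms, of True] by simp_all
  fix A f g assume A: "A \<in> Obj (CW K)"
    and "f \<in> hom (CW K) (syntactic \<phi>) A" "g \<in> hom (CW K) (syntactic \<psi>) A"
  then obtain R\<^sub>1 R\<^sub>2 \<chi> where f: "f = (syntactic \<phi>, R\<^sub>1, A)" and R1: "cw_morphism (syntactic \<phi>) A R\<^sub>1"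
    and g: "g = (syntactic \<psi>, R\<^sub>2, A)" and R2: "cw_morphism (syntactic \<psi>) A R\<^sub>2"
    and \<chi>: "A = syntactic \<chi>"
    by (auto simp: hom_CW Obj_CW)
  let ?h = "(syntactic (Or \<phi> \<psi>), tagL False R\<^sub>1 \<union> tagL True R\<^sub>2, A)"
  note comp = inj_relcomp_copair[OF cw_morphism_subset cw_morphism_subset]
  show "\<exists>!h. h \<in> hom (CW K) (syntactic (Or \<phi> \<psi>)) A \<and>
      Cmp (CW K) h (inj_arrow False \<phi> \<psi>) = f \<and> Cmp (CW K) h (inj_arrow True \<phi> \<psi>) = g"
  proof (intro ex1I conjI)
    show "?h \<in> hom (CW K) (syntactic (Or \<phi> \<psi>)) A"
      using A \<open>syntactic (Or \<phi> \<psi>) \<in> Obj (CW K)\<close> R1 R2 by (simp add: hom_CW cw_morphism_Or \<chi>)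
    show "Cmp (CW K) ?h (inj_arrow False \<phi> \<psi>) = f" "Cmp (CW K) ?h (inj_arrow True \<phi> \<psi>) = g"
      using comp[OF R1 R2] by (simp_all add: inj_arrow_def Cmp_CW f g)
    fix h assume h: "h \<in> hom (CW K) (syntactic (Or \<phi> \<psi>)) A \<and>
      Cmp (CW K) h (inj_arrow False \<phi> \<psi>) = f \<and> Cmp (CW K) h (inj_arrow True \<phi> \<psi>) = g"
    then obtain R where hR: "h = (syntactic (Or \<phi> \<psi>), R, A)"
      and R: "cw_morphism (syntactic (Or \<phi> \<psi>)) A R"
      by (auto simp: hom_CW)
    obtain Q\<^sub>1 Q\<^sub>2 where Q: "R = tagL False Q\<^sub>1 \<union> tagL True Q\<^sub>2"
      using tagL_cases[of R "leaves (syntactic \<phi>)" "leaves (syntactic \<psi>)" "leaves A"]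
        cw_morphism_subset[OF R] by (auto simp: syntactic_Or prop_sum_def)
    then have "cw_morphism (syntactic \<phi>) A Q\<^sub>1" "cw_morphism (syntactic \<psi>) A Q\<^sub>2"
      using R by (simp_all add: cw_morphism_Or \<chi>)
    from comp[OF this] have "Q\<^sub>1 = R\<^sub>1" "Q\<^sub>2 = R\<^sub>2"
      using h by (simp_all add: hR Q f g inj_arrow_def Cmp_CW)
    then show "h = ?h"
      by (simp add: hR Q)
  qed
qed

lemma is_product_CW:
  assumes "P \<in> Obj (CW K)" "Q \<in> Obj (CW K)"
  shows "is_product (CW K) P Q (prop_product P Q) (proj1 P Q) (proj2 P Q)"
  using assms is_product_CW_syntactic
  by (auto simp: Obj_CW proj_eq_proj_arrow simp flip: syntactic_And)

lemma is_sum_CW: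
  assumes "P \<in> Obj (CW K)" "Q \<in> Obj (CW K)"
  shows "is_sum (CW K) P Q (prop_sum P Q) (inj1 P Q) (inj2 P Q)"
  using assms is_sum_CW_syntactic
  by (auto simp: Obj_CW inj_eq_inj_arrow simp flip: syntactic_Or)

lemma category_with_products_and_sums_CW: "category_with_products_and_sums (CW K)"
  unfolding category_with_products_and_sums_def
  using category_CW is_product_CW is_sum_CW by blast

section \<open>Recovering a formula from its proposition\<close>

lemma form_eqI:
  assumes "leaf_paths \<phi> = leaf_paths \<psi>"
    and "\<And>p. p \<in> leaf_paths \<phi> \<Longrightarrow> leaf_label \<phi> p = leaf_label \<psi> p"
    and "\<And>s. maximal_And_free \<phi> s \<longleftrightarrow> maximal_And_free \<psi> s"
  shows "\<phi> = \<psi>"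
  using assms
proof (induction \<phi> arbitrary: \<psi>)
  case (Atom k)
  have "[] \<in> leaf_paths \<psi>"
    using Atom(1) by auto
  then obtain l where "\<psi> = Atom l"
    by (cases \<psi>) auto
  then show ?case
    using Atom(2)[of "[]"] by simp
next
  case (And \<phi>\<^sub>1 \<phi>\<^sub>2)
  show ?case
  proof (cases \<psi>)
    case (Atom l)
    then have "[] \<in> leaf_paths (And \<phi>\<^sub>1 \<phi>\<^sub>2)"
      using And.prems(1) by simp
    then show ?thesis
      by simp
  next
    case (Or \<psi>\<^sub>1 \<psi>\<^sub>2)
    \<comment> \<open>The two connectives are told apart by \<open>s \<uplus> {}\<close>: it is a
      resolution of the conjunction, but as a resolution of a disjunction it would make the empty
      set a resolution of the right disjunct.\<close>
    obtain s where "maximal_And_free \<phi>\<^sub>1 s"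
      using syntactic_perp[of \<phi>\<^sub>1] by (auto simp: resolutions_syntactic)
    then have "maximal_And_free \<psi>\<^sub>2 {}"
      using And.prems(3)[of "s \<uplus> {}"] by (simp add: Or maximal_And_free_And maximal_And_free_Or)
    then show ?thesis
      by (simp add: maximal_And_free_nonempty)
  next
    case \<psi>: (And \<psi>\<^sub>1 \<psi>\<^sub>2)
    have "\<phi>\<^sub>1 = \<psi>\<^sub>1"
      using And.prems(1) And.prems(2)[of "False # _"] And.prems(3)[of "_ \<uplus> {}"]
      by (intro And.IH(1)) (simp_all add: \<psi> maximal_And_free_And maximal_And_free_nonempty)
    moreover have "\<phi>\<^sub>2 = \<psi>\<^sub>2"
      using And.prems(1) And.prems(2)[of "True # _"] And.prems(3)[of "{} \<uplus> _"]
      by (intro And.IH(2)) (simp_all add: \<psi> maximal_And_free_And maximal_And_free_nonempty)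
    ultimately show ?thesis
      by (simp add: \<psi>)
  qed
next
  case (Or \<phi>\<^sub>1 \<phi>\<^sub>2)
  show ?case
  proof (cases \<psi>)
    case (Atom l)
    then have "[] \<in> leaf_paths (Or \<phi>\<^sub>1 \<phi>\<^sub>2)"
      using Or.prems(1) by simp
    then show ?thesis
      by simp
  next
    case (And \<psi>\<^sub>1 \<psi>\<^sub>2)
    obtain s where "maximal_And_free \<psi>\<^sub>1 s"
      using syntactic_perp[of \<psi>\<^sub>1] by (auto simp: resolutions_syntactic)
    then have "maximal_And_free \<phi>\<^sub>2 {}"
      using Or.prems(3)[of "s \<uplus> {}"] by (simp add: And maximal_And_free_And maximal_And_free_Or)
    then show ?thesis
      by (simp add: maximal_And_free_nonempty)
  next
    case \<psi>: (Or \<psi>\<^sub>1 \<psi>\<^sub>2)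
    obtain s where s: "maximal_And_free \<phi>\<^sub>1 s"
      using syntactic_perp[of \<phi>\<^sub>1] by (auto simp: resolutions_syntactic)
    obtain t where t: "maximal_And_free \<phi>\<^sub>2 t"
      using syntactic_perp[of \<phi>\<^sub>2] by (auto simp: resolutions_syntactic)
    \<comment> \<open>The resolutions of a disjunction form a rectangle. Fixing one coordinate at
      \<open>s\<close> or \<open>t\<close>, which exist on both sides, recovers each factor.\<close>
    have m: "maximal_And_free \<phi>\<^sub>1 u \<and> maximal_And_free \<phi>\<^sub>2 v \<longleftrightarrow>
        maximal_And_free \<psi>\<^sub>1 u \<and> maximal_And_free \<psi>\<^sub>2 v" for u v
      using Or.prems(3)[of "u \<uplus> v"] by (simp add: \<psi> maximal_And_free_Or)
    have "\<phi>\<^sub>1 = \<psi>\<^sub>1"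
      using Or.prems(1) Or.prems(2)[of "False # _"] m s t
      by (intro Or.IH(1)) (simp_all add: \<psi>, blast)
    moreover have "\<phi>\<^sub>2 = \<psi>\<^sub>2"
      using Or.prems(1) Or.prems(2)[of "True # _"] m s t
      by (intro Or.IH(2)) (simp_all add: \<psi>, blast)
    ultimately show ?thesis
      by (simp add: \<psi>)
  qed
qed

text \<open>Permits decoding the objects of \<open>CW K\<close> into formulas by
  \<open>inv syntactic\<close>, which is how recursion on formulas defines functors and
  transformations on propositions.\<close>

lemma inj_syntactic: "inj syntactic"
proof (rule injI)
  fix \<phi> \<psi> :: "'k form" assume eq: "syntactic \<phi> = syntactic \<psi>"
  have leaves: "leaf_paths \<phi> = leaf_paths \<psi>"
    using arg_cong[OF eq, of leaves] by (simp add: syntactic_def)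
  show "\<phi> = \<psi>"
  proof (rule form_eqI[OF leaves])
    show "leaf_label \<phi> p = leaf_label \<psi> p" if "p \<in> leaf_paths \<phi>" for p
      using fun_cong[OF arg_cong[OF eq, of label], of p] that leaves by (simp add: syntactic_def)
    show "maximal_And_free \<phi> s \<longleftrightarrow> maximal_And_free \<psi> s" for s
      using arg_cong[OF eq, of resolutions] by (auto simp: resolutions_syntactic)
  qed
qed

lemma syntactic_eq_iff [simp]: "syntactic \<phi> = syntactic \<psi> \<longleftrightarrow> \<phi> = \<psi>"
  using inj_syntactic by (auto dest: injD)

section \<open>Interpretation of derivations\<close>

text \<open>Existence of cones is replaced by a choice, so that \<open>ob\<close> can be defined by
  recursion. The map \<open>H\<close> is constrained on \<open>K\<close> only, which is why the
  lemmas that need objects of \<open>D\<close> assume their atoms to lie in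
  \<open>K\<close>.\<close>

locale chosen_products_and_sums =
  fixes D :: "('o, 'm) cat" and K :: "'k set" and H :: "'k \<Rightarrow> 'o"
    and prd :: "'o \<Rightarrow> 'o \<Rightarrow> 'o" and pr :: "bool \<Rightarrow> 'o \<Rightarrow> 'o \<Rightarrow> 'm"
    and sm :: "'o \<Rightarrow> 'o \<Rightarrow> 'o" and inj :: "bool \<Rightarrow> 'o \<Rightarrow> 'o \<Rightarrow> 'm"
  assumes D: "category D"
    and H: "\<And>k. k \<in> K \<Longrightarrow> H k \<in> Obj D"
    and product: "\<And>a b. a \<in> Obj D \<Longrightarrow> b \<in> Obj D \<Longrightarrow>
      is_product D a b (prd a b) (pr False a b) (pr True a b)"
    and sum: "\<And>a b. a \<in> Obj D \<Longrightarrow> b \<in> Obj D \<Longrightarrow>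
      is_sum D a b (sm a b) (inj False a b) (inj True a b)"
begin

primrec ob :: "'k form \<Rightarrow> 'o" where
  "ob (Atom k) = H k"
| "ob (And \<phi> \<psi>) = prd (ob \<phi>) (ob \<psi>)"
| "ob (Or \<phi> \<psi>) = sm (ob \<phi>) (ob \<psi>)"

text \<open>The pairing rule takes the mediating arrow \<open>m\<close> as given and asks that its
  two composites with the projections be interpretations, which avoids a description operator inside
  the definition; copairing is treated dually. Totality and uniqueness are proved
  afterwards.\<close>

inductive interp :: "'k form \<Rightarrow> 'k form \<Rightarrow> (path \<times> path) set \<Rightarrow> 'm \<Rightarrow> bool" where
  atom: "interp (Atom k) (Atom k) {([], [])} (Ide D (H k))"
| pair: "interp \<chi> \<phi> R\<^sub>1 (Cmp D (pr False (ob \<phi>) (ob \<psi>)) m) \<Longrightarrow>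
    interp \<chi> \<psi> R\<^sub>2 (Cmp D (pr True (ob \<phi>) (ob \<psi>)) m) \<Longrightarrow> m \<in> hom D (ob \<chi>) (ob (And \<phi> \<psi>)) \<Longrightarrow>
    interp \<chi> (And \<phi> \<psi>) (tagR False R\<^sub>1 \<union> tagR True R\<^sub>2) m"
| copair: "interp \<phi> \<chi> R\<^sub>1 (Cmp D m (inj False (ob \<phi>) (ob \<psi>))) \<Longrightarrow>
    interp \<psi> \<chi> R\<^sub>2 (Cmp D m (inj True (ob \<phi>) (ob \<psi>))) \<Longrightarrow> m \<in> hom D (ob (Or \<phi> \<psi>)) (ob \<chi>) \<Longrightarrow>
    interp (Or \<phi> \<psi>) \<chi> (tagL False R\<^sub>1 \<union> tagL True R\<^sub>2) m"
| proj: "interp (if d then \<psi> else \<phi>) \<chi> R m \<Longrightarrow>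
    interp (And \<phi> \<psi>) \<chi> (tagL d R) (Cmp D m (pr d (ob \<phi>) (ob \<psi>)))"
| inj: "interp \<chi> (if d then \<psi> else \<phi>) R m \<Longrightarrow>
    interp \<chi> (Or \<phi> \<psi>) (tagR d R) (Cmp D (inj d (ob \<phi>) (ob \<psi>)) m)"

lemma ob_Obj: "atoms \<phi> \<subseteq> K \<Longrightarrow> ob \<phi> \<in> Obj D"
  by (induction \<phi>) (auto simp: H intro: is_productD[OF product] is_sumD[OF sum])

lemma product_ob:
  assumes "atoms \<phi> \<subseteq> K" "atoms \<psi> \<subseteq> K"
  shows "is_product D (ob \<phi>) (ob \<psi>) (ob (And \<phi> \<psi>)) (pr False (ob \<phi>) (ob \<psi>)) (pr True (ob \<phi>) (ob \<psi>))"
  using product assms by (simp add: ob_Obj)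

lemma sum_ob:
  assumes "atoms \<phi> \<subseteq> K" "atoms \<psi> \<subseteq> K"
  shows "is_sum D (ob \<phi>) (ob \<psi>) (ob (Or \<phi> \<psi>)) (inj False (ob \<phi>) (ob \<psi>)) (inj True (ob \<phi>) (ob \<psi>))"
  using sum assms by (simp add: ob_Obj)

lemma pr_hom:
  assumes "atoms \<phi> \<subseteq> K" "atoms \<psi> \<subseteq> K"
  shows "pr d (ob \<phi>) (ob \<psi>) \<in> hom D (ob (And \<phi> \<psi>)) (ob (if d then \<psi> else \<phi>))"
  using is_productD[OF product_ob[OF assms]] by (cases d) simp_all

lemma inj_hom:
  assumes "atoms \<phi> \<subseteq> K" "atoms \<psi> \<subseteq> K"
  shows "inj d (ob \<phi>) (ob \<psi>) \<in> hom D (ob (if d then \<psi> else \<phi>)) (ob (Or \<phi> \<psi>))"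
  using is_sumD[OF sum_ob[OF assms]] by (cases d) simp_all

lemma interp_hom:
  "interp \<phi> \<psi> R m \<Longrightarrow> atoms \<phi> \<subseteq> K \<Longrightarrow> atoms \<psi> \<subseteq> K \<Longrightarrow> m \<in> hom D (ob \<phi>) (ob \<psi>)"
proof (induction rule: interp.induct)
  case (atom k)
  then show ?case
    using Ide_hom[OF D H] by simp
next
  case (proj d \<psi> \<phi> \<chi> R m)
  then have "m \<in> hom D (ob (if d then \<psi> else \<phi>)) (ob \<chi>)"
    by (cases d) simp_all
  then show ?case
    using proj.prems by (intro Cmp_hom[OF D pr_hom]) simp_all
next
  case (inj \<chi> d \<psi> \<phi> R m)
  then have "m \<in> hom D (ob \<chi>) (ob (if d then \<psi> else \<phi>))"
    by (cases d) simp_all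
  then show ?case
    using inj.prems by (intro Cmp_hom[OF D _ inj_hom]) simp_all
qed

lemma interp_deriv: "interp \<phi> \<psi> R m \<Longrightarrow> deriv \<phi> \<psi> R"
  by (induction rule: interp.induct) (blast intro: deriv.intros)+

lemma interp_total:
  "deriv \<phi> \<psi> R \<Longrightarrow> atoms \<phi> \<subseteq> K \<Longrightarrow> atoms \<psi> \<subseteq> K \<Longrightarrow> \<exists>m. interp \<phi> \<psi> R m"
proof (induction rule: deriv.induct)
  case (atom k)
  then show ?case
    using interp.atom by blast
next
  case (pair \<chi> \<phi> R\<^sub>1 \<psi> R\<^sub>2)
  have at: "atoms \<phi> \<subseteq> K" "atoms \<psi> \<subseteq> K"
    using pair.prems by simp_all
  obtain m\<^sub>1 m\<^sub>2 where m: "interp \<chi> \<phi> R\<^sub>1 m\<^sub>1" "interp \<chi> \<psi> R\<^sub>2 m\<^sub>2"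
    using pair.IH pair.prems(1) at by blast
  obtain m where "m \<in> hom D (ob \<chi>) (ob (And \<phi> \<psi>))"
    "Cmp D (pr False (ob \<phi>) (ob \<psi>)) m = m\<^sub>1" "Cmp D (pr True (ob \<phi>) (ob \<psi>)) m = m\<^sub>2"
    using product_pairing[OF D product_ob[OF at] interp_hom[OF m(1) pair.prems(1) at(1)]
        interp_hom[OF m(2) pair.prems(1) at(2)]] .
  then show ?case
    using interp.pair m by metis
next
  case (copair \<phi> \<chi> R\<^sub>1 \<psi> R\<^sub>2)
  have at: "atoms \<phi> \<subseteq> K" "atoms \<psi> \<subseteq> K"
    using copair.prems by simp_all
  obtain m\<^sub>1 m\<^sub>2 where m: "interp \<phi> \<chi> R\<^sub>1 m\<^sub>1" "interp \<psi> \<chi> R\<^sub>2 m\<^sub>2"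
    using copair.IH copair.prems(2) at by blast
  obtain m where "m \<in> hom D (ob (Or \<phi> \<psi>)) (ob \<chi>)"
    "Cmp D m (inj False (ob \<phi>) (ob \<psi>)) = m\<^sub>1" "Cmp D m (inj True (ob \<phi>) (ob \<psi>)) = m\<^sub>2"
    using sum_copairing[OF D sum_ob[OF at] interp_hom[OF m(1) at(1) copair.prems(2)]
        interp_hom[OF m(2) at(2) copair.prems(2)]] .
  then show ?case
    using interp.copair m by metis
next
  case (proj d \<psi> \<phi> \<chi> R)
  then obtain m where "interp (if d then \<psi> else \<phi>) \<chi> R m"
    by (cases d) auto
  then show ?case
    using interp.proj by blast
next
  case (inj \<chi> d \<psi> \<phi> R)
  then obtain m where "interp \<chi> (if d then \<psi> else \<phi>) R m"
    by (cases d) auto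
  then show ?case
    using interp.inj by blast
qed

lemma interp_proj_id:
  assumes "interp (if d then \<psi> else \<phi>) (if d then \<psi> else \<phi>) R (Ide D (ob (if d then \<psi> else \<phi>)))"
    and "atoms \<phi> \<subseteq> K" "atoms \<psi> \<subseteq> K"
  shows "interp (And \<phi> \<psi>) (if d then \<psi> else \<phi>) (tagL d R) (pr d (ob \<phi>) (ob \<psi>))"
  using interp.proj[OF assms(1)] Cmp_Ide_left[OF D pr_hom[OF assms(2,3)]] by simp

lemma interp_inj_id:
  assumes "interp (if d then \<psi> else \<phi>) (if d then \<psi> else \<phi>) R (Ide D (ob (if d then \<psi> else \<phi>)))"
    and "atoms \<phi> \<subseteq> K" "atoms \<psi> \<subseteq> K"
  shows "interp (if d then \<psi> else \<phi>) (Or \<phi> \<psi>) (tagR d R) (inj d (ob \<phi>) (ob \<psi>))"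
  using interp.inj[OF assms(1)] Cmp_Ide_right[OF D inj_hom[OF assms(2,3)]] by simp

text \<open>The expansion of identities: the identity relation on a conjunction is the pairing of
  the two projections, each being a tagged smaller identity. It follows that the chosen projections
  and injections are interpretations too.\<close>

lemma interp_id:
  "atoms \<phi> \<subseteq> K \<Longrightarrow> interp \<phi> \<phi> (Id_on (leaves (syntactic \<phi>))) (Ide D (ob \<phi>))"
proof (induction \<phi>)
  case (Atom k)
  have "Id_on {[]} = {([] :: path, [] :: path)}"
    by auto
  then show ?case
    using interp.atom[of k] by (simp add: syntactic_Atom generator_def)
next
  case (And \<phi> \<psi>)
  have at: "atoms \<phi> \<subseteq> K" "atoms \<psi> \<subseteq> K"
    using And.prems by simp_all
  have e: "Cmp D (pr d (ob \<phi>) (ob \<psi>)) (Ide D (ob (And \<phi> \<psi>))) = pr d (ob \<phi>) (ob \<psi>)" for d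
    using Cmp_Ide_right[OF D pr_hom[OF at]] .
  have "interp (And \<phi> \<psi>) (And \<phi> \<psi>) (tagR False (tagL False (Id_on (leaves (syntactic \<phi>)))) \<union>
      tagR True (tagL True (Id_on (leaves (syntactic \<psi>))))) (Ide D (ob (And \<phi> \<psi>)))"
    using And.IH at e interp_proj_id[of False \<psi> \<phi>] interp_proj_id[of True \<psi> \<phi>]
      Ide_hom[OF D ob_Obj[OF And.prems]]
    by (intro interp.pair) simp_all
  then show ?case
    by (simp add: syntactic_And prop_product_def Id_on_path_plus)
next
  case (Or \<phi> \<psi>)
  have at: "atoms \<phi> \<subseteq> K" "atoms \<psi> \<subseteq> K"
    using Or.prems by simp_all
  have e: "Cmp D (Ide D (ob (Or \<phi> \<psi>))) (inj d (ob \<phi>) (ob \<psi>)) = inj d (ob \<phi>) (ob \<psi>)" for d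
    using Cmp_Ide_left[OF D inj_hom[OF at]] .
  have "interp (Or \<phi> \<psi>) (Or \<phi> \<psi>) (tagL False (tagR False (Id_on (leaves (syntactic \<phi>)))) \<union>
      tagL True (tagR True (Id_on (leaves (syntactic \<psi>))))) (Ide D (ob (Or \<phi> \<psi>)))"
    using Or.IH at e interp_inj_id[of False \<psi> \<phi>] interp_inj_id[of True \<psi> \<phi>]
      Ide_hom[OF D ob_Obj[OF Or.prems]]
    by (intro interp.copair) simp_all
  then show ?case
    by (simp add: syntactic_Or prop_sum_def Id_on_path_plus tag_commute)
qed

lemmas interp_pr = interp_proj_id[OF interp_id] and interp_in = interp_inj_id[OF interp_id]

text \<open>Cut elimination, tracking relation and arrow at once. In a commuting case one of the
  outer formulas shrinks, in a principal case the middle formula does, so the sum of the three sizes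
  decreases in each.\<close>

lemma interp_comp:
  "interp \<phi> \<psi> R m \<Longrightarrow> interp \<psi> \<chi> Q n \<Longrightarrow> atoms \<phi> \<subseteq> K \<Longrightarrow> atoms \<psi> \<subseteq> K \<Longrightarrow> atoms \<chi> \<subseteq> K \<Longrightarrow>
    interp \<phi> \<chi> (R O Q) (Cmp D n m)"
proof (induction "size \<phi> + size \<psi> + size \<chi>" arbitrary: \<phi> \<psi> \<chi> R Q m n rule: less_induct)
  case less
  note M = less.prems(1) and N = less.prems(2) and at = less.prems(3-5)
  note m = interp_hom[OF M at(1,2)] and n = interp_hom[OF N at(2,3)]
  note IH = less.hyps
  \<comment> \<open>The four commuting cases come before the case analysis, since each meets several
    last rules of the other derivation. The cut moves into the premises, and associativity in
    \<open>D\<close> matches the arrows.\<close>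
  have pairR: ?case
    if \<chi>: "\<chi> = And \<chi>\<^sub>1 \<chi>\<^sub>2" and Q: "Q = tagR False Q\<^sub>1 \<union> tagR True Q\<^sub>2"
      and 1: "interp \<psi> \<chi>\<^sub>1 Q\<^sub>1 (Cmp D (pr False (ob \<chi>\<^sub>1) (ob \<chi>\<^sub>2)) n)"
      and 2: "interp \<psi> \<chi>\<^sub>2 Q\<^sub>2 (Cmp D (pr True (ob \<chi>\<^sub>1) (ob \<chi>\<^sub>2)) n)" for \<chi>\<^sub>1 \<chi>\<^sub>2 Q\<^sub>1 Q\<^sub>2
  proof -
    have a: "atoms \<chi>\<^sub>1 \<subseteq> K" "atoms \<chi>\<^sub>2 \<subseteq> K"
      using at(3) by (simp_all add: \<chi>)
    have assoc: "Cmp D (Cmp D (pr d (ob \<chi>\<^sub>1) (ob \<chi>\<^sub>2)) n) m = Cmp D (pr d (ob \<chi>\<^sub>1) (ob \<chi>\<^sub>2)) (Cmp D n m)" for d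
      using Cmp_assoc[OF D m n[unfolded \<chi>] pr_hom[OF a]] .
    have "interp \<phi> (And \<chi>\<^sub>1 \<chi>\<^sub>2) (tagR False (R O Q\<^sub>1) \<union> tagR True (R O Q\<^sub>2)) (Cmp D n m)"
    proof (rule interp.pair)
      show "interp \<phi> \<chi>\<^sub>1 (R O Q\<^sub>1) (Cmp D (pr False (ob \<chi>\<^sub>1) (ob \<chi>\<^sub>2)) (Cmp D n m))"
        using IH[OF _ M 1] a at by (simp add: assoc \<chi>)
      show "interp \<phi> \<chi>\<^sub>2 (R O Q\<^sub>2) (Cmp D (pr True (ob \<chi>\<^sub>1) (ob \<chi>\<^sub>2)) (Cmp D n m))"
        using IH[OF _ M 2] a at by (simp add: assoc \<chi>)
      show "Cmp D n m \<in> hom D (ob \<phi>) (ob (And \<chi>\<^sub>1 \<chi>\<^sub>2))"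
        using Cmp_hom[OF D m n] by (simp add: \<chi>)
    qed
    then show ?thesis
      by (simp add: \<chi> Q relcomp_distrib tag_relcomp)
  qed
  have copairL: ?case
    if \<phi>: "\<phi> = Or \<phi>\<^sub>1 \<phi>\<^sub>2" and R: "R = tagL False R\<^sub>1 \<union> tagL True R\<^sub>2"
      and 1: "interp \<phi>\<^sub>1 \<psi> R\<^sub>1 (Cmp D m (inj False (ob \<phi>\<^sub>1) (ob \<phi>\<^sub>2)))"
      and 2: "interp \<phi>\<^sub>2 \<psi> R\<^sub>2 (Cmp D m (inj True (ob \<phi>\<^sub>1) (ob \<phi>\<^sub>2)))" for \<phi>\<^sub>1 \<phi>\<^sub>2 R\<^sub>1 R\<^sub>2
  proof -
    have a: "atoms \<phi>\<^sub>1 \<subseteq> K" "atoms \<phi>\<^sub>2 \<subseteq> K"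
      using at(1) by (simp_all add: \<phi>)
    have assoc: "Cmp D n (Cmp D m (inj d (ob \<phi>\<^sub>1) (ob \<phi>\<^sub>2))) = Cmp D (Cmp D n m) (inj d (ob \<phi>\<^sub>1) (ob \<phi>\<^sub>2))" for d
      using Cmp_assoc[OF D inj_hom[OF a] m[unfolded \<phi>] n] by simp
    have "interp (Or \<phi>\<^sub>1 \<phi>\<^sub>2) \<chi> (tagL False (R\<^sub>1 O Q) \<union> tagL True (R\<^sub>2 O Q)) (Cmp D n m)"
    proof (rule interp.copair)
      show "interp \<phi>\<^sub>1 \<chi> (R\<^sub>1 O Q) (Cmp D (Cmp D n m) (inj False (ob \<phi>\<^sub>1) (ob \<phi>\<^sub>2)))"
        using IH[OF _ 1 N] a at by (simp add: assoc \<phi>)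
      show "interp \<phi>\<^sub>2 \<chi> (R\<^sub>2 O Q) (Cmp D (Cmp D n m) (inj True (ob \<phi>\<^sub>1) (ob \<phi>\<^sub>2)))"
        using IH[OF _ 2 N] a at by (simp add: assoc \<phi>)
      show "Cmp D n m \<in> hom D (ob (Or \<phi>\<^sub>1 \<phi>\<^sub>2)) (ob \<chi>)"
        using Cmp_hom[OF D m n] by (simp add: \<phi>)
    qed
    then show ?thesis
      by (simp add: \<phi> R relcomp_distrib2 tag_relcomp)
  qed
  have injR: ?case
    if \<chi>: "\<chi> = Or \<chi>\<^sub>1 \<chi>\<^sub>2" and Q: "Q = tagR d Q'" and n': "n = Cmp D (inj d (ob \<chi>\<^sub>1) (ob \<chi>\<^sub>2)) n'"
      and N': "interp \<psi> (if d then \<chi>\<^sub>2 else \<chi>\<^sub>1) Q' n'" for d \<chi>\<^sub>1 \<chi>\<^sub>2 Q' n'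
  proof -
    have a: "atoms \<chi>\<^sub>1 \<subseteq> K" "atoms \<chi>\<^sub>2 \<subseteq> K" "atoms (if d then \<chi>\<^sub>2 else \<chi>\<^sub>1) \<subseteq> K"
      using at(3) by (simp_all add: \<chi>)
    have "interp \<phi> (if d then \<chi>\<^sub>2 else \<chi>\<^sub>1) (R O Q') (Cmp D n' m)"
      using IH[OF _ M N' at(1,2) a(3)] by (simp add: \<chi>)
    from interp.inj[OF this] show ?thesis
      using Cmp_assoc[OF D m interp_hom[OF N' at(2) a(3)] inj_hom[OF a(1,2)]]
      by (simp add: \<chi> Q n' tag_relcomp)
  qed
  have projL: ?case
    if \<phi>: "\<phi> = And \<phi>\<^sub>1 \<phi>\<^sub>2" and R: "R = tagL d R'" and m': "m = Cmp D m' (pr d (ob \<phi>\<^sub>1) (ob \<phi>\<^sub>2))"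
      and M': "interp (if d then \<phi>\<^sub>2 else \<phi>\<^sub>1) \<psi> R' m'" for d \<phi>\<^sub>1 \<phi>\<^sub>2 R' m'
  proof -
    have a: "atoms \<phi>\<^sub>1 \<subseteq> K" "atoms \<phi>\<^sub>2 \<subseteq> K" "atoms (if d then \<phi>\<^sub>2 else \<phi>\<^sub>1) \<subseteq> K"
      using at(1) by (simp_all add: \<phi>)
    have "interp (if d then \<phi>\<^sub>2 else \<phi>\<^sub>1) \<chi> (R' O Q) (Cmp D n m')"
      using IH[OF _ M' N a(3) at(2,3)] by (simp add: \<phi>)
    from interp.proj[OF this] show ?thesis
      using Cmp_assoc[OF D pr_hom[OF a(1,2)] interp_hom[OF M' a(3) at(2)] n]
      by (simp add: \<phi> R m' tag_relcomp)
  qed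
  from M show ?case
  proof (cases rule: interp.cases)
    case (atom k)
    have "{([], [])} O Q = Q"
      using cw_morphism_subset[OF deriv_sound[OF interp_deriv[OF N]]]
      by (auto simp: atom syntactic_Atom generator_def)
    then show ?thesis
      using N Cmp_Ide_right[OF D n] by (simp add: atom)
  next
    case (copair \<phi>\<^sub>1 R\<^sub>1 \<phi>\<^sub>2 R\<^sub>2)
    then show ?thesis
      using copairL by blast
  next
    case (proj d \<phi>\<^sub>2 \<phi>\<^sub>1 R' m')
    then show ?thesis
      using projL by blast
  next
    case M: (pair \<psi>\<^sub>1 R\<^sub>1 \<psi>\<^sub>2 R\<^sub>2)
    from N show ?thesis
    proof (cases rule: interp.cases)
      case (pair \<chi>\<^sub>1 Q\<^sub>1 \<chi>\<^sub>2 Q\<^sub>2)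
      then show ?thesis
        using pairR by blast
    next
      case (inj d \<chi>\<^sub>2 \<chi>\<^sub>1 Q' n')
      then show ?thesis
        using injR by blast
    next
      case (proj d \<psi>\<^sub>2' \<psi>\<^sub>1' Q' n')
      then have N': "interp (if d then \<psi>\<^sub>2 else \<psi>\<^sub>1) \<chi> Q' n'"
        and n': "n = Cmp D n' (pr d (ob \<psi>\<^sub>1) (ob \<psi>\<^sub>2))" and Q: "Q = tagL d Q'"
        using M(1) by (cases d; simp)+
      have a: "atoms \<psi>\<^sub>1 \<subseteq> K" "atoms \<psi>\<^sub>2 \<subseteq> K" "atoms (if d then \<psi>\<^sub>2 else \<psi>\<^sub>1) \<subseteq> K"
        using at(2) by (simp_all add: M(1))
      \<comment> \<open>Principal cut of a pairing against a projection: the component on side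
        \<open>d\<close> survives and is cut with the premise of the projection.\<close>
      let ?R = "if d then R\<^sub>2 else R\<^sub>1" and ?m = "Cmp D (pr d (ob \<psi>\<^sub>1) (ob \<psi>\<^sub>2)) m"
      have "interp \<phi> (if d then \<psi>\<^sub>2 else \<psi>\<^sub>1) ?R ?m"
        using M by (cases d) simp_all
      from IH[OF _ this N' at(1) a(3) at(3)] have "interp \<phi> \<chi> (?R O Q') (Cmp D n' ?m)"
        by (simp add: M(1))
      moreover have "Cmp D n m = Cmp D n' ?m"
        unfolding n' using Cmp_assoc[OF D m[unfolded M(1)] pr_hom[OF a(1,2)]
            interp_hom[OF N' a(3) at(3)]] .
      moreover have "R O Q = ?R O Q'"
        by (simp add: M(2) Q relcomp_distrib2 tagR_relcomp_tagL)
      ultimately show ?thesis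
        by simp
    qed (use M in simp_all)
  next
    case M: (inj d \<psi>\<^sub>2 \<psi>\<^sub>1 R' m')
    from N show ?thesis
    proof (cases rule: interp.cases)
      case (pair \<chi>\<^sub>1 Q\<^sub>1 \<chi>\<^sub>2 Q\<^sub>2)
      then show ?thesis
        using pairR by blast
    next
      case (inj d \<chi>\<^sub>2 \<chi>\<^sub>1 Q' n')
      then show ?thesis
        using injR by blast
    next
      case (copair \<psi>\<^sub>1' Q\<^sub>1 \<psi>\<^sub>2' Q\<^sub>2)
      then have N': "interp \<psi>\<^sub>1 \<chi> Q\<^sub>1 (Cmp D n (inj False (ob \<psi>\<^sub>1) (ob \<psi>\<^sub>2)))"
        "interp \<psi>\<^sub>2 \<chi> Q\<^sub>2 (Cmp D n (inj True (ob \<psi>\<^sub>1) (ob \<psi>\<^sub>2)))"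
        and Q: "Q = tagL False Q\<^sub>1 \<union> tagL True Q\<^sub>2"
        using M(1) by simp_all
      have a: "atoms \<psi>\<^sub>1 \<subseteq> K" "atoms \<psi>\<^sub>2 \<subseteq> K" "atoms (if d then \<psi>\<^sub>2 else \<psi>\<^sub>1) \<subseteq> K"
        using at(2) by (simp_all add: M(1))
      \<comment> \<open>Principal cut of an injection against a copairing, the mirror image of the
        previous one.\<close>
      let ?Q = "if d then Q\<^sub>2 else Q\<^sub>1" and ?n = "Cmp D n (inj d (ob \<psi>\<^sub>1) (ob \<psi>\<^sub>2))"
      have "interp (if d then \<psi>\<^sub>2 else \<psi>\<^sub>1) \<chi> ?Q ?n"
        using N' by (cases d) simp_all
      from IH[OF _ M(4) this at(1) a(3) at(3)] have "interp \<phi> \<chi> (R' O ?Q) (Cmp D ?n m')"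
        by (simp add: M(1))
      moreover have "Cmp D n m = Cmp D ?n m'"
        unfolding M(3) using Cmp_assoc[OF D interp_hom[OF M(4) at(1) a(3)] inj_hom[OF a(1,2)]
            n[unfolded M(1)]] by simp
      moreover have "R O Q = R' O ?Q"
        by (simp add: M(2) Q relcomp_distrib tagR_relcomp_tagL)
      ultimately show ?thesis
        by simp
    qed (use M in simp_all)
  qed
qed

text \<open>For a conjunction on the right, or a disjunction on the left, the last rules are
  irrelevant: a product or sum cone separates arrows, and the composites with it interpret a common
  relation between smaller formulas. Only projections and injections remain to be compared with each
  other.\<close>

lemma interp_unique:
  "interp \<phi> \<psi> R m \<Longrightarrow> interp \<phi> \<psi> R n \<Longrightarrow> atoms \<phi> \<subseteq> K \<Longrightarrow> atoms \<psi> \<subseteq> K \<Longrightarrow> m = n"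
proof (induction "size \<phi> + size \<psi>" arbitrary: \<phi> \<psi> R m n rule: less_induct)
  case less
  note M = less.prems(1) and N = less.prems(2) and at = less.prems(3,4)
  note m = interp_hom[OF M at] and n = interp_hom[OF N at]
  note IH = less.hyps
  have And: ?case if \<psi>: "\<psi> = And \<psi>\<^sub>1 \<psi>\<^sub>2" for \<psi>\<^sub>1 \<psi>\<^sub>2
  proof -
    have a: "atoms \<psi>\<^sub>1 \<subseteq> K" "atoms \<psi>\<^sub>2 \<subseteq> K"
      using at(2) by (simp_all add: \<psi>)
    have "Cmp D (pr d (ob \<psi>\<^sub>1) (ob \<psi>\<^sub>2)) m = Cmp D (pr d (ob \<psi>\<^sub>1) (ob \<psi>\<^sub>2)) n" for d
    proof -
      have ad: "atoms (if d then \<psi>\<^sub>2 else \<psi>\<^sub>1) \<subseteq> K"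
        using a by simp
      show ?thesis
        by (rule IH[OF _ interp_comp[OF M[unfolded \<psi>] interp_pr[OF ad a] at(1) at(2)[unfolded \<psi>] ad]
              interp_comp[OF N[unfolded \<psi>] interp_pr[OF ad a] at(1) at(2)[unfolded \<psi>] ad] at(1) ad])
          (simp add: \<psi>)
    qed
    then show ?thesis
      using product_ext[OF D product_ob[OF a] m[unfolded \<psi>] n[unfolded \<psi>]] by blast
  qed
  have Or: ?case if \<phi>: "\<phi> = Or \<phi>\<^sub>1 \<phi>\<^sub>2" for \<phi>\<^sub>1 \<phi>\<^sub>2
  proof -
    have a: "atoms \<phi>\<^sub>1 \<subseteq> K" "atoms \<phi>\<^sub>2 \<subseteq> K"
      using at(1) by (simp_all add: \<phi>)
    have "Cmp D m (inj d (ob \<phi>\<^sub>1) (ob \<phi>\<^sub>2)) = Cmp D n (inj d (ob \<phi>\<^sub>1) (ob \<phi>\<^sub>2))" for d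
    proof -
      have ad: "atoms (if d then \<phi>\<^sub>2 else \<phi>\<^sub>1) \<subseteq> K"
        using a by simp
      show ?thesis
        by (rule IH[OF _ interp_comp[OF interp_in[OF ad a] M[unfolded \<phi>] ad at(1)[unfolded \<phi>] at(2)]
              interp_comp[OF interp_in[OF ad a] N[unfolded \<phi>] ad at(1)[unfolded \<phi>] at(2)] ad at(2)])
          (simp add: \<phi>)
    qed
    then show ?thesis
      using sum_ext[OF D sum_ob[OF a] m[unfolded \<phi>] n[unfolded \<phi>]] by blast
  qed
  \<comment> \<open>A relation that factors both through a projection and through an injection factors
    through both at once, and the two interpretations are the two ways around a square.\<close>
  have mixed: "Cmp D m' (pr d (ob \<phi>\<^sub>1) (ob \<phi>\<^sub>2)) = Cmp D (inj e (ob \<psi>\<^sub>1) (ob \<psi>\<^sub>2)) n'"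
    if \<phi>: "\<phi> = And \<phi>\<^sub>1 \<phi>\<^sub>2" and \<psi>: "\<psi> = Or \<psi>\<^sub>1 \<psi>\<^sub>2" and R: "tagL d R' = tagR e R''"
      and M': "interp (if d then \<phi>\<^sub>2 else \<phi>\<^sub>1) \<psi> R' m'" and N': "interp \<phi> (if e then \<psi>\<^sub>2 else \<psi>\<^sub>1) R'' n'"
    for \<phi>\<^sub>1 \<phi>\<^sub>2 \<psi>\<^sub>1 \<psi>\<^sub>2 d e R' R'' m' n'
  proof -
    let ?\<phi> = "if d then \<phi>\<^sub>2 else \<phi>\<^sub>1" and ?\<psi> = "if e then \<psi>\<^sub>2 else \<psi>\<^sub>1"
    have a: "atoms \<phi>\<^sub>1 \<subseteq> K" "atoms \<phi>\<^sub>2 \<subseteq> K" "atoms ?\<phi> \<subseteq> K"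
      and b: "atoms \<psi>\<^sub>1 \<subseteq> K" "atoms \<psi>\<^sub>2 \<subseteq> K" "atoms ?\<psi> \<subseteq> K"
      using at by (simp_all add: \<phi> \<psi>)
    define Q where "Q = {(x, y). (x, e # y) \<in> R'}"
    have "(x, y) \<in> R' \<longleftrightarrow> (x, y) \<in> tagR e Q" "(x, y) \<in> R'' \<longleftrightarrow> (x, y) \<in> tagL d Q" for x y
    proof -
      have "(d # x, y) \<in> tagL d R' \<longleftrightarrow> (d # x, y) \<in> tagR e R''"
        "(x, e # y) \<in> tagL d R' \<longleftrightarrow> (x, e # y) \<in> tagR e R''"
        by (simp_all only: R)
      then show "(x, y) \<in> R' \<longleftrightarrow> (x, y) \<in> tagR e Q" "(x, y) \<in> R'' \<longleftrightarrow> (x, y) \<in> tagL d Q"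
        by (auto simp: Q_def)
    qed
    then have R': "R' = tagR e Q" and R'': "R'' = tagL d Q"
      by auto
    \<comment> \<open>The derivation behind \<open>M'\<close> need not end in an injection, so
      \<open>Q\<close> is not read off from its premises. It is derivable because the tag can be
      stripped from the morphism and every morphism has a derivation.\<close>
    have "deriv ?\<phi> ?\<psi> Q"
      using interp_deriv[OF M'] by (simp add: R' deriv_iff \<psi> cw_morphism_inj)
    then obtain q where q: "interp ?\<phi> ?\<psi> Q q"
      using interp_total[OF _ a(3) b(3)] by blast
    have 1: "m' = Cmp D (inj e (ob \<psi>\<^sub>1) (ob \<psi>\<^sub>2)) q"
      by (rule IH[OF _ M' _ a(3) at(2)]) (use interp.inj[OF q] in \<open>simp_all add: \<phi> \<psi> R'\<close>)
    have 2: "n' = Cmp D q (pr d (ob \<phi>\<^sub>1) (ob \<phi>\<^sub>2))"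
      by (rule IH[OF _ N' _ at(1) b(3)]) (use interp.proj[OF q] in \<open>simp_all add: \<phi> \<psi> R''\<close>)
    show ?thesis
      unfolding 1 2 by (rule Cmp_assoc[OF D pr_hom[OF a(1,2)] interp_hom[OF q a(3) b(3)]
            inj_hom[OF b(1,2)]])
  qed
  \<comment> \<open>Needed when both derivations end in a projection, or both in an injection: a
    nonempty relation determines the side.\<close>
  have ne: "R \<noteq> {}"
    using cw_morphism_nonempty[OF deriv_sound[OF interp_deriv[OF M]]] .
  from M show ?case
  proof (cases rule: interp.cases)
    case (atom k)
    from N show ?thesis
      by (cases rule: interp.cases) (use atom in simp_all)
  next
    case (pair \<psi>\<^sub>1 R\<^sub>1 \<psi>\<^sub>2 R\<^sub>2)
    then show ?thesis
      using And by blast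
  next
    case (copair \<phi>\<^sub>1 R\<^sub>1 \<phi>\<^sub>2 R\<^sub>2)
    then show ?thesis
      using Or by blast
  next
    case M: (proj d \<phi>\<^sub>2 \<phi>\<^sub>1 R' m')
    from N show ?thesis
    proof (cases rule: interp.cases)
      case (pair \<psi>\<^sub>1 R\<^sub>1 \<psi>\<^sub>2 R\<^sub>2)
      then show ?thesis
        using And by blast
    next
      case (proj e \<phi>\<^sub>2' \<phi>\<^sub>1' R'' n')
      then have N': "interp (if e then \<phi>\<^sub>2 else \<phi>\<^sub>1) \<psi> R'' n'" and R'': "R = tagL e R''"
        and n': "n = Cmp D n' (pr e (ob \<phi>\<^sub>1) (ob \<phi>\<^sub>2))"
        using M(1) by (cases e; simp)+
      have d: "e = d"
        using tagL_eq_tagL[of e R'' d R'] ne M(2) R'' by simp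
      have "m' = n'"
        by (rule IH[OF _ M(4) _ _ at(2)]) (use N' at(1) M(1,2) R'' d in simp_all)
      then show ?thesis
        by (simp add: M(3) n' d)
    next
      case (inj e \<psi>\<^sub>2 \<psi>\<^sub>1 R'' n')
      then show ?thesis
        using mixed[OF M(1) inj(1) _ M(4) inj(4)] M(2,3) by simp
    qed (use M in simp_all)
  next
    case M: (inj d \<psi>\<^sub>2 \<psi>\<^sub>1 R' m')
    from N show ?thesis
    proof (cases rule: interp.cases)
      case (copair \<phi>\<^sub>1 R\<^sub>1 \<phi>\<^sub>2 R\<^sub>2)
      then show ?thesis
        using Or by blast
    next
      case (inj e \<psi>\<^sub>2' \<psi>\<^sub>1' R'' n')
      then have N': "interp \<phi> (if e then \<psi>\<^sub>2 else \<psi>\<^sub>1) R'' n'" and R'': "R = tagR e R''"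
        and n': "n = Cmp D (inj e (ob \<psi>\<^sub>1) (ob \<psi>\<^sub>2)) n'"
        using M(1) by (cases e; simp)+
      have d: "e = d"
        using tagR_eq_tagR[of e R'' d R'] ne M(2) R'' by simp
      have "m' = n'"
        by (rule IH[OF _ M(4) _ at(1)]) (use N' at(2) M(1,2) R'' d in simp_all)
      then show ?thesis
        by (simp add: M(3) n' d)
    next
      case (proj e \<phi>\<^sub>2 \<phi>\<^sub>1 R'' n')
      then show ?thesis
        using mixed[OF proj(1) M(1) _ proj(4) M(4)] M(2,3) by simp
    qed (use M in simp_all)
  qed
qed

end

section \<open>Extension of functors\<close>

lemma hom_CW_derivE:
  assumes "f \<in> hom (CW K) P Q"
  obtains \<phi> \<psi> R where "P = syntactic \<phi>" "Q = syntactic \<psi>" "f = (syntactic \<phi>, R, syntactic \<psi>)"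
    "atoms \<phi> \<subseteq> K" "atoms \<psi> \<subseteq> K" "deriv \<phi> \<psi> R"
  using assms by (auto simp: hom_CW Obj_CW deriv_iff)

lemma preserves_products_and_sums_CWI:
  assumes F: "is_functor (CW K) D F"
    and "\<And>\<phi> \<psi>. atoms \<phi> \<subseteq> K \<Longrightarrow> atoms \<psi> \<subseteq> K \<Longrightarrow>
      is_product D (FObj F (syntactic \<phi>)) (FObj F (syntactic \<psi>)) (FObj F (syntactic (And \<phi> \<psi>)))
        (FArr F (proj_arrow False \<phi> \<psi>)) (FArr F (proj_arrow True \<phi> \<psi>))"
    and "\<And>\<phi> \<psi>. atoms \<phi> \<subseteq> K \<Longrightarrow> atoms \<psi> \<subseteq> K \<Longrightarrow>
      is_sum D (FObj F (syntactic \<phi>)) (FObj F (syntactic \<psi>)) (FObj F (syntactic (Or \<phi> \<psi>)))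
        (FArr F (inj_arrow False \<phi> \<psi>)) (FArr F (inj_arrow True \<phi> \<psi>))"
  shows "preserves_products_and_sums (CW K) D F"
  unfolding preserves_products_and_sums_def
proof (intro conjI ballI allI impI)
  fix P Q A f g assume "P \<in> Obj (CW K)" "Q \<in> Obj (CW K)"
  then obtain \<phi> \<psi> where P: "P = syntactic \<phi>" "atoms \<phi> \<subseteq> K" and Q: "Q = syntactic \<psi>" "atoms \<psi> \<subseteq> K"
    by (auto simp: Obj_CW)
  show "is_product D (FObj F P) (FObj F Q) (FObj F A) (FArr F f) (FArr F g)"
    if "is_product (CW K) P Q A f g"
    using functor_preserves_product_cones[OF F is_product_CW_syntactic[OF P(2) Q(2)]
        assms(2)[OF P(2) Q(2)]] that by (simp add: P(1) Q(1))
  show "is_sum D (FObj F P) (FObj F Q) (FObj F A) (FArr F f) (FArr F g)"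
    if "is_sum (CW K) P Q A f g"
    using functor_preserves_sum_cones[OF F is_sum_CW_syntactic[OF P(2) Q(2)]
        assms(3)[OF P(2) Q(2)]] that by (simp add: P(1) Q(1))
qed

lemma
  assumes "preserves_products_and_sums (CW K) D F" "atoms \<phi> \<subseteq> K" "atoms \<psi> \<subseteq> K"
  shows preserved_product:
      "is_product D (FObj F (syntactic \<phi>)) (FObj F (syntactic \<psi>)) (FObj F (syntactic (And \<phi> \<psi>)))
        (FArr F (proj_arrow False \<phi> \<psi>)) (FArr F (proj_arrow True \<phi> \<psi>))"
    and preserved_sum:
      "is_sum D (FObj F (syntactic \<phi>)) (FObj F (syntactic \<psi>)) (FObj F (syntactic (Or \<phi> \<psi>)))
        (FArr F (inj_arrow False \<phi> \<psi>)) (FArr F (inj_arrow True \<phi> \<psi>))"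
proof -
  have "syntactic \<phi> \<in> Obj (CW K)" "syntactic \<psi> \<in> Obj (CW K)"
    using assms(2,3) by (auto simp: Obj_CW)
  then show
      "is_product D (FObj F (syntactic \<phi>)) (FObj F (syntactic \<psi>)) (FObj F (syntactic (And \<phi> \<psi>)))
        (FArr F (proj_arrow False \<phi> \<psi>)) (FArr F (proj_arrow True \<phi> \<psi>))"
      "is_sum D (FObj F (syntactic \<phi>)) (FObj F (syntactic \<psi>)) (FObj F (syntactic (Or \<phi> \<psi>)))
        (FArr F (inj_arrow False \<phi> \<psi>)) (FArr F (inj_arrow True \<phi> \<psi>))"
    using assms(1) is_product_CW_syntactic[OF assms(2,3)] is_sum_CW_syntactic[OF assms(2,3)]
    unfolding preserves_products_and_sums_def by blast+
qed

lemma is_functor_generators: "is_functor (discrete K) (CW K) (generators K)"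
proof (rule is_functorI[OF category_discrete category_CW])
  have gen: "generator k \<in> Obj (CW K)" if "k \<in> K" for k
    using that by (auto simp: Obj_CW intro!: exI[of _ "Atom k"] simp: syntactic_Atom)
  fix a assume "a \<in> Obj (discrete K)"
  then show "FObj (generators K) a \<in> Obj (CW K)"
    using gen by (simp add: discrete_def generators_def)
  show "FArr (generators K) (Ide (discrete K) a) = Ide (CW K) (FObj (generators K) a)"
    using \<open>a \<in> Obj (discrete K)\<close> by (simp add: discrete_def generators_def)
next
  fix a b c f g assume f: "f \<in> hom (discrete K) a b"
  then have k: "f \<in> K" "a = f" "b = f"
    by (auto simp: discrete_def hom_iff)
  have gen: "generator f \<in> Obj (CW K)"
    using k by (auto simp: Obj_CW intro!: exI[of _ "Atom f"] simp: syntactic_Atom)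
  show "FArr (generators K) f \<in> hom (CW K) (FObj (generators K) a) (FObj (generators K) b)"
    using Ide_hom[OF category_CW gen] k by (simp add: generators_def)
  assume "g \<in> hom (discrete K) b c"
  then show "FArr (generators K) (Cmp (discrete K) g f) =
      Cmp (CW K) (FArr (generators K) g) (FArr (generators K) f)"
    using k Cmp_Ide_left[OF category_CW Ide_hom[OF category_CW gen]]
    by (simp add: generators_def discrete_def hom_iff)
qed (simp_all add: generators_def discrete_def)

context chosen_products_and_sums
begin

text \<open>The description is meaningful on arrows because each morphism has a derivation, each
  derivation an interpretation, and interpretations of one relation agree.\<close>

definition extension :: "((path, 'k) propn, 'k cw_arrow, 'o, 'm) func" where
  "extension = \<lparr>FObj = (\<lambda>P\<in>Obj (CW K). ob (inv syntactic P)),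
    FArr = (\<lambda>f\<in>Arr (CW K).
      THE m. interp (inv syntactic (fst f)) (inv syntactic (snd (snd f))) (fst (snd f)) m)\<rparr>"

lemma extension_Obj:
  assumes "atoms \<phi> \<subseteq> K"
  shows "FObj extension (syntactic \<phi>) = ob \<phi>"
proof -
  have "syntactic \<phi> \<in> Obj (CW K)"
    using assms by (auto simp: Obj_CW)
  then show ?thesis
    by (simp add: extension_def inv_f_f[OF inj_syntactic])
qed

lemma extension_Arr:
  assumes m: "interp \<phi> \<psi> R m" and at: "atoms \<phi> \<subseteq> K" "atoms \<psi> \<subseteq> K"
  shows "FArr extension (syntactic \<phi>, R, syntactic \<psi>) = m"
proof -
  have "(syntactic \<phi>, R, syntactic \<psi>) \<in> hom (CW K) (syntactic \<phi>) (syntactic \<psi>)"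
    using at deriv_sound[OF interp_deriv[OF m]] by (auto simp: hom_CW Obj_CW)
  then have "FArr extension (syntactic \<phi>, R, syntactic \<psi>) = (THE m. interp \<phi> \<psi> R m)"
    by (simp add: hom_iff extension_def inv_f_f[OF inj_syntactic])
  also have "\<dots> = m"
    using interp_unique[OF _ m at] m by blast
  finally show ?thesis .
qed

lemma is_functor_extension: "is_functor (CW K) D extension"
proof (rule is_functorI[OF category_CW D])
  fix P assume "P \<in> Obj (CW K)"
  then obtain \<phi> where P: "P = syntactic \<phi>" and at: "atoms \<phi> \<subseteq> K"
    by (auto simp: Obj_CW)
  show "FObj extension P \<in> Obj D"
    using at by (simp add: P extension_Obj ob_Obj)
  show "FArr extension (Ide (CW K) P) = Ide D (FObj extension P)"
    using extension_Arr[OF interp_id[OF at] at at] by (simp add: P Ide_CW extension_Obj[OF at])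
next
  fix P Q A f g assume "f \<in> hom (CW K) P Q"
  then obtain \<phi> \<psi> R where f: "P = syntactic \<phi>" "Q = syntactic \<psi>" "f = (syntactic \<phi>, R, syntactic \<psi>)"
    and at: "atoms \<phi> \<subseteq> K" "atoms \<psi> \<subseteq> K" and R: "deriv \<phi> \<psi> R"
    by (rule hom_CW_derivE)
  obtain m where m: "interp \<phi> \<psi> R m"
    using interp_total[OF R at] by blast
  show "FArr extension f \<in> hom D (FObj extension P) (FObj extension Q)"
    using extension_Arr[OF m at] interp_hom[OF m at] at by (simp add: f extension_Obj)
  assume "g \<in> hom (CW K) Q A"
  then obtain \<psi>' \<chi> R' where g': "Q = syntactic \<psi>'" "g = (syntactic \<psi>', R', syntactic \<chi>)"
    and at': "atoms \<chi> \<subseteq> K" and R': "deriv \<psi>' \<chi> R'"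
    by (rule hom_CW_derivE)
  then have g: "g = (syntactic \<psi>, R', syntactic \<chi>)" and R': "deriv \<psi> \<chi> R'"
    using f(2) by simp_all
  obtain n where n: "interp \<psi> \<chi> R' n"
    using interp_total[OF R' at(2) at'] by blast
  show "FArr extension (Cmp (CW K) g f) = Cmp D (FArr extension g) (FArr extension f)"
    using extension_Arr[OF interp_comp[OF m n at at'] at(1) at'] extension_Arr[OF m at]
      extension_Arr[OF n at(2) at'] by (simp add: f(3) g Cmp_CW)
qed (simp_all add: extension_def)

lemma preserves_products_and_sums_extension:
  "preserves_products_and_sums (CW K) D extension"
proof (rule preserves_products_and_sums_CWI[OF is_functor_extension])
  fix \<phi> \<psi> :: "'k form" assume at: "atoms \<phi> \<subseteq> K" "atoms \<psi> \<subseteq> K"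
  have ad: "atoms (if d then \<psi> else \<phi>) \<subseteq> K" for d
    using at by simp
  have And: "atoms (And \<phi> \<psi>) \<subseteq> K" and Or: "atoms (Or \<phi> \<psi>) \<subseteq> K"
    using at by simp_all
  have "FArr extension (proj_arrow d \<phi> \<psi>) = pr d (ob \<phi>) (ob \<psi>)" for d
    unfolding proj_arrow_def using extension_Arr[OF interp_pr[OF ad at] And ad] .
  then show "is_product D (FObj extension (syntactic \<phi>)) (FObj extension (syntactic \<psi>))
      (FObj extension (syntactic (And \<phi> \<psi>)))
      (FArr extension (proj_arrow False \<phi> \<psi>)) (FArr extension (proj_arrow True \<phi> \<psi>))"
    using product_ob[OF at] by (simp only: extension_Obj at And)
  have "FArr extension (inj_arrow d \<phi> \<psi>) = inj d (ob \<phi>) (ob \<psi>)" for d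
    unfolding inj_arrow_def using extension_Arr[OF interp_in[OF ad at] ad Or] .
  then show "is_sum D (FObj extension (syntactic \<phi>)) (FObj extension (syntactic \<psi>))
      (FObj extension (syntactic (Or \<phi> \<psi>)))
      (FArr extension (inj_arrow False \<phi> \<psi>)) (FArr extension (inj_arrow True \<phi> \<psi>))"
    using sum_ob[OF at] by (simp only: extension_Obj at Or)
qed

lemma extension_generator: "k \<in> K \<Longrightarrow> FObj extension (generator k) = H k"
  using extension_Obj[of "Atom k"] by (simp add: syntactic_Atom)

end

text \<open>The restriction of the extension equals \<open>G\<close> itself, since \<open>ob\<close>
  sends an atom to its given object and all arrows of the discrete category are identities.\<close>

lemma ex_extension:
  assumes D: "category_with_products_and_sums D" and G: "is_functor (discrete K) D G"
  shows "\<exists>F. is_functor (CW K) D F \<and> preserves_products_and_sums (CW K) D F \<and>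
    comp_functor (discrete K) F (generators K) = G"
proof -
  \<comment> \<open>A cone is packed into one triple of apex and two legs, so that one application
    of choice per connective fixes all cones.\<close>
  have "\<forall>a b. \<exists>t. a \<in> Obj D \<longrightarrow> b \<in> Obj D \<longrightarrow> is_product D a b (fst t) (fst (snd t)) (snd (snd t))"
    "\<forall>a b. \<exists>t. a \<in> Obj D \<longrightarrow> b \<in> Obj D \<longrightarrow> is_sum D a b (fst t) (fst (snd t)) (snd (snd t))"
    using D unfolding category_with_products_and_sums_def by (metis fst_conv snd_conv)+
  then obtain p s where
    p: "\<And>a b. a \<in> Obj D \<Longrightarrow> b \<in> Obj D \<Longrightarrow>
      is_product D a b (fst (p a b)) (fst (snd (p a b))) (snd (snd (p a b)))" and
    s: "\<And>a b. a \<in> Obj D \<Longrightarrow> b \<in> Obj D \<Longrightarrow>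
      is_sum D a b (fst (s a b)) (fst (snd (s a b))) (snd (snd (s a b)))"
    by metis
  interpret chosen_products_and_sums D K "FObj G" "\<lambda>a b. fst (p a b)"
    "\<lambda>d a b. (if d then snd else fst) (snd (p a b))" "\<lambda>a b. fst (s a b)"
    "\<lambda>d a b. (if d then snd else fst) (snd (s a b))"
  proof
    show "category D"
      using D by (simp add: category_with_products_and_sums_def)
    show "FObj G k \<in> Obj D" if "k \<in> K" for k
      using functor_Obj[OF G] that by (simp add: discrete_def)
  qed (use p s in simp_all)
  have "comp_functor (discrete K) extension (generators K) = G"
  proof (rule functor_eqI[where C = "discrete K"])
    fix k assume "k \<in> Obj (discrete K)"
    then show "FObj (comp_functor (discrete K) extension (generators K)) k = FObj G k"
      using extension_generator by (simp add: comp_functor_def discrete_def generators_def)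
  next
    fix k assume "k \<in> Arr (discrete K)"
    then have k: "k \<in> K" "k \<in> Obj (discrete K)"
      by (simp_all add: discrete_def)
    have "FArr extension (Ide (CW K) (generator k)) = Ide D (FObj G k)"
      using functor_Ide[OF is_functor_extension] functor_Obj[OF is_functor_generators k(2)] k(1)
        extension_generator by (simp add: generators_def)
    moreover have "FArr G k = Ide D (FObj G k)"
      using functor_Ide[OF G k(2)] by (simp add: discrete_def)
    ultimately show "FArr (comp_functor (discrete K) extension (generators K)) k = FArr G k"
      using k by (simp add: comp_functor_def discrete_def generators_def)
  qed (simp_all add: comp_functor_def functor_extensional[OF G])
  then show ?thesis
    using is_functor_extension preserves_products_and_sums_extension by blast
qed

section \<open>Extension of natural transformations\<close>

locale preserving_functors =
  fixes K :: "'k set" and D :: "('o, 'm) cat" and F G :: "((path, 'k) propn, 'k cw_arrow, 'o, 'm) func"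
  assumes F: "is_functor (CW K) D F" and G: "is_functor (CW K) D G"
    and pF: "preserves_products_and_sums (CW K) D F"
    and pG: "preserves_products_and_sums (CW K) D G"
begin

lemma D: "category D"
  using F by (rule functor_category_cod)

abbreviation FO :: "'k form \<Rightarrow> 'o" where "FO \<phi> \<equiv> FObj F (syntactic \<phi>)"
abbreviation GO :: "'k form \<Rightarrow> 'o" where "GO \<phi> \<equiv> FObj G (syntactic \<phi>)"

text \<open>At a conjunction, naturality at the projections determines the component, because
  \<open>G\<close> sends them to a product cone; at a disjunction, naturality at the injections
  does, because \<open>F\<close> sends them to a sum cone.\<close>

lemma nat_trans_unique:
  assumes \<eta>: "nat_trans (CW K) D F G \<eta>" and \<theta>: "nat_trans (CW K) D F G \<theta>"
    and eq: "\<And>k. k \<in> K \<Longrightarrow> \<eta> (generator k) = \<theta> (generator k)"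
  shows "\<eta> = \<theta>"
proof (rule extensionalityI[OF nat_transD(3)[OF \<eta>] nat_transD(3)[OF \<theta>]])
  have hom: "\<eta> (syntactic \<phi>) \<in> hom D (FO \<phi>) (GO \<phi>)" "\<theta> (syntactic \<phi>) \<in> hom D (FO \<phi>) (GO \<phi>)"
    if "atoms \<phi> \<subseteq> K" for \<phi>
    using nat_transD(4)[OF \<eta>] nat_transD(4)[OF \<theta>] that by (auto simp: Obj_CW)
  have "\<eta> (syntactic \<phi>) = \<theta> (syntactic \<phi>)" if "atoms \<phi> \<subseteq> K" for \<phi>
    using that
  proof (induction \<phi>)
    case (Atom k)
    then show ?case
      using eq by (simp add: syntactic_Atom)
  next
    case (And \<phi> \<psi>)
    have at: "atoms \<phi> \<subseteq> K" "atoms \<psi> \<subseteq> K"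
      using And.prems by simp_all
    show ?case
      by (rule product_ext[OF D preserved_product[OF pG at] hom[OF And.prems]])
        (use nat_transD(5)[OF \<eta> proj_arrow_hom[OF at, of False]]
          nat_transD(5)[OF \<theta> proj_arrow_hom[OF at, of False]]
          nat_transD(5)[OF \<eta> proj_arrow_hom[OF at, of True]]
          nat_transD(5)[OF \<theta> proj_arrow_hom[OF at, of True]] And.IH at in simp_all)
  next
    case (Or \<phi> \<psi>)
    have at: "atoms \<phi> \<subseteq> K" "atoms \<psi> \<subseteq> K"
      using Or.prems by simp_all
    show ?case
      by (rule sum_ext[OF D preserved_sum[OF pF at] hom[OF Or.prems]])
        (use nat_transD(5)[OF \<eta> inj_arrow_hom[OF at, of False]]
          nat_transD(5)[OF \<theta> inj_arrow_hom[OF at, of False]]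
          nat_transD(5)[OF \<eta> inj_arrow_hom[OF at, of True]]
          nat_transD(5)[OF \<theta> inj_arrow_hom[OF at, of True]] Or.IH at in simp_all)
  qed
  then show "\<eta> P = \<theta> P" if "P \<in> Obj (CW K)" for P
    using that by (auto simp: Obj_CW)
qed

end

locale generator_components = preserving_functors K D F G
  for K :: "'k set" and D :: "('o, 'm) cat" and F G :: "((path, 'k) propn, 'k cw_arrow, 'o, 'm) func" +
  fixes \<theta> :: "'k \<Rightarrow> 'm"
  assumes \<theta>: "\<And>k. k \<in> K \<Longrightarrow> \<theta> k \<in> hom D (FObj F (generator k)) (FObj G (generator k))"
begin

text \<open>The only candidate: at a compound formula the component is the mediating arrow for which
  the squares at the projections, or at the injections, commute.\<close>

primrec component :: "'k form \<Rightarrow> 'm" where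
  "component (Atom k) = \<theta> k"
| "component (And \<phi> \<psi>) = (THE m. m \<in> hom D (FO (And \<phi> \<psi>)) (GO (And \<phi> \<psi>)) \<and>
    Cmp D (FArr G (proj_arrow False \<phi> \<psi>)) m = Cmp D (component \<phi>) (FArr F (proj_arrow False \<phi> \<psi>)) \<and>
    Cmp D (FArr G (proj_arrow True \<phi> \<psi>)) m = Cmp D (component \<psi>) (FArr F (proj_arrow True \<phi> \<psi>)))"
| "component (Or \<phi> \<psi>) = (THE m. m \<in> hom D (FO (Or \<phi> \<psi>)) (GO (Or \<phi> \<psi>)) \<and>
    Cmp D m (FArr F (inj_arrow False \<phi> \<psi>)) = Cmp D (FArr G (inj_arrow False \<phi> \<psi>)) (component \<phi>) \<and>
    Cmp D m (FArr F (inj_arrow True \<phi> \<psi>)) = Cmp D (FArr G (inj_arrow True \<phi> \<psi>)) (component \<psi>))"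

definition square :: "'k form \<Rightarrow> 'k form \<Rightarrow> 'k cw_arrow \<Rightarrow> bool" where
  "square \<phi> \<psi> f \<longleftrightarrow> Cmp D (component \<psi>) (FArr F f) = Cmp D (FArr G f) (component \<phi>)"

text \<open>Typing and the two squares are obtained together, since all three come from the same
  unique description, whose existence depends on the typing of the components of the
  conjuncts.\<close>

lemma component_And:
  assumes at: "atoms \<phi> \<subseteq> K" "atoms \<psi> \<subseteq> K"
    and hom: "component \<phi> \<in> hom D (FO \<phi>) (GO \<phi>)" "component \<psi> \<in> hom D (FO \<psi>) (GO \<psi>)"
  shows "component (And \<phi> \<psi>) \<in> hom D (FO (And \<phi> \<psi>)) (GO (And \<phi> \<psi>)) \<and>
    square (And \<phi> \<psi>) \<phi> (proj_arrow False \<phi> \<psi>) \<and> square (And \<phi> \<psi>) \<psi> (proj_arrow True \<phi> \<psi>)"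
proof -
  note FP = is_productD[OF preserved_product[OF pF at]]
  note f = Cmp_hom[OF D FP(2) hom(1)] and g = Cmp_hom[OF D FP(3) hom(2)]
  have "\<exists>!m. m \<in> hom D (FO (And \<phi> \<psi>)) (GO (And \<phi> \<psi>)) \<and>
    Cmp D (FArr G (proj_arrow False \<phi> \<psi>)) m = Cmp D (component \<phi>) (FArr F (proj_arrow False \<phi> \<psi>)) \<and>
    Cmp D (FArr G (proj_arrow True \<phi> \<psi>)) m = Cmp D (component \<psi>) (FArr F (proj_arrow True \<phi> \<psi>))"
    using preserved_product[OF pG at] FP(1) f g unfolding is_product_def by blast
  from theI'[OF this] show ?thesis
    unfolding square_def component.simps by simp
qed

lemma component_Or:
  assumes at: "atoms \<phi> \<subseteq> K" "atoms \<psi> \<subseteq> K"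
    and hom: "component \<phi> \<in> hom D (FO \<phi>) (GO \<phi>)" "component \<psi> \<in> hom D (FO \<psi>) (GO \<psi>)"
  shows "component (Or \<phi> \<psi>) \<in> hom D (FO (Or \<phi> \<psi>)) (GO (Or \<phi> \<psi>)) \<and>
    square \<phi> (Or \<phi> \<psi>) (inj_arrow False \<phi> \<psi>) \<and> square \<psi> (Or \<phi> \<psi>) (inj_arrow True \<phi> \<psi>)"
proof -
  note GS = is_sumD[OF preserved_sum[OF pG at]]
  note f = Cmp_hom[OF D hom(1) GS(2)] and g = Cmp_hom[OF D hom(2) GS(3)]
  have "\<exists>!m. m \<in> hom D (FO (Or \<phi> \<psi>)) (GO (Or \<phi> \<psi>)) \<and>
    Cmp D m (FArr F (inj_arrow False \<phi> \<psi>)) = Cmp D (FArr G (inj_arrow False \<phi> \<psi>)) (component \<phi>) \<and>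
    Cmp D m (FArr F (inj_arrow True \<phi> \<psi>)) = Cmp D (FArr G (inj_arrow True \<phi> \<psi>)) (component \<psi>)"
    using preserved_sum[OF pF at] GS(1) f g unfolding is_sum_def by blast
  from theI'[OF this] show ?thesis
    unfolding square_def component.simps by simp
qed

lemma component_hom: "atoms \<phi> \<subseteq> K \<Longrightarrow> component \<phi> \<in> hom D (FO \<phi>) (GO \<phi>)"
proof (induction \<phi>)
  case (Atom k)
  then show ?case
    using \<theta> by (simp add: syntactic_Atom)
next
  case (And \<phi> \<psi>)
  then have "atoms \<phi> \<subseteq> K" "atoms \<psi> \<subseteq> K"
    by simp_all
  then show ?case
    using component_And And.IH by blast
next
  case (Or \<phi> \<psi>)
  then have "atoms \<phi> \<subseteq> K" "atoms \<psi> \<subseteq> K"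
    by simp_all
  then show ?case
    using component_Or Or.IH by blast
qed

lemma square_proj:
  assumes at: "atoms \<phi> \<subseteq> K" "atoms \<psi> \<subseteq> K"
  shows "square (And \<phi> \<psi>) (if d then \<psi> else \<phi>) (proj_arrow d \<phi> \<psi>)"
  using component_And[OF at component_hom[OF at(1)] component_hom[OF at(2)]] by (cases d) simp_all

lemma square_inj:
  assumes at: "atoms \<phi> \<subseteq> K" "atoms \<psi> \<subseteq> K"
  shows "square (if d then \<psi> else \<phi>) (Or \<phi> \<psi>) (inj_arrow d \<phi> \<psi>)"
  using component_Or[OF at component_hom[OF at(1)] component_hom[OF at(2)]] by (cases d) simp_all

section \<open>Pasting and cancelling naturality squares\<close>

context
  fixes \<phi> \<psi> \<chi> :: "'k form" and f g :: "'k cw_arrow"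
  assumes at: "atoms \<phi> \<subseteq> K" "atoms \<psi> \<subseteq> K" "atoms \<chi> \<subseteq> K"
    and f: "f \<in> hom (CW K) (syntactic \<phi>) (syntactic \<psi>)"
    and g: "g \<in> hom (CW K) (syntactic \<psi>) (syntactic \<chi>)"
begin

lemma squares_assoc:
  "Cmp D (component \<chi>) (FArr F (Cmp (CW K) g f)) = Cmp D (Cmp D (component \<chi>) (FArr F g)) (FArr F f)"
  "Cmp D (FArr G (Cmp (CW K) g f)) (component \<phi>) = Cmp D (FArr G g) (Cmp D (FArr G f) (component \<phi>))"
  "Cmp D (Cmp D (FArr G g) (component \<psi>)) (FArr F f) = Cmp D (FArr G g) (Cmp D (component \<psi>) (FArr F f))"
  using functor_Cmp[OF F f g] functor_Cmp[OF G f g]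
    Cmp_assoc[OF D functor_hom[OF F f] functor_hom[OF F g] component_hom[OF at(3)]]
    Cmp_assoc[OF D component_hom[OF at(1)] functor_hom[OF G f] functor_hom[OF G g]]
    Cmp_assoc[OF D functor_hom[OF F f] component_hom[OF at(2)] functor_hom[OF G g]]
  by simp_all

lemma square_Cmp:
  assumes "square \<phi> \<psi> f" "square \<psi> \<chi> g"
  shows "square \<phi> \<chi> (Cmp (CW K) g f)"
  using assms squares_assoc by (simp add: square_def)

text \<open>From the outer rectangle and its second square the first square follows only after
  composing with \<open>FArr G g\<close>. A single projection cannot be cancelled; the two
  projections together can.\<close>

lemma square_cancel_left:
  assumes "square \<psi> \<chi> g" "square \<phi> \<chi> (Cmp (CW K) g f)"
  shows "Cmp D (FArr G g) (Cmp D (component \<psi>) (FArr F f)) =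
    Cmp D (FArr G g) (Cmp D (FArr G f) (component \<phi>))"
  using assms squares_assoc by (simp add: square_def)

lemma square_cancel_right:
  assumes "square \<phi> \<psi> f" "square \<phi> \<chi> (Cmp (CW K) g f)"
  shows "Cmp D (Cmp D (component \<chi>) (FArr F g)) (FArr F f) =
    Cmp D (Cmp D (FArr G g) (component \<psi>)) (FArr F f)"
  using assms squares_assoc by (simp add: square_def)

end

text \<open>Naturality is checked along derivations, which reach every arrow of \<open>CW K\<close>.
  Projection and injection rules paste a generating square to a smaller one; for pairing and
  copairing the square is tested against both legs of a product cone of \<open>G\<close> or a sum
  cone of \<open>F\<close>.\<close>

lemma square_deriv:
  "deriv \<phi> \<psi> R \<Longrightarrow> atoms \<phi> \<subseteq> K \<Longrightarrow> atoms \<psi> \<subseteq> K \<Longrightarrow> square \<phi> \<psi> (syntactic \<phi>, R, syntactic \<psi>)"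
proof (induction rule: deriv.induct)
  case (atom k)
  have k: "syntactic (Atom k) \<in> Obj (CW K)"
    using atom by (auto simp: Obj_CW intro!: exI[of _ "Atom k"])
  have "(syntactic (Atom k), {([], [])}, syntactic (Atom k)) = Ide (CW K) (syntactic (Atom k))"
    by (auto simp: Ide_CW syntactic_Atom generator_def)
  then show ?case
    using functor_Ide[OF F k] functor_Ide[OF G k] Cmp_Ide_left[OF D component_hom[OF atom(1)]]
      Cmp_Ide_right[OF D component_hom[OF atom(1)]]
    by (simp only: square_def)
next
  case (pair \<chi> \<phi> R\<^sub>1 \<psi> R\<^sub>2)
  have at: "atoms \<phi> \<subseteq> K" "atoms \<psi> \<subseteq> K"
    using pair.prems by simp_all
  have ad: "atoms (if d then \<psi> else \<phi>) \<subseteq> K" for d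
    using at by simp
  let ?f = "(syntactic \<chi>, tagR False R\<^sub>1 \<union> tagR True R\<^sub>2, syntactic (And \<phi> \<psi>))"
  have f: "?f \<in> hom (CW K) (syntactic \<chi>) (syntactic (And \<phi> \<psi>))"
    using deriv_sound[OF deriv.pair[OF pair.hyps]] pair.prems by (auto simp: hom_CW_syntactic)
  have "Cmp (CW K) (proj_arrow d \<phi> \<psi>) ?f =
      (syntactic \<chi>, if d then R\<^sub>2 else R\<^sub>1, syntactic (if d then \<psi> else \<phi>))" for d
    using pair_relcomp_proj[OF cw_morphism_subset[OF deriv_sound[OF pair.hyps(1)]]
        cw_morphism_subset[OF deriv_sound[OF pair.hyps(2)]]]
    by (simp add: proj_arrow_def Cmp_CW)
  then have sq: "square \<chi> (if d then \<psi> else \<phi>) (Cmp (CW K) (proj_arrow d \<phi> \<psi>) ?f)" for d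
    using pair.IH pair.prems(1) at by (cases d) simp_all
  have eq: "Cmp D (FArr G (proj_arrow d \<phi> \<psi>)) (Cmp D (component (And \<phi> \<psi>)) (FArr F ?f)) =
      Cmp D (FArr G (proj_arrow d \<phi> \<psi>)) (Cmp D (FArr G ?f) (component \<chi>))" for d
    by (rule square_cancel_left[OF pair.prems ad f proj_arrow_hom[OF at] square_proj[OF at] sq])
  show ?case
    unfolding square_def
    by (rule product_ext[OF D preserved_product[OF pG at]
          Cmp_hom[OF D functor_hom[OF F f] component_hom[OF pair.prems(2)]]
          Cmp_hom[OF D component_hom[OF pair.prems(1)] functor_hom[OF G f]] eq eq])
next
  case (copair \<phi> \<chi> R\<^sub>1 \<psi> R\<^sub>2)
  have at: "atoms \<phi> \<subseteq> K" "atoms \<psi> \<subseteq> K"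
    using copair.prems by simp_all
  have ad: "atoms (if d then \<psi> else \<phi>) \<subseteq> K" for d
    using at by simp
  let ?f = "(syntactic (Or \<phi> \<psi>), tagL False R\<^sub>1 \<union> tagL True R\<^sub>2, syntactic \<chi>)"
  have f: "?f \<in> hom (CW K) (syntactic (Or \<phi> \<psi>)) (syntactic \<chi>)"
    using deriv_sound[OF deriv.copair[OF copair.hyps]] copair.prems by (auto simp: hom_CW_syntactic)
  have "Cmp (CW K) ?f (inj_arrow d \<phi> \<psi>) =
      (syntactic (if d then \<psi> else \<phi>), if d then R\<^sub>2 else R\<^sub>1, syntactic \<chi>)" for d
    using inj_relcomp_copair[OF cw_morphism_subset[OF deriv_sound[OF copair.hyps(1)]]
        cw_morphism_subset[OF deriv_sound[OF copair.hyps(2)]]]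
    by (simp add: inj_arrow_def Cmp_CW)
  then have sq: "square (if d then \<psi> else \<phi>) \<chi> (Cmp (CW K) ?f (inj_arrow d \<phi> \<psi>))" for d
    using copair.IH copair.prems(2) at by (cases d) simp_all
  have eq: "Cmp D (Cmp D (component \<chi>) (FArr F ?f)) (FArr F (inj_arrow d \<phi> \<psi>)) =
      Cmp D (Cmp D (FArr G ?f) (component (Or \<phi> \<psi>))) (FArr F (inj_arrow d \<phi> \<psi>))" for d
    by (rule square_cancel_right[OF ad copair.prems inj_arrow_hom[OF at] f square_inj[OF at] sq])
  show ?case
    unfolding square_def
    by (rule sum_ext[OF D preserved_sum[OF pF at]
          Cmp_hom[OF D functor_hom[OF F f] component_hom[OF copair.prems(2)]]
          Cmp_hom[OF D component_hom[OF copair.prems(1)] functor_hom[OF G f]] eq eq])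
next
  case (proj d \<psi> \<phi> \<chi> R)
  have at: "atoms \<phi> \<subseteq> K" "atoms \<psi> \<subseteq> K" and ad: "atoms (if d then \<psi> else \<phi>) \<subseteq> K"
    using proj.prems by simp_all
  let ?f = "(syntactic (if d then \<psi> else \<phi>), R, syntactic \<chi>)"
  note R = deriv_sound[OF proj.hyps]
  have f: "?f \<in> hom (CW K) (syntactic (if d then \<psi> else \<phi>)) (syntactic \<chi>)"
    unfolding hom_CW_syntactic[OF ad proj.prems(2)] using R by blast
  have "Cmp (CW K) ?f (proj_arrow d \<phi> \<psi>) = (syntactic (And \<phi> \<psi>), tagL d R, syntactic \<chi>)"
    by (simp only: proj_arrow_def Cmp_CW tag_relcomp relcomp_Id_on[OF cw_morphism_subset[OF R]])
  then show ?case
    using square_Cmp[OF proj.prems(1) ad proj.prems(2) proj_arrow_hom[OF at] f square_proj[OF at]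
        proj.IH[OF ad proj.prems(2)]] by metis
next
  case (inj \<chi> d \<psi> \<phi> R)
  have at: "atoms \<phi> \<subseteq> K" "atoms \<psi> \<subseteq> K" and ad: "atoms (if d then \<psi> else \<phi>) \<subseteq> K"
    using inj.prems by simp_all
  let ?f = "(syntactic \<chi>, R, syntactic (if d then \<psi> else \<phi>))"
  note R = deriv_sound[OF inj.hyps]
  have f: "?f \<in> hom (CW K) (syntactic \<chi>) (syntactic (if d then \<psi> else \<phi>))"
    unfolding hom_CW_syntactic[OF inj.prems(1) ad] using R by blast
  have "Cmp (CW K) (inj_arrow d \<phi> \<psi>) ?f = (syntactic \<chi>, tagR d R, syntactic (Or \<phi> \<psi>))"
    by (simp only: inj_arrow_def Cmp_CW tag_relcomp relcomp_Id_on[OF cw_morphism_subset[OF R]])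
  then show ?case
    using square_Cmp[OF inj.prems(1) ad inj.prems(2) f inj_arrow_hom[OF at]
        inj.IH[OF inj.prems(1) ad] square_inj[OF at]] by metis
qed

lemma ex_nat_trans:
  "\<exists>\<eta>. nat_trans (CW K) D F G \<eta> \<and> (\<forall>k\<in>K. \<eta> (generator k) = \<theta> k)"
proof -
  define \<eta> where "\<eta> = (\<lambda>P\<in>Obj (CW K). component (inv syntactic P))"
  have \<eta>: "\<eta> (syntactic \<phi>) = component \<phi>" if "atoms \<phi> \<subseteq> K" for \<phi>
  proof -
    have "syntactic \<phi> \<in> Obj (CW K)"
      using that by (auto simp: Obj_CW)
    then show ?thesis
      by (simp add: \<eta>_def inv_f_f[OF inj_syntactic])
  qed
  have "nat_trans (CW K) D F G \<eta>"
  proof (rule nat_transI[OF F G])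
    show "\<eta> \<in> extensional (Obj (CW K))"
      by (simp add: \<eta>_def)
    show "\<eta> P \<in> hom D (FObj F P) (FObj G P)" if "P \<in> Obj (CW K)" for P
      using that component_hom by (auto simp: Obj_CW \<eta>)
    fix P Q f assume "f \<in> hom (CW K) P Q"
    then obtain \<phi> \<psi> R where f: "P = syntactic \<phi>" "Q = syntactic \<psi>" "f = (syntactic \<phi>, R, syntactic \<psi>)"
      and at: "atoms \<phi> \<subseteq> K" "atoms \<psi> \<subseteq> K" and R: "deriv \<phi> \<psi> R"
      by (rule hom_CW_derivE)
    show "Cmp D (\<eta> Q) (FArr F f) = Cmp D (FArr G f) (\<eta> P)"
      using square_deriv[OF R at] by (simp add: f \<eta> at square_def)
  qed
  moreover have "\<eta> (generator k) = \<theta> k" if "k \<in> K" for k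
    using \<eta>[of "Atom k"] that by (simp add: syntactic_Atom)
  ultimately show ?thesis
    by blast
qed

end

section \<open>Freeness\<close>

lemma hom_preserving_functor_category:
  "t \<in> hom (preserving_functor_category C D) F G \<longleftrightarrow>
    (\<exists>\<eta>. t = (F, \<eta>, G) \<and> nat_trans C D F G \<eta>) \<and>
    preserves_products_and_sums C D F \<and> preserves_products_and_sums C D G"
  by (simp add: preserving_functor_category_def full_subcategory_simps hom_functor_category)

lemma Obj_preserving_functor_category:
  "F \<in> Obj (preserving_functor_category C D) \<longleftrightarrow>
    is_functor C D F \<and> preserves_products_and_sums C D F"
  by (simp add: preserving_functor_category_def full_subcategory_simps functor_category_def)

lemma nat_trans_restriction:
  assumes J: "is_functor A C J" and \<eta>: "nat_trans C D F G \<eta>"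
  shows "nat_trans A D (comp_functor A F J) (comp_functor A G J) (\<lambda>a\<in>Obj A. \<eta> (FObj J a))"
proof (rule nat_transI)
  note A = functor_category_dom[OF J]
  show "is_functor A D (comp_functor A F J)" "is_functor A D (comp_functor A G J)"
    using is_functor_comp[OF J] nat_transD(1,2)[OF \<eta>] by blast+
  show "(\<lambda>a\<in>Obj A. \<eta> (FObj J a)) a
      \<in> hom D (FObj (comp_functor A F J) a) (FObj (comp_functor A G J) a)" if "a \<in> Obj A" for a
    using that nat_transD(4)[OF \<eta> functor_Obj[OF J that]] by (simp add: comp_functor_def)
  fix a b f assume f: "f \<in> hom A a b"
  show "Cmp D ((\<lambda>a\<in>Obj A. \<eta> (FObj J a)) b) (FArr (comp_functor A F J) f) =
      Cmp D (FArr (comp_functor A G J) f) ((\<lambda>a\<in>Obj A. \<eta> (FObj J a)) a)"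
    using f hom_Obj[OF A f] nat_transD(5)[OF \<eta> functor_hom[OF J f]]
    by (simp add: comp_functor_def hom_iff)
qed simp

lemma is_functor_restriction:
  fixes J :: "('k, 'l, 'o1, 'm1) func" and D :: "('o2, 'm2) cat"
  assumes J: "is_functor A C J"
  shows "is_functor (preserving_functor_category C D) (functor_category A D)
    (restriction_functor A C D J)" (is "is_functor ?P ?E ?r")
proof (rule is_functorI)
  show P: "category ?P"
    unfolding preserving_functor_category_def
    by (intro category_full_subcategory category_functor_category)
  show "category ?E"
    by (rule category_functor_category)
  have r: "FArr ?r (F, \<eta>, G) = (comp_functor A F J, \<lambda>a\<in>Obj A. \<eta> (FObj J a), comp_functor A G J)"
    if "(F, \<eta>, G) \<in> hom ?P F G" for F \<eta> G
    using that by (simp add: restriction_functor_def hom_iff)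
  fix F assume F: "F \<in> Obj ?P"
  show "FObj ?r F \<in> Obj ?E"
    using F is_functor_comp[OF J, of D F]
    by (simp add: restriction_functor_def functor_category_def Obj_preserving_functor_category)
  have "Ide ?P F = (F, \<lambda>a\<in>Obj C. Ide D (FObj F a), F)"
    by (simp add: preserving_functor_category_def full_subcategory_simps functor_category_def)
  then show "FArr ?r (Ide ?P F) = Ide ?E (FObj ?r F)"
    using r[of F _ F] Ide_hom[OF P F] F functor_Obj[OF J]
    by (auto simp: functor_category_def restriction_functor_def comp_functor_def)
next
  fix F G t assume t: "t \<in> hom ?P F G"
  then obtain \<eta> where \<eta>: "t = (F, \<eta>, G)" "nat_trans C D F G \<eta>"
    and p: "preserves_products_and_sums C D F" "preserves_products_and_sums C D G"
    by (auto simp: hom_preserving_functor_category)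
  note FG = nat_transD(1,2)[OF \<eta>(2)]
  have rO: "FObj ?r F = comp_functor A F J" "FObj ?r G = comp_functor A G J"
    using FG p by (simp_all add: restriction_functor_def Obj_preserving_functor_category)
  have rt: "FArr ?r t = (comp_functor A F J, \<lambda>a\<in>Obj A. \<eta> (FObj J a), comp_functor A G J)"
    using t by (simp add: restriction_functor_def hom_iff \<eta>)
  show "FArr ?r t \<in> hom ?E (FObj ?r F) (FObj ?r G)"
    unfolding hom_functor_category rO rt using nat_trans_restriction[OF J \<eta>(2)] by blast
  fix H s assume s: "s \<in> hom ?P G H"
  then obtain \<theta> where \<theta>: "s = (G, \<theta>, H)" "nat_trans C D G H \<theta>"
    and pH: "preserves_products_and_sums C D H"
    by (auto simp: hom_preserving_functor_category)
  have rs: "FArr ?r s = (comp_functor A G J, \<lambda>a\<in>Obj A. \<theta> (FObj J a), comp_functor A H J)"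
    using s by (simp add: restriction_functor_def hom_iff \<theta>)
  have st: "Cmp ?P s t = (F, \<lambda>a\<in>Obj C. Cmp D (\<theta> a) (\<eta> a), H)"
    by (simp add: \<eta>(1) \<theta>(1) preserving_functor_category_def full_subcategory_simps
        functor_category_def)
  have "(F, \<lambda>a\<in>Obj C. Cmp D (\<theta> a) (\<eta> a), H) \<in> hom ?P F H"
    unfolding hom_preserving_functor_category using nat_trans_Cmp[OF \<eta>(2) \<theta>(2)] p pH by simp
  then have "FArr ?r (Cmp ?P s t) =
      (comp_functor A F J, \<lambda>a\<in>Obj A. (\<lambda>a\<in>Obj C. Cmp D (\<theta> a) (\<eta> a)) (FObj J a), comp_functor A H J)"
    by (simp add: st restriction_functor_def hom_iff)
  then show "FArr ?r (Cmp ?P s t) = Cmp ?E (FArr ?r s) (FArr ?r t)"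
    using functor_Obj[OF J] by (auto simp: rs rt functor_category_def)
qed (simp_all add: restriction_functor_def)

text \<open>Surjectivity on objects is the extension of functors; fullness is the extension of
  families indexed by the generators, and faithfulness is the uniqueness of that extension.\<close>

lemma is_equivalence_restriction:
  fixes K :: "'k set" and D :: "('o, 'm) cat"
  assumes D: "category_with_products_and_sums D"
  shows "is_equivalence (preserving_functor_category (CW K) D) (functor_category (discrete K) D)
    (restriction_functor (discrete K) (CW K) D (generators K))" (is "is_equivalence ?P ?E ?r")
proof (rule is_equivalenceI[OF is_functor_restriction[OF is_functor_generators]])
  have rO: "FObj ?r F = comp_functor (discrete K) F (generators K)" if "F \<in> Obj ?P" for F
    using that by (simp add: restriction_functor_def)
  show "\<exists>F\<in>Obj ?P. FObj ?r F = H" if H: "H \<in> Obj ?E" for H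
  proof -
    have "is_functor (discrete K) D H"
      using H by (simp add: functor_category_def)
    from ex_extension[OF D this] show ?thesis
      using rO by (auto simp: Obj_preserving_functor_category)
  qed
  fix F G t assume objF: "F \<in> Obj ?P" and objG: "G \<in> Obj ?P"
    and t: "t \<in> hom ?E (FObj ?r F) (FObj ?r G)"
  obtain \<theta> where t_eq: "t = (FObj ?r F, \<theta>, FObj ?r G)"
    and nat: "nat_trans (discrete K) D (FObj ?r F) (FObj ?r G) \<theta>"
    using t by (auto simp: hom_functor_category)
  interpret generator_components K D F G \<theta>
  proof
    fix k assume "k \<in> K"
    then show "\<theta> k \<in> hom D (FObj F (generator k)) (FObj G (generator k))"
      using nat_transD(4)[OF nat[unfolded rO[OF objF] rO[OF objG]], of k]
      by (simp add: comp_functor_def discrete_def generators_def)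
  qed (use objF objG in \<open>simp_all add: Obj_preserving_functor_category\<close>)
  \<comment> \<open>Source and target of the restricted arrow agree with those of \<open>t\<close>
    already, so being a lift of \<open>t\<close> means agreeing with \<theta> on the
    generators.\<close>
  have lift: "s \<in> hom ?P F G \<and> FArr ?r s = t \<longleftrightarrow>
      (\<exists>\<eta>. s = (F, \<eta>, G) \<and> nat_trans (CW K) D F G \<eta> \<and> (\<forall>k\<in>K. \<eta> (generator k) = \<theta> k))" for s
  proof -
    have "FArr ?r (F, \<eta>, G) = t \<longleftrightarrow> (\<forall>k\<in>K. \<eta> (generator k) = \<theta> k)"
      if \<eta>: "nat_trans (CW K) D F G \<eta>" for \<eta>
    proof -
      have "(F, \<eta>, G) \<in> hom ?P F G"
        unfolding hom_preserving_functor_category using \<eta> pF pG by blast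
      then have "FArr ?r (F, \<eta>, G) = (FObj ?r F, \<lambda>k\<in>K. \<eta> (FObj (generators K) k), FObj ?r G)"
        using objF objG by (simp add: restriction_functor_def hom_iff discrete_def)
      then have "FArr ?r (F, \<eta>, G) = t \<longleftrightarrow> (\<lambda>k\<in>K. \<eta> (FObj (generators K) k)) = \<theta>"
        by (simp add: t_eq)
      also have "\<dots> \<longleftrightarrow> (\<forall>k\<in>K. \<eta> (generator k) = \<theta> k)"
        using nat_transD(3)[OF nat]
        by (auto simp: fun_eq_iff generators_def extensional_def discrete_def restrict_def)
      finally show ?thesis .
    qed
    then show ?thesis
      unfolding hom_preserving_functor_category using pF pG by auto
  qed
  show "\<exists>!s. s \<in> hom ?P F G \<and> FArr ?r s = t"
    unfolding lift using ex_nat_trans nat_trans_unique by (metis (no_types, lifting))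
qed

text \<open>Freeness by itself says only that some products and sums exist in \<open>CW K\<close>;
  the second conjunct identifies them with the explicit constructions on propositions.\<close>

theorem theorem1:
  fixes K :: "'k set"
  shows "free_category_with_products_and_sums TYPE('o) TYPE('m) K (CW K) (generators K) \<and>
    (\<forall>P\<in>Obj (CW K). \<forall>Q\<in>Obj (CW K).
       is_product (CW K) P Q (prop_product P Q) (proj1 P Q) (proj2 P Q) \<and>
       is_sum (CW K) P Q (prop_sum P Q) (inj1 P Q) (inj2 P Q))"
  unfolding free_category_with_products_and_sums_def
  using category_with_products_and_sums_CW is_functor_generators is_equivalence_restriction
    is_product_CW is_sum_CW by blast

end
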